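(* Let $m\ge1$ and $q\in\mathbb{R}$. (i) For $1\le p<\infty$, $\mathfrak{F}_{p,q}<\infty$ if and only if $q\le1$. (ii) $\mathfrak{F}_{\infty,q}<\infty$ if and only if $q\le1$.
   Context: For a non-empty open $\Omega\subset\mathbb{R}^m$ with $|\Omega|<\infty$, $\lambda_1(\Omega)=\inf_{\varphi\in H_0^1(\Omega)\setminus\{0\}}\int_\Omega|D\varphi|^2/\int_\Omega\varphi^2$, $v_\Omega$ is the unique solution of $-\Delta v=1$, $v\in H_0^1(\Omega)$, and $T_p(\Omega)=\|v_\Omega\|_{L^p(\Omega)}$. For $p\ge1$, $q\in\mathbb{R}$: $F_{p,q}(\Omega)=T_p(\Omega)\lambda_1(\Omega)^q/|\Omega|^{\frac1p+\frac2m(1-q)}$ and $F_{\infty,q}(\Omega)=\|v_\Omega\|_{L^\infty(\Omega)}\lambda_1(\Omega)^q/|\Omega|^{\frac2m(1-q)}$; $\mathfrak{F}_{p,q}=\sup\{F_{p,q}(\Omega):\Omega\text{ open in }\mathbb{R}^m,\ 0<|\Omega|<\infty\}$ and $\mathfrak{F}_{\infty,q}=\sup\{F_{\infty,q}(\Omega):\Omega\text{ open in }\mathbb{R}^m,\ 0<|\Omega|<\infty\}$. *)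

theory Defs
  imports "HOL-Analysis.Analysis"
begin

text \<open>Dimension m = DIM('a). Functions are real-valued on 'a; gradients are 'a-valued.\<close>

definition C1c :: "'a::euclidean_space set \<Rightarrow> ('a \<Rightarrow> real) \<Rightarrow> ('a \<Rightarrow> 'a) \<Rightarrow> bool" where
  "C1c \<Omega> \<phi> G \<longleftrightarrow>
     (\<forall>x. (\<phi> has_derivative (\<lambda>h. G x \<bullet> h)) (at x)) \<and> continuous_on UNIV G \<and>
     compact (closure {x. \<phi> x \<noteq> 0}) \<and> closure {x. \<phi> x \<noteq> 0} \<subseteq> \<Omega>"

text \<open>H_0^1(\<Omega>): closure of C^1_c(\<Omega>) in the H^1 norm; H01 \<Omega> u g means u \<in> H_0^1(\<Omega>)
  with weak gradient g.\<close>
definition H01 :: "'a::euclidean_space set \<Rightarrow> ('a \<Rightarrow> real) \<Rightarrow> ('a \<Rightarrow> 'a) \<Rightarrow> bool" where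
  "H01 \<Omega> u g \<longleftrightarrow>
     u \<in> borel_measurable (lebesgue_on \<Omega>) \<and> g \<in> borel_measurable (lebesgue_on \<Omega>) \<and>
     integrable (lebesgue_on \<Omega>) (\<lambda>x. (u x)\<^sup>2) \<and>
     integrable (lebesgue_on \<Omega>) (\<lambda>x. (norm (g x))\<^sup>2) \<and>
     (\<exists>\<phi> G. (\<forall>n. C1c \<Omega> (\<phi> n) (G n)) \<and>
        (\<lambda>n. integral\<^sup>L (lebesgue_on \<Omega>) (\<lambda>x. (\<phi> n x - u x)\<^sup>2)) \<longlonglongrightarrow> 0 \<and>
        (\<lambda>n. integral\<^sup>L (lebesgue_on \<Omega>) (\<lambda>x. (norm (G n x - g x))\<^sup>2)) \<longlonglongrightarrow> 0)"

definition lambda1 :: "'a::euclidean_space set \<Rightarrow> real" where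
  "lambda1 \<Omega> = Inf {integral\<^sup>L (lebesgue_on \<Omega>) (\<lambda>x. (norm (g x))\<^sup>2) /
                       integral\<^sup>L (lebesgue_on \<Omega>) (\<lambda>x. (u x)\<^sup>2) | u g.
                     H01 \<Omega> u g \<and> integral\<^sup>L (lebesgue_on \<Omega>) (\<lambda>x. (u x)\<^sup>2) \<noteq> 0}"

definition torsion_sol :: "'a::euclidean_space set \<Rightarrow> ('a \<Rightarrow> real) \<Rightarrow> ('a \<Rightarrow> 'a) \<Rightarrow> bool" where
  "torsion_sol \<Omega> v g \<longleftrightarrow> H01 \<Omega> v g \<and>
     (\<forall>\<phi> G. C1c \<Omega> \<phi> G \<longrightarrow>
        integral\<^sup>L (lebesgue_on \<Omega>) (\<lambda>x. g x \<bullet> G x) = integral\<^sup>L (lebesgue_on \<Omega>) \<phi>)"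

definition Lp_norm :: "'a::euclidean_space set \<Rightarrow> real \<Rightarrow> ('a \<Rightarrow> real) \<Rightarrow> real" where
  "Lp_norm \<Omega> p v = (integral\<^sup>L (lebesgue_on \<Omega>) (\<lambda>x. \<bar>v x\<bar> powr p)) powr (1 / p)"

definition Linf_norm :: "'a::euclidean_space set \<Rightarrow> ('a \<Rightarrow> real) \<Rightarrow> real" where
  "Linf_norm \<Omega> v = Inf {C. AE x in lebesgue_on \<Omega>. \<bar>v x\<bar> \<le> C}"

text \<open>T_p(\<Omega>) = \<parallel>v_\<Omega>\<parallel>_p (well defined since v_\<Omega> is unique a.e.).\<close>
definition Tp :: "'a::euclidean_space set \<Rightarrow> real \<Rightarrow> real" where
  "Tp \<Omega> p = (THE t. \<exists>v g. torsion_sol \<Omega> v g \<and> t = Lp_norm \<Omega> p v)"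

definition Tinf :: "'a::euclidean_space set \<Rightarrow> real" where
  "Tinf \<Omega> = (THE t. \<exists>v g. torsion_sol \<Omega> v g \<and> t = Linf_norm \<Omega> v)"

definition Fpq :: "'a::euclidean_space set \<Rightarrow> real \<Rightarrow> real \<Rightarrow> real" where
  "Fpq \<Omega> p q = Tp \<Omega> p * lambda1 \<Omega> powr q /
      measure lebesgue \<Omega> powr (1 / p + 2 / real DIM('a) * (1 - q))"

definition Finfq :: "'a::euclidean_space set \<Rightarrow> real \<Rightarrow> real" where
  "Finfq \<Omega> q = Tinf \<Omega> * lambda1 \<Omega> powr q /
      measure lebesgue \<Omega> powr (2 / real DIM('a) * (1 - q))"

definition admissible :: "'a::euclidean_space set \<Rightarrow> bool" where
  "admissible \<Omega> \<longleftrightarrow> open \<Omega> \<and> 0 < emeasure lebesgue \<Omega> \<and> emeasure lebesgue \<Omega> < \<infinity>"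

definition supFpq :: "'a::euclidean_space itself \<Rightarrow> real \<Rightarrow> real \<Rightarrow> ereal" where
  "supFpq _ p q = (SUP \<Omega> \<in> {\<Omega>::'a set. admissible \<Omega>}. ereal (Fpq \<Omega> p q))"

definition supFinfq :: "'a::euclidean_space itself \<Rightarrow> real \<Rightarrow> ereal" where
  "supFinfq _ q = (SUP \<Omega> \<in> {\<Omega>::'a set. admissible \<Omega>}. ereal (Finfq \<Omega> q))"

end

theory Submission
  imports Defs
begin

text \<open>
  For \<open>q \<le> 1\<close> two scale-invariant estimates suffice, with constants depending only on the dimension \<open>m\<close>.

  A Faber--Krahn bound \<open>\<lambda>\<^sub>1 \<ge> c |\<Omega>| powr (- 2/m)\<close>: for \<open>\<phi>\<close> supported in \<open>\<Omega>\<close> and \<open>x + h \<notin> \<Omega>\<close> one has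
  \<open>\<phi>(x)\<^sup>2 = (\<phi>(x + h) - \<phi>(x))\<^sup>2\<close>; integrating over \<open>x\<close> and over \<open>h\<close> in a ball which is everywhere at least
  half outside \<open>\<Omega>\<close> turns the translation estimate into a Poincare inequality.

  The bound \<open>\<parallel>v\<parallel>\<^sub>\<infinity> \<le> C / \<lambda>\<^sub>1\<close>: testing the equation with \<open>v \<psi>\<^sup>2\<close>, where \<open>|D\<psi>| \<le> sqrt (\<lambda>\<^sub>1 / 2) \<psi>\<close>, bounds the
  averages of \<open>v\<^sup>2\<close> on balls of radius \<open>\<lambda>\<^sub>1 powr (- 1/2)\<close> by a multiple of \<open>\<lambda>\<^sub>1 powr (- 2)\<close>. The function
  \<open>W = sqrt (v\<^sup>2 + \<delta>\<^sup>2) - \<delta>\<close>, extended by zero, satisfies \<open>- \<Delta>W \<le> 1\<close> on the whole space, and a sub-mean-value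
  inequality passes from averages to pointwise values.

  For \<open>q > 1\<close>, \<open>N\<close> unit balls far apart have \<open>\<lambda>\<^sub>1\<close> and the mean of \<open>v\<close> bounded below independently of \<open>N\<close>,
  so the functional grows at least like \<open>N powr (2 (q - 1) / m)\<close>.
\<close>

subsection \<open>Square-integrable functions\<close>

text \<open>The two estimates bound \<open>F\<close> by a constant times
  \<open>(\<lambda>\<^sub>1 |\<Omega>| powr (2/m)) powr (q - 1)\<close>. For q \<le> 1 this exponent
  is not positive, so a lower bound on the bracket is enough; for q > 1 the bracket itself can be
  made large, by adding volume at bounded cost in \<open>\<lambda>\<^sub>1\<close>. Every inequality
  is therefore either proved for C1 functions and passed to the limit in norm, or obtained by
  testing the weak equation. The sign is avoided by working with a smooth substitute for |v|, whose
  derivative is continuous and bounded as the chain rule requires. The parameter \<delta> stays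
  fixed at \<open>1 / \<lambda>\<^sub>1\<close>, the size of the bound being proved, so no limit in
  \<delta> is taken. The weight \<psi> has to satisfy two demands: a gradient dominated by \<psi>
  itself, so that the extra term is absorbed by \<open>\<lambda>\<^sub>1\<close>, and square
  integrability over the whole space, so that the local bound does not involve |\<Omega>|. A
  negative power of a quadratic meets both.\<close>

definition L2 :: "'a measure \<Rightarrow> ('a \<Rightarrow> 'b::euclidean_space) \<Rightarrow> bool" where
  "L2 M f \<longleftrightarrow> f \<in> borel_measurable M \<and> integrable M (\<lambda>x. (norm (f x))\<^sup>2)"

text \<open>Values lie in an arbitrary Euclidean space so that functions and their gradients are
  covered by the same lemmas.\<close>

definition n2 :: "'a measure \<Rightarrow> ('a \<Rightarrow> 'b::euclidean_space) \<Rightarrow> real" where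
  "n2 M f = sqrt (\<integral>x. (norm (f x))\<^sup>2 \<partial>M)"

lemma L2_measurable: "L2 M f \<Longrightarrow> f \<in> borel_measurable M"
  by (simp add: L2_def)

lemma L2_integrable_sq: "L2 M f \<Longrightarrow> integrable M (\<lambda>x. (norm (f x))\<^sup>2)"
  by (simp add: L2_def)

lemma n2_nonneg [simp]: "0 \<le> n2 M f"
  by (simp add: n2_def)

lemma n2_sq: "(n2 M f)\<^sup>2 = (\<integral>x. (norm (f x))\<^sup>2 \<partial>M)"
  by (simp add: n2_def)

lemma L2_bound:
  assumes "L2 M g" "f \<in> borel_measurable M" "AE x in M. norm (f x) \<le> norm (g x)"
  shows "L2 M f"
proof -
  have "integrable M (\<lambda>x. (norm (f x))\<^sup>2)"
  proof (rule Bochner_Integration.integrable_bound[OF L2_integrable_sq[OF assms(1)]])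
    show "(\<lambda>x. (norm (f x))\<^sup>2) \<in> borel_measurable M"
      using assms(2) by measurable
    show "AE x in M. norm ((norm (f x))\<^sup>2) \<le> norm ((norm (g x))\<^sup>2)"
      using assms(3) by eventually_elim (simp add: power_mono)
  qed
  then show ?thesis using assms(2) by (simp add: L2_def)
qed

lemma L2_scaleR: "L2 M f \<Longrightarrow> L2 M (\<lambda>x. c *\<^sub>R f x)"
  by (auto simp: L2_def power_mult_distrib)

lemma L2_minus: "L2 M f \<Longrightarrow> L2 M (\<lambda>x. - f x)"
  by (auto simp: L2_def)

lemma L2_add:
  assumes "L2 M f" "L2 M g"
  shows "L2 M (\<lambda>x. f x + g x)"
proof -
  note [measurable] = assms[THEN L2_measurable]
  have "integrable M (\<lambda>x. (norm (f x + g x))\<^sup>2)"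
  proof (rule Bochner_Integration.integrable_bound)
    show "integrable M (\<lambda>x. 2 * (norm (f x))\<^sup>2 + 2 * (norm (g x))\<^sup>2)"
      using assms by (auto simp: L2_def)
    have "(norm (f x + g x))\<^sup>2 \<le> 2 * (norm (f x))\<^sup>2 + 2 * (norm (g x))\<^sup>2" for x
    proof -
      have "(norm (f x + g x))\<^sup>2 \<le> (norm (f x) + norm (g x))\<^sup>2"
        by (intro power_mono norm_triangle_ineq) auto
      also have "\<dots> \<le> 2 * (norm (f x))\<^sup>2 + 2 * (norm (g x))\<^sup>2"
        using sum_squares_bound[of "norm (f x)" "norm (g x)"] by (simp add: power2_sum)
      finally show ?thesis .
    qed
    then show "AE x in M. norm ((norm (f x + g x))\<^sup>2) \<le> norm (2 * (norm (f x))\<^sup>2 + 2 * (norm (g x))\<^sup>2)"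
      by auto
  qed measurable
  then show ?thesis by (simp add: L2_def)
qed

lemma L2_diff: "L2 M f \<Longrightarrow> L2 M g \<Longrightarrow> L2 M (\<lambda>x. f x - g x)"
  using L2_add[OF _ L2_minus, of M f g] by simp

lemma L2_mult_bounded:
  assumes "L2 M f" and [measurable]: "\<psi> \<in> borel_measurable M" and "\<And>x. \<bar>\<psi> x\<bar> \<le> C"
  shows "L2 M (\<lambda>x. \<psi> x *\<^sub>R f x)"
proof (rule L2_bound[OF L2_scaleR[OF assms(1), of C]])
  show "(\<lambda>x. \<psi> x *\<^sub>R f x) \<in> borel_measurable M"
    using L2_measurable[OF assms(1)] by measurable
  have "0 \<le> C" using assms(3) by (meson abs_ge_zero order_trans)
  then show "AE x in M. norm (\<psi> x *\<^sub>R f x) \<le> norm (C *\<^sub>R f x)"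
    using assms(3) by (auto intro!: AE_I2 mult_right_mono)
qed

lemma L2_real_scaleR_bounded:
  fixes u :: "'a \<Rightarrow> real" and H :: "'a \<Rightarrow> 'b::euclidean_space"
  assumes "L2 M u" and [measurable]: "H \<in> borel_measurable M" and "\<And>x. norm (H x) \<le> C"
  shows "L2 M (\<lambda>x. u x *\<^sub>R H x)"
proof (rule L2_bound[OF L2_scaleR[OF assms(1), of C]])
  show "(\<lambda>x. u x *\<^sub>R H x) \<in> borel_measurable M"
    using L2_measurable[OF assms(1)] by measurable
  have "0 \<le> C" using assms(3) by (meson norm_ge_zero order_trans)
  then show "AE x in M. norm (u x *\<^sub>R H x) \<le> norm (C *\<^sub>R u x)"
    using assms(3) by (auto intro!: AE_I2 mult_left_mono simp: abs_mult mult.commute[of C])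
qed

lemma L2_inner_integrable:
  assumes "L2 M f" "L2 M g"
  shows "integrable M (\<lambda>x. f x \<bullet> g x)"
proof (rule Bochner_Integration.integrable_bound)
  show "integrable M (\<lambda>x. (norm (f x))\<^sup>2 + (norm (g x))\<^sup>2)"
    using assms by (auto simp: L2_def)
  show "(\<lambda>x. f x \<bullet> g x) \<in> borel_measurable M"
    using assms[THEN L2_measurable] by measurable
  have "\<bar>f x \<bullet> g x\<bar> \<le> (norm (f x))\<^sup>2 + (norm (g x))\<^sup>2" for x
  proof -
    have "\<bar>f x \<bullet> g x\<bar> \<le> norm (f x) * norm (g x)" by (rule Cauchy_Schwarz_ineq2)
    also have "\<dots> \<le> 2 * norm (f x) * norm (g x)" by simp
    also have "\<dots> \<le> (norm (f x))\<^sup>2 + (norm (g x))\<^sup>2" by (rule sum_squares_bound)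
    finally show ?thesis .
  qed
  then show "AE x in M. norm (f x \<bullet> g x) \<le> norm ((norm (f x))\<^sup>2 + (norm (g x))\<^sup>2)"
    by (simp add: order_trans[OF _ abs_ge_self])
qed

lemma L2_mult_integrable:
  fixes f g :: "'a \<Rightarrow> real"
  shows "L2 M f \<Longrightarrow> L2 M g \<Longrightarrow> integrable M (\<lambda>x. f x * g x)"
  using L2_inner_integrable[of M f g] by simp

lemma L2_integrable:
  fixes f :: "'a \<Rightarrow> real"
  assumes "finite_measure M" "L2 M f"
  shows "integrable M f"
proof -
  interpret finite_measure M by fact
  have "L2 M (\<lambda>x. 1::real)" by (simp add: L2_def)
  from L2_mult_integrable[OF assms(2) this] show ?thesis by simp
qed

lemma n2_expand:
  assumes "L2 M f" "L2 M g"
  shows "(n2 M (\<lambda>x. f x + t *\<^sub>R g x))\<^sup>2 = (n2 M f)\<^sup>2 + 2 * t * (\<integral>x. f x \<bullet> g x \<partial>M) + t\<^sup>2 * (n2 M g)\<^sup>2"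
proof -
  have eq: "(norm (f x + t *\<^sub>R g x))\<^sup>2 = (norm (f x))\<^sup>2 + 2 * t * (f x \<bullet> g x) + t\<^sup>2 * (norm (g x))\<^sup>2" for x
    unfolding power2_norm_eq_inner by (simp add: algebra_simps inner_commute power2_eq_square)
  show ?thesis
    unfolding n2_sq eq using assms L2_inner_integrable[OF assms]
    by (simp add: L2_integrable_sq)
qed

text \<open>The squared norm of \<open>f + t g\<close> is a quadratic in \<open>t\<close> that is
  never negative; its discriminant gives the claim.\<close>

lemma L2_Cauchy_Schwarz:
  assumes "L2 M f" "L2 M g"
  shows "\<bar>\<integral>x. f x \<bullet> g x \<partial>M\<bar> \<le> n2 M f * n2 M g"
proof -
  define A B c where "A = n2 M f" and "B = n2 M g" and "c = (\<integral>x. f x \<bullet> g x \<partial>M)"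
  have q: "0 \<le> A\<^sup>2 + 2 * t * c + t\<^sup>2 * B\<^sup>2" for t
    using n2_expand[OF assms, of t] unfolding A_def B_def c_def by (metis zero_le_power2)
  have "\<bar>c\<bar> \<le> A * B"
  proof (cases "B = 0")
    case True
    have "c = 0"
    proof (rule ccontr)
      assume "c \<noteq> 0"
      \<comment> \<open>If \<open>B = 0\<close> the quadratic is affine in \<open>t\<close>; this
        \<open>t\<close> gives it the value -1.\<close>
      then show False using q[of "-(A\<^sup>2 + 1) / (2 * c)"] True by (simp add: field_simps)
    qed
    then show ?thesis by (simp add: A_def B_def)
  next
    case False
    then have "B\<^sup>2 > 0" by simp
    have "0 \<le> A\<^sup>2 - c\<^sup>2 / B\<^sup>2"
      \<comment> \<open>The minimiser of the quadratic.\<close>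
      using q[of "- c / B\<^sup>2"] False by (simp add: field_simps power2_eq_square)
    then have "c\<^sup>2 \<le> (A * B)\<^sup>2"
      using \<open>B\<^sup>2 > 0\<close> by (simp add: field_simps power_mult_distrib)
    then show ?thesis
      by (metis A_def B_def abs_le_square_iff abs_of_nonneg mult_nonneg_nonneg n2_nonneg)
  qed
  then show ?thesis by (simp add: A_def B_def c_def)
qed

lemma n2_triangle:
  assumes "L2 M f" "L2 M g"
  shows "n2 M (\<lambda>x. f x + g x) \<le> n2 M f + n2 M g"
proof (rule power2_le_imp_le)
  show "(n2 M (\<lambda>x. f x + g x))\<^sup>2 \<le> (n2 M f + n2 M g)\<^sup>2"
    using n2_expand[OF assms, of 1] L2_Cauchy_Schwarz[OF assms]
    by (simp add: power2_sum)
qed simp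

lemma n2_scaleR: "n2 M (\<lambda>x. c *\<^sub>R f x) = \<bar>c\<bar> * n2 M f"
  by (simp add: n2_def power_mult_distrib real_sqrt_mult)

lemma n2_minus: "n2 M (\<lambda>x. - f x) = n2 M f"
  by (simp add: n2_def)

lemma n2_diff_commute: "n2 M (\<lambda>x. f x - g x) = n2 M (\<lambda>x. g x - f x)"
  by (simp add: n2_def norm_minus_commute)

lemma n2_mono:
  assumes "L2 M g" "f \<in> borel_measurable M" "AE x in M. norm (f x) \<le> norm (g x)"
  shows "n2 M f \<le> n2 M g"
proof -
  have "L2 M f" by (rule L2_bound[OF assms])
  then show ?thesis
    unfolding n2_def using assms
    by (intro real_sqrt_le_mono integral_mono_AE) (auto simp: L2_def elim!: eventually_mono intro!: power_mono)
qed

lemma n2_triangle_diff: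
  assumes "L2 M f" "L2 M g"
  shows "\<bar>n2 M f - n2 M g\<bar> \<le> n2 M (\<lambda>x. f x - g x)"
  using n2_triangle[OF L2_diff[OF assms] assms(2)] n2_triangle[OF L2_diff[OF assms(2,1)] assms(1)]
    n2_diff_commute[of M f g] by simp

lemma n2_tendsto:
  assumes "\<And>n. L2 M (f n)" "L2 M F" "(\<lambda>n. n2 M (\<lambda>x. f n x - F x)) \<longlonglongrightarrow> 0"
  shows "(\<lambda>n. n2 M (f n)) \<longlonglongrightarrow> n2 M F"
proof -
  have "(\<lambda>n. n2 M (f n) - n2 M F) \<longlonglongrightarrow> 0"
    by (rule Lim_null_comparison[OF _ assms(3)]) (simp add: n2_triangle_diff assms)
  then show ?thesis by (simp add: LIM_zero_iff)
qed

lemma L2_inner_tendsto: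
  assumes "\<And>n. L2 M (f n)" "L2 M F" "(\<lambda>n. n2 M (\<lambda>x. f n x - F x)) \<longlonglongrightarrow> 0" "L2 M g"
  shows "(\<lambda>n. \<integral>x. f n x \<bullet> g x \<partial>M) \<longlonglongrightarrow> (\<integral>x. F x \<bullet> g x \<partial>M)"
proof -
  have "(\<lambda>n. (\<integral>x. f n x \<bullet> g x \<partial>M) - (\<integral>x. F x \<bullet> g x \<partial>M)) \<longlonglongrightarrow> 0"
  proof (rule Lim_null_comparison)
    show "\<forall>\<^sub>F n in sequentially. norm ((\<integral>x. f n x \<bullet> g x \<partial>M) - (\<integral>x. F x \<bullet> g x \<partial>M))
        \<le> n2 M (\<lambda>x. f n x - F x) * n2 M g"
    proof (rule always_eventually, rule allI)
      fix n
      have "(\<integral>x. f n x \<bullet> g x \<partial>M) - (\<integral>x. F x \<bullet> g x \<partial>M) = (\<integral>x. (f n x - F x) \<bullet> g x \<partial>M)"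
        by (simp add: inner_diff_left L2_inner_integrable assms)
      then show "norm ((\<integral>x. f n x \<bullet> g x \<partial>M) - (\<integral>x. F x \<bullet> g x \<partial>M)) \<le> n2 M (\<lambda>x. f n x - F x) * n2 M g"
        using L2_Cauchy_Schwarz[OF L2_diff[OF assms(1,2)] assms(4)] by simp
    qed
    show "(\<lambda>n. n2 M (\<lambda>x. f n x - F x) * n2 M g) \<longlonglongrightarrow> 0"
      using tendsto_mult[OF assms(3) tendsto_const] by simp
  qed
  then show ?thesis by (simp add: LIM_zero_iff)
qed

lemma L2_integral_tendsto:
  fixes f :: "nat \<Rightarrow> 'a \<Rightarrow> real"
  assumes "finite_measure M" "\<And>n. L2 M (f n)" "L2 M F" "(\<lambda>n. n2 M (\<lambda>x. f n x - F x)) \<longlonglongrightarrow> 0"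
  shows "(\<lambda>n. \<integral>x. f n x \<partial>M) \<longlonglongrightarrow> (\<integral>x. F x \<partial>M)"
proof -
  interpret finite_measure M by fact
  have "L2 M (\<lambda>x. 1::real)" by (simp add: L2_def)
  from L2_inner_tendsto[OF assms(2-4) this] show ?thesis by simp
qed

lemma n2_tendsto_subseq_AE:
  assumes "\<And>n. L2 M (f n)" "L2 M F" "(\<lambda>n. n2 M (\<lambda>x. f n x - F x)) \<longlonglongrightarrow> 0"
  obtains r :: "nat \<Rightarrow> nat" where "strict_mono r" "AE x in M. (\<lambda>n. f (r n) x) \<longlonglongrightarrow> F x"
proof -
  have "(\<lambda>n. (n2 M (\<lambda>x. f n x - F x))\<^sup>2) \<longlonglongrightarrow> 0"
    using tendsto_power[OF assms(3), of 2] by simp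
  then have "(\<lambda>n. \<integral>x. norm ((norm (f n x - F x))\<^sup>2) \<partial>M) \<longlonglongrightarrow> 0"
    by (simp add: n2_sq)
  from tendsto_L1_AE_subseq[OF _ this] obtain r :: "nat \<Rightarrow> nat" where r: "strict_mono r"
    "AE x in M. (\<lambda>n. (norm (f (r n) x - F x))\<^sup>2) \<longlonglongrightarrow> 0"
    using L2_integrable_sq[OF L2_diff[OF assms(1,2)]] by auto
  have "AE x in M. (\<lambda>n. f (r n) x) \<longlonglongrightarrow> F x"
    using r(2)
  proof eventually_elim
    case (elim x)
    from tendsto_real_sqrt[OF this] have "(\<lambda>n. norm (f (r n) x - F x)) \<longlonglongrightarrow> 0" by simp
    then show ?case using LIM_zero_iff tendsto_norm_zero_iff by blast
  qed
  with r(1) show ?thesis by (rule that)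
qed

text \<open>Riesz-Fischer. A rapidly converging subsequence converges almost everywhere, and Fatou's
  lemma turns the Cauchy bounds into bounds on the distance to the pointwise limit.\<close>

lemma L2_complete:
  fixes f :: "nat \<Rightarrow> 'a \<Rightarrow> 'b::euclidean_space"
  assumes L: "\<And>n. L2 M (f n)"
    and cau: "\<And>e. e > 0 \<Longrightarrow> \<exists>N. \<forall>m\<ge>N. \<forall>n\<ge>N. n2 M (\<lambda>x. f m x - f n x) < e"
  obtains F where "L2 M F" "(\<lambda>n. n2 M (\<lambda>x. f n x - F x)) \<longlonglongrightarrow> 0"
proof -
  note [measurable] = L2_measurable[OF L]
  have "\<exists>N. \<forall>m\<ge>N. \<forall>n\<ge>N. n2 M (\<lambda>x. f m x - f n x) < (1/2)^k" for k
    by (rule cau) simp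
  then obtain N where N: "\<And>k m n. m \<ge> N k \<Longrightarrow> n \<ge> N k \<Longrightarrow> n2 M (\<lambda>x. f m x - f n x) < (1/2)^k"
    by metis
  \<comment> \<open>The \<open>max\<close> keeps \<open>r\<close> strictly increasing and at the
    same time \<open>r k\<close> at least \<open>N k\<close>.\<close>
  define r where "r = rec_nat (N 0) (\<lambda>k rk. Suc (max rk (N (Suc k))))"
  have rSuc: "r (Suc k) = Suc (max (r k) (N (Suc k)))" for k by (simp add: r_def)
  have rN: "r k \<ge> N k" for k by (cases k) (auto simp: rSuc r_def)
  have rmono: "strict_mono r" by (rule strict_monoI_Suc) (simp add: rSuc)
  define d where "d k x = f (r (Suc k)) x - f (r k) x" for k x
  have dm [measurable]: "d k \<in> borel_measurable M" for k unfolding d_def by measurable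
  have dL: "L2 M (d k)" for k unfolding d_def by (intro L2_diff L)
  have dn: "n2 M (d k) \<le> (1/2)^k" for k
    unfolding d_def using N[of k "r (Suc k)" "r k"] rN[of k] rmono
    by (meson less_eq_real_def order_trans strict_monoD lessI less_imp_le)
  have dn2: "(\<integral>x. (norm (d k x))\<^sup>2 \<partial>M) \<le> (1/4)^k" for k
  proof -
    have "(n2 M (d k))\<^sup>2 \<le> ((1/2)^k)\<^sup>2" by (intro power_mono dn) simp
    also have "((1/2)^k)\<^sup>2 = ((1/4)^k :: real)"
      by (simp add: power2_eq_square flip: power_mult_distrib)
    finally show ?thesis by (simp add: n2_sq)
  qed
  \<comment> \<open>The integral of the k-th term is at most \<open>2^k * (1/4)^k\<close>. The
    factor \<open>2^k\<close> is there so that bounded terms already force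
    \<open>norm (d k x)\<close> to decay geometrically.\<close>
  have summ: "AE x in M. summable (\<lambda>k. 2^k * (norm (d k x))\<^sup>2)"
  proof -
    have "(\<integral>\<^sup>+x. (\<Sum>k. ennreal (2^k * (norm (d k x))\<^sup>2)) \<partial>M) = (\<Sum>k. \<integral>\<^sup>+x. ennreal (2^k * (norm (d k x))\<^sup>2) \<partial>M)"
      by (rule nn_integral_suminf) measurable
    also have "\<dots> \<le> (\<Sum>k. ennreal ((1/2)^k))"
    proof (rule suminf_le)
      fix k
      have "(\<integral>\<^sup>+x. ennreal (2^k * (norm (d k x))\<^sup>2) \<partial>M) = ennreal (\<integral>x. 2^k * (norm (d k x))\<^sup>2 \<partial>M)"
        by (rule nn_integral_eq_integral) (use L2_integrable_sq[OF dL] in auto)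
      also have "\<dots> = ennreal (2^k * (\<integral>x. (norm (d k x))\<^sup>2 \<partial>M))" by simp
      also have "\<dots> \<le> ennreal (2^k * (1/4)^k)"
        by (intro ennreal_leI mult_left_mono dn2) simp
      also have "2^k * (1/4)^k = ((1/2)^k :: real)" by (simp flip: power_mult_distrib)
      finally show "(\<integral>\<^sup>+x. ennreal (2^k * (norm (d k x))\<^sup>2) \<partial>M) \<le> ennreal ((1/2)^k)" .
    qed auto
    also have "\<dots> = ennreal (\<Sum>k. (1/2)^k)"
      by (rule suminf_ennreal2) (auto intro: summable_geometric)
    also have "\<dots> < \<infinity>" by simp
    finally have "AE x in M. (\<Sum>k. ennreal (2^k * (norm (d k x))\<^sup>2)) \<noteq> \<infinity>"
      by (intro nn_integral_PInf_AE) auto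
    then show ?thesis
      by eventually_elim (auto intro!: summable_suminf_not_top)
  qed
  define F where "F x = lim (\<lambda>k. f (r k) x)" for x
  have conv: "AE x in M. (\<lambda>k. f (r k) x) \<longlonglongrightarrow> F x"
    using summ
  proof eventually_elim
    case (elim x)
    from summable_LIMSEQ_zero[OF elim] have "Bseq (\<lambda>k. 2^k * (norm (d k x))\<^sup>2)"
      by (intro convergent_imp_Bseq) (auto simp: convergent_def)
    then obtain K where K: "K > 0" "\<And>k. \<bar>2^k * (norm (d k x))\<^sup>2\<bar> \<le> K"
      by (auto simp: Bseq_def)
    have bnd: "norm (d k x) \<le> sqrt K * (sqrt (1/2))^k" for k
    proof (rule power2_le_imp_le)
      have "(norm (d k x))\<^sup>2 \<le> K / 2^k" using K(2)[of k] by (simp add: field_simps)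
      also have "\<dots> = (sqrt K * (sqrt (1/2))^k)\<^sup>2"
      proof -
        have "((sqrt (1/2))^k)\<^sup>2 = ((sqrt (1/2))\<^sup>2)^k" by (metis power_mult mult.commute)
        also have "\<dots> = (1/2::real)^k" by simp
        finally show ?thesis using K(1) unfolding power_mult_distrib by (simp add: power_divide)
      qed
      finally show "(norm (d k x))\<^sup>2 \<le> (sqrt K * (sqrt (1/2))^k)\<^sup>2" .
    qed (use K in simp)
    have "summable (\<lambda>k. sqrt K * (sqrt (1/2))^k)"
      by (intro summable_mult summable_geometric) simp
    then have "summable (\<lambda>k. d k x)"
      by (rule summable_comparison_test') (use bnd in auto)
    then have "convergent (\<lambda>n. \<Sum>k<n. d k x)" by (simp add: summable_iff_convergent)
    moreover have "(\<Sum>k<n. d k x) = f (r n) x - f (r 0) x" for n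
      unfolding d_def by (rule sum_lessThan_telescope)
    ultimately have "convergent (\<lambda>n. f (r n) x - f (r 0) x)" by simp
    then have "convergent (\<lambda>n. (f (r n) x - f (r 0) x) + f (r 0) x)"
      by (intro convergent_add convergent_const)
    then have "convergent (\<lambda>n. f (r n) x)" by simp
    then show ?case by (simp add: F_def convergent_LIMSEQ_iff)
  qed
  have Fm [measurable]: "F \<in> borel_measurable M"
    unfolding F_def by (rule borel_measurable_lim_metric) measurable
  \<comment> \<open>Fatou along the subsequence; \<open>n\<close> itself need not belong to
    it.\<close>
  have key: "(\<integral>\<^sup>+x. ennreal ((norm (F x - f n x))\<^sup>2) \<partial>M) \<le> ennreal (((1/2)^k)\<^sup>2)" if n: "n \<ge> N k" for n k
  proof -
    have "(\<integral>\<^sup>+x. ennreal ((norm (F x - f n x))\<^sup>2) \<partial>M)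
        = (\<integral>\<^sup>+x. liminf (\<lambda>j. ennreal ((norm (f (r j) x - f n x))\<^sup>2)) \<partial>M)"
    proof (rule nn_integral_cong_AE)
      show "AE x in M. ennreal ((norm (F x - f n x))\<^sup>2) = liminf (\<lambda>j. ennreal ((norm (f (r j) x - f n x))\<^sup>2))"
        using conv
      proof eventually_elim
        case (elim x)
        then have "(\<lambda>j. ennreal ((norm (f (r j) x - f n x))\<^sup>2)) \<longlonglongrightarrow> ennreal ((norm (F x - f n x))\<^sup>2)"
          by (intro tendsto_intros)
        then show ?case by (intro lim_imp_Liminf[symmetric]) auto
      qed
    qed
    also have "\<dots> \<le> liminf (\<lambda>j. \<integral>\<^sup>+x. ennreal ((norm (f (r j) x - f n x))\<^sup>2) \<partial>M)"
      by (rule nn_integral_liminf) measurable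
    also have "\<dots> \<le> ennreal (((1/2)^k)\<^sup>2)"
    proof -
      have "\<forall>\<^sub>F j in sequentially. (\<integral>\<^sup>+x. ennreal ((norm (f (r j) x - f n x))\<^sup>2) \<partial>M) \<le> ennreal (((1/2)^k)\<^sup>2)"
        using eventually_ge_at_top[of k]
      proof eventually_elim
        case (elim j)
        have "r j \<ge> r k" using rmono elim by (simp add: strict_mono_less_eq)
        then have "n2 M (\<lambda>x. f (r j) x - f n x) < (1/2)^k" using N[of k "r j" n] rN[of k] n by simp
        then have "(n2 M (\<lambda>x. f (r j) x - f n x))\<^sup>2 \<le> ((1/2)^k)\<^sup>2" by (intro power_mono) auto
        then show ?case
          by (subst nn_integral_eq_integral) (use L2_integrable_sq[OF L2_diff[OF L L]] in \<open>auto simp: n2_sq intro!: ennreal_leI\<close>)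
      qed
      then have "liminf (\<lambda>j. \<integral>\<^sup>+x. ennreal ((norm (f (r j) x - f n x))\<^sup>2) \<partial>M) \<le> liminf (\<lambda>j. ennreal (((1/2)^k)\<^sup>2))"
        by (rule Liminf_mono)
      then show ?thesis by (simp add: Liminf_const)
    qed
    finally show ?thesis .
  qed
  have LFn: "L2 M (\<lambda>x. F x - f n x)" if "n \<ge> N 0" for n
    unfolding L2_def
  proof
    show "integrable M (\<lambda>x. (norm (F x - f n x))\<^sup>2)"
      by (rule integrableI_nonneg) (use key[OF that] in \<open>auto intro: order_le_less_trans\<close>)
  qed measurable
  have LF: "L2 M F"
    using L2_add[OF LFn[OF order_refl] L[of "N 0"]] by simp
  have n2b: "n2 M (\<lambda>x. f n x - F x) \<le> (1/2)^k" if "n \<ge> N k" for n k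
  proof -
    have "(\<integral>\<^sup>+x. ennreal ((norm (F x - f n x))\<^sup>2) \<partial>M) = ennreal ((n2 M (\<lambda>x. F x - f n x))\<^sup>2)"
      unfolding n2_sq by (rule nn_integral_eq_integral) (use L2_integrable_sq[OF L2_diff[OF LF L]] in auto)
    with key[OF that] have "(n2 M (\<lambda>x. F x - f n x))\<^sup>2 \<le> ((1/2)^k)\<^sup>2"
      by (simp add: ennreal_le_iff)
    then show ?thesis by (metis n2_diff_commute power2_le_imp_le zero_le_divide_1_iff zero_le_numeral zero_le_power)
  qed
  have "(\<lambda>n. n2 M (\<lambda>x. f n x - F x)) \<longlonglongrightarrow> 0"
  proof (rule LIMSEQ_I)
    fix e :: real assume "e > 0"
    then obtain k where "(1/2)^k < e" using real_arch_pow_inv[of e "1/2"] by auto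
    then show "\<exists>N. \<forall>n\<ge>N. norm (n2 M (\<lambda>x. f n x - F x) - 0) < e"
      using n2b[of k] by (intro exI[of _ "N k"]) (auto intro: order_le_less_trans)
  qed
  with LF show ?thesis by (rule that)
qed

subsection \<open>Compactly supported functions and the space \<open>H\<^sub>0\<^sup>1\<close>\<close>

lemma integrable_lborel_compact_support:
  fixes f :: "'a::euclidean_space \<Rightarrow> 'b::{banach, second_countable_topology}"
  assumes "continuous_on UNIV f" "compact K" "\<And>x. x \<notin> K \<Longrightarrow> f x = 0"
  shows "integrable lborel f"
proof -
  have "integrable lborel (\<lambda>x. indicator K x *\<^sub>R f x)"
    by (rule borel_integrable_compact[OF assms(2)]) (rule continuous_on_subset[OF assms(1)], simp)
  moreover have "(\<lambda>x. indicator K x *\<^sub>R f x) = f"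
    using assms(3) by (auto simp: indicator_def)
  ultimately show ?thesis by simp
qed

lemma borel_measurable_lebesgue_on:
  fixes f :: "'a::euclidean_space \<Rightarrow> 'b::topological_space"
  assumes "f \<in> borel_measurable borel"
  shows "f \<in> borel_measurable (lebesgue_on S)"
  using assms by (intro measurable_restrict_space1 measurable_completion) simp

text \<open>The definitions integrate over \<open>lebesgue_on \<Omega>\<close>, while Fubini,
  translations and dilations are used over \<open>lborel\<close>. Test functions vanish off
  \<Omega>, so their integrals can be moved between the two.\<close>

lemma lebesgue_on_eq_lborel:
  fixes f :: "'a::euclidean_space \<Rightarrow> 'b::{banach, second_countable_topology}"
  assumes "f \<in> borel_measurable borel" "S \<in> sets lebesgue" "\<And>x. x \<notin> S \<Longrightarrow> f x = 0"
  shows integrable_lebesgue_on_eq_lborel: "integrable (lebesgue_on S) f \<longleftrightarrow> integrable lborel f"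
    and integral_lebesgue_on_eq_lborel: "integral\<^sup>L (lebesgue_on S) f = integral\<^sup>L lborel f"
proof -
  have eq: "(\<lambda>x. indicator S x *\<^sub>R f x) = f"
    using assms(3) by (auto simp: indicator_def)
  have f: "f \<in> lborel \<rightarrow>\<^sub>M borel" using assms(1) by simp
  show "integrable (lebesgue_on S) f \<longleftrightarrow> integrable lborel f"
    by (subst integrable_restrict_space) (simp_all add: assms eq integrable_completion[OF f])
  show "integral\<^sup>L (lebesgue_on S) f = integral\<^sup>L lborel f"
    by (subst integral_restrict_space) (simp_all add: assms eq integral_completion[OF f])
qed

section \<open>C1 functions with compact support\<close>

lemma C1cI:
  assumes "\<And>x. (\<phi> has_derivative (\<lambda>h. G x \<bullet> h)) (at x)" "continuous_on UNIV G"
    "compact K" "K \<subseteq> \<Omega>" "\<And>x. x \<notin> K \<Longrightarrow> \<phi> x = 0"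
  shows "C1c \<Omega> \<phi> G"
proof -
  have sub: "closure {x. \<phi> x \<noteq> 0} \<subseteq> K"
    using assms(5) by (intro closure_minimal compact_imp_closed[OF assms(3)]) auto
  then have "compact (closure {x. \<phi> x \<noteq> 0})"
    by (metis assms(3) closed_closure closed_Int_compact inf.absorb1)
  then show ?thesis using assms sub by (auto simp: C1c_def)
qed

text \<open>The gradient vanishes off the support as well: there the function is zero on an open
  set, and derivatives are unique.\<close>

lemma C1cE:
  assumes "C1c \<Omega> \<phi> G"
  obtains K where "compact K" "K \<subseteq> \<Omega>" "\<And>x. x \<notin> K \<Longrightarrow> \<phi> x = 0" "\<And>x. x \<notin> K \<Longrightarrow> G x = 0"
    "continuous_on UNIV \<phi>" "continuous_on UNIV G" "\<And>x. (\<phi> has_derivative (\<lambda>h. G x \<bullet> h)) (at x)"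
proof -
  define K where "K = closure {x. \<phi> x \<noteq> 0}"
  have K: "compact K" "K \<subseteq> \<Omega>" and G: "continuous_on UNIV G"
    and d: "\<And>x. (\<phi> has_derivative (\<lambda>h. G x \<bullet> h)) (at x)"
    using assms by (auto simp: C1c_def K_def)
  have z: "\<phi> x = 0" if "x \<notin> K" for x
    using that closure_subset[of "{x. \<phi> x \<noteq> 0}"] by (auto simp: K_def)
  have z': "G x = 0" if "x \<notin> K" for x
  proof -
    have "(\<phi> has_derivative (\<lambda>h. 0)) (at x)"
      by (rule has_derivative_transform_within_open[where f="\<lambda>_. 0" and s="- K"])
         (use that z compact_imp_closed[OF K(1)] in \<open>auto simp: open_Compl\<close>)
    from has_derivative_unique[OF this d[of x]] have "(\<lambda>h. 0) = (\<lambda>h. G x \<bullet> h)" .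
    then have "G x \<bullet> G x = 0" by metis
    then show ?thesis by simp
  qed
  have "continuous_on UNIV \<phi>"
    using d by (auto intro!: continuous_at_imp_continuous_on has_derivative_continuous)
  then show ?thesis using that K z z' G d by blast
qed

lemma C1c_continuous:
  assumes "C1c \<Omega> \<phi> G"
  shows "continuous_on UNIV \<phi>" "continuous_on UNIV G"
  by (rule C1cE[OF assms], blast)+

lemma C1c_borel:
  assumes "C1c \<Omega> \<phi> G"
  shows "\<phi> \<in> borel_measurable borel" "G \<in> borel_measurable borel"
  using C1c_continuous[OF assms] by (auto intro: borel_measurable_continuous_onI)

lemma C1c_outside:
  assumes "C1c \<Omega> \<phi> G" "x \<notin> \<Omega>"
  shows "\<phi> x = 0" "G x = 0"
  by (rule C1cE[OF assms(1)], use assms(2) in blast)+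

lemma C1c_integrable_lborel:
  assumes "C1c \<Omega> \<phi> G"
  shows "integrable lborel \<phi>" "integrable lborel (\<lambda>x. (\<phi> x)\<^sup>2)" "integrable lborel (\<lambda>x. (norm (G x))\<^sup>2)"
proof -
  from assms obtain K where K: "compact K" "\<And>x. x \<notin> K \<Longrightarrow> \<phi> x = 0" "\<And>x. x \<notin> K \<Longrightarrow> G x = 0"
    "continuous_on UNIV \<phi>" "continuous_on UNIV G" by (elim C1cE) blast
  show "integrable lborel \<phi>" "integrable lborel (\<lambda>x. (\<phi> x)\<^sup>2)" "integrable lborel (\<lambda>x. (norm (G x))\<^sup>2)"
    by (rule integrable_lborel_compact_support[OF _ K(1)]; use K in \<open>auto intro!: continuous_intros\<close>)+
qed

lemma C1c_zero: "C1c \<Omega> (\<lambda>x. 0) (\<lambda>x. 0)"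
  by (rule C1cI[where K="{}"]) auto

lemma C1c_add_scaled:
  assumes "C1c \<Omega> \<phi> G" "C1c \<Omega> \<psi> H"
  shows "C1c \<Omega> (\<lambda>x. \<phi> x + t * \<psi> x) (\<lambda>x. G x + t *\<^sub>R H x)"
proof -
  from assms(1) obtain K where K: "compact K" "K \<subseteq> \<Omega>" "\<And>x. x \<notin> K \<Longrightarrow> \<phi> x = 0"
    "continuous_on UNIV G" "\<And>x. (\<phi> has_derivative (\<lambda>h. G x \<bullet> h)) (at x)" by (elim C1cE) blast
  from assms(2) obtain K' where K': "compact K'" "K' \<subseteq> \<Omega>" "\<And>x. x \<notin> K' \<Longrightarrow> \<psi> x = 0"
    "continuous_on UNIV H" "\<And>x. (\<psi> has_derivative (\<lambda>h. H x \<bullet> h)) (at x)" by (elim C1cE) blast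
  show ?thesis
  proof (rule C1cI[where K="K \<union> K'"])
    show "((\<lambda>x. \<phi> x + t * \<psi> x) has_derivative (\<lambda>h. (G x + t *\<^sub>R H x) \<bullet> h)) (at x)" for x
      using has_derivative_add[OF K(5) has_derivative_mult_right[OF K'(5), of t], of x]
      by (simp add: inner_add_left)
  qed (use K K' in \<open>auto intro!: continuous_intros\<close>)
qed

lemma C1c_mult:
  assumes "C1c \<Omega> \<phi> G" "\<And>x. (\<psi> has_derivative (\<lambda>h. H x \<bullet> h)) (at x)" "continuous_on UNIV H"
  shows "C1c \<Omega> (\<lambda>x. \<psi> x * \<phi> x) (\<lambda>x. \<psi> x *\<^sub>R G x + \<phi> x *\<^sub>R H x)"
proof -
  from assms(1) obtain K where K: "compact K" "K \<subseteq> \<Omega>" "\<And>x. x \<notin> K \<Longrightarrow> \<phi> x = 0"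
    "continuous_on UNIV \<phi>" "continuous_on UNIV G" "\<And>x. (\<phi> has_derivative (\<lambda>h. G x \<bullet> h)) (at x)" by (elim C1cE) blast
  have c: "continuous_on UNIV \<psi>"
    using assms(2) by (auto intro!: continuous_at_imp_continuous_on has_derivative_continuous)
  show ?thesis
  proof (rule C1cI[where K=K])
    show "((\<lambda>x. \<psi> x * \<phi> x) has_derivative (\<lambda>h. (\<psi> x *\<^sub>R G x + \<phi> x *\<^sub>R H x) \<bullet> h)) (at x)" for x
      using has_derivative_mult[OF assms(2)[of x] K(6)[of x]]
      by (simp add: inner_add_left mult.commute)
  qed (use K c assms(3) in \<open>auto intro!: continuous_intros\<close>)
qed

lemma C1c_compose:
  fixes \<beta> :: "real \<Rightarrow> real"
  assumes "C1c \<Omega> \<phi> G" "\<And>t. (\<beta> has_real_derivative \<beta>' t) (at t)" "continuous_on UNIV \<beta>'" "\<beta> 0 = 0"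
  shows "C1c \<Omega> (\<lambda>x. \<beta> (\<phi> x)) (\<lambda>x. \<beta>' (\<phi> x) *\<^sub>R G x)"
proof -
  from assms(1) obtain K where K: "compact K" "K \<subseteq> \<Omega>" "\<And>x. x \<notin> K \<Longrightarrow> \<phi> x = 0"
    "continuous_on UNIV \<phi>" "continuous_on UNIV G" "\<And>x. (\<phi> has_derivative (\<lambda>h. G x \<bullet> h)) (at x)" by (elim C1cE) blast
  show ?thesis
  proof (rule C1cI[where K=K])
    show "((\<lambda>x. \<beta> (\<phi> x)) has_derivative (\<lambda>h. (\<beta>' (\<phi> x) *\<^sub>R G x) \<bullet> h)) (at x)" for x
      using has_derivative_compose[OF K(6)[of x] assms(2)[of "\<phi> x", unfolded has_field_derivative_def]]
      by simp
    show "continuous_on UNIV (\<lambda>x. \<beta>' (\<phi> x) *\<^sub>R G x)"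
      by (intro continuous_intros K continuous_on_compose2[OF assms(3) K(4)]) auto
  qed (use K assms(4) in auto)
qed

lemma n2_tendsto_0_iff:
  "(\<lambda>n. n2 M (f n)) \<longlonglongrightarrow> 0 \<longleftrightarrow> (\<lambda>n. \<integral>x. (norm (f n x))\<^sup>2 \<partial>M) \<longlonglongrightarrow> 0"
proof
  assume "(\<lambda>n. n2 M (f n)) \<longlonglongrightarrow> 0"
  from tendsto_power[OF this, of 2] show "(\<lambda>n. \<integral>x. (norm (f n x))\<^sup>2 \<partial>M) \<longlonglongrightarrow> 0"
    by (simp add: n2_sq)
next
  assume "(\<lambda>n. \<integral>x. (norm (f n x))\<^sup>2 \<partial>M) \<longlonglongrightarrow> 0"
  from tendsto_real_sqrt[OF this] show "(\<lambda>n. n2 M (f n)) \<longlonglongrightarrow> 0"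
    by (simp add: n2_def)
qed

lemma H01_iff:
  "H01 \<Omega> u g \<longleftrightarrow> L2 (lebesgue_on \<Omega>) u \<and> L2 (lebesgue_on \<Omega>) g \<and>
     (\<exists>\<phi> G. (\<forall>n. C1c \<Omega> (\<phi> n) (G n)) \<and>
        (\<lambda>n. n2 (lebesgue_on \<Omega>) (\<lambda>x. \<phi> n x - u x)) \<longlonglongrightarrow> 0 \<and>
        (\<lambda>n. n2 (lebesgue_on \<Omega>) (\<lambda>x. G n x - g x)) \<longlonglongrightarrow> 0)"
  unfolding H01_def L2_def n2_tendsto_0_iff by auto

lemma H01E:
  assumes "H01 \<Omega> u g"
  obtains \<phi> G where "L2 (lebesgue_on \<Omega>) u" "L2 (lebesgue_on \<Omega>) g" "\<And>n. C1c \<Omega> (\<phi> n) (G n)"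
    "(\<lambda>n. n2 (lebesgue_on \<Omega>) (\<lambda>x. \<phi> n x - u x)) \<longlonglongrightarrow> 0"
    "(\<lambda>n. n2 (lebesgue_on \<Omega>) (\<lambda>x. G n x - g x)) \<longlonglongrightarrow> 0"
  using assms unfolding H01_iff by blast

lemma H01I:
  assumes "L2 (lebesgue_on \<Omega>) u" "L2 (lebesgue_on \<Omega>) g" "\<And>n. C1c \<Omega> (\<phi> n) (G n)"
    "(\<lambda>n. n2 (lebesgue_on \<Omega>) (\<lambda>x. \<phi> n x - u x)) \<longlonglongrightarrow> 0"
    "(\<lambda>n. n2 (lebesgue_on \<Omega>) (\<lambda>x. G n x - g x)) \<longlonglongrightarrow> 0"
  shows "H01 \<Omega> u g"
  using assms unfolding H01_iff by blast

lemma H01_L2: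
  assumes "H01 \<Omega> u g"
  shows "L2 (lebesgue_on \<Omega>) u" "L2 (lebesgue_on \<Omega>) g"
  using assms unfolding H01_iff by auto

lemma n2_null_comparison:
  assumes "b \<longlonglongrightarrow> 0" "\<And>n. n2 M (f n) \<le> b n"
  shows "(\<lambda>n. n2 M (f n)) \<longlonglongrightarrow> 0"
  by (rule Lim_null_comparison[OF _ assms(1)]) (simp add: assms(2))

lemma n2_mult_bounded:
  assumes "L2 M f" "\<psi> \<in> borel_measurable M" "\<And>x. \<bar>\<psi> x\<bar> \<le> C"
  shows "n2 M (\<lambda>x. \<psi> x *\<^sub>R f x) \<le> C * n2 M f"
proof -
  have C: "0 \<le> C" using assms(3) by (meson abs_ge_zero order_trans)
  have "n2 M (\<lambda>x. \<psi> x *\<^sub>R f x) \<le> n2 M (\<lambda>x. C *\<^sub>R f x)"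
  proof (rule n2_mono[OF L2_scaleR[OF assms(1)]])
    show "(\<lambda>x. \<psi> x *\<^sub>R f x) \<in> borel_measurable M"
      by (intro borel_measurable_scaleR L2_measurable assms)
  qed (use C assms(3) in \<open>auto intro!: AE_I2 mult_right_mono\<close>)
  also have "\<dots> = C * n2 M f" using C by (simp add: n2_scaleR)
  finally show ?thesis .
qed

lemma n2_real_scaleR_bounded:
  fixes u :: "'a \<Rightarrow> real" and H :: "'a \<Rightarrow> 'b::euclidean_space"
  assumes "L2 M u" "H \<in> borel_measurable M" "\<And>x. norm (H x) \<le> C"
  shows "n2 M (\<lambda>x. u x *\<^sub>R H x) \<le> C * n2 M u"
proof -
  have "n2 M (\<lambda>x. u x *\<^sub>R H x) = n2 M (\<lambda>x. norm (H x) *\<^sub>R u x)"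
    by (simp add: n2_def power_mult_distrib mult.commute)
  also have "\<dots> \<le> C * n2 M u"
    by (rule n2_mult_bounded[OF assms(1)]) (use assms in auto)
  finally show ?thesis .
qed

section \<open>Stability of \<open>H01\<close> under differences, bounded multipliers and the chain
  rule\<close>

locale admissible_domain =
  fixes \<Omega> :: "'a::euclidean_space set"
  assumes adm: "admissible \<Omega>"
begin

lemma open_domain: "open \<Omega>"
  using adm by (simp add: admissible_def)

lemma sets_domain: "\<Omega> \<in> sets lebesgue"
  using open_domain by auto

lemma finite_measure_domain: "finite_measure (lebesgue_on \<Omega>)"
  using adm sets_domain
  by (intro finite_measureI) (auto simp: admissible_def emeasure_restrict_space space_restrict_space)

lemma measure_domain_pos: "0 < measure lebesgue \<Omega>"
  using adm unfolding admissible_def measure_def enn2real_positive_iff by auto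

lemma measure_lebesgue_on_domain: "measure (lebesgue_on \<Omega>) \<Omega> = measure lebesgue \<Omega>"
  using sets_domain by (simp add: measure_restrict_space)

text \<open>The set \<Omega>' is unrelated to \<Omega>, so bumps that reach across the boundary of
  \<Omega> are covered.\<close>

lemma C1c_L2:
  assumes "C1c \<Omega>' \<phi> G"
  shows "L2 (lebesgue_on \<Omega>) \<phi>" "L2 (lebesgue_on \<Omega>) G"
proof -
  have i: "integrable (lebesgue_on \<Omega>) f" if "integrable lborel f" for f :: "'a \<Rightarrow> real"
  proof -
    have "f \<in> lborel \<rightarrow>\<^sub>M borel" using that by auto
    then have "integrable lebesgue f" using that integrable_completion by blast
    from integrable_mult_indicator[OF sets_domain this] show ?thesis
      using sets_domain integrable_restrict_space[of \<Omega> lebesgue f] by simp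
  qed
  show "L2 (lebesgue_on \<Omega>) \<phi>" "L2 (lebesgue_on \<Omega>) G"
    using C1c_borel[OF assms] C1c_integrable_lborel[OF assms]
    by (auto simp: L2_def intro!: i borel_measurable_lebesgue_on)
qed

lemma C1c_H01: "C1c \<Omega> \<phi> G \<Longrightarrow> H01 \<Omega> \<phi> G"
  by (rule H01I[where \<phi>="\<lambda>n. \<phi>" and G="\<lambda>n. G"]) (auto simp: C1c_L2 n2_def)

lemma H01_diff:
  assumes "H01 \<Omega> u g" "H01 \<Omega> w h"
  shows "H01 \<Omega> (\<lambda>x. u x - w x) (\<lambda>x. g x - h x)"
proof -
  let ?M = "lebesgue_on \<Omega>"
  obtain \<phi> G where 1: "L2 ?M u" "L2 ?M g" "\<And>n. C1c \<Omega> (\<phi> n) (G n)"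
    "(\<lambda>n. n2 ?M (\<lambda>x. \<phi> n x - u x)) \<longlonglongrightarrow> 0" "(\<lambda>n. n2 ?M (\<lambda>x. G n x - g x)) \<longlonglongrightarrow> 0"
    using H01E[OF assms(1)] by blast
  obtain \<psi> H where 2: "L2 ?M w" "L2 ?M h" "\<And>n. C1c \<Omega> (\<psi> n) (H n)"
    "(\<lambda>n. n2 ?M (\<lambda>x. \<psi> n x - w x)) \<longlonglongrightarrow> 0" "(\<lambda>n. n2 ?M (\<lambda>x. H n x - h x)) \<longlonglongrightarrow> 0"
    using H01E[OF assms(2)] by blast
  show ?thesis
  proof (rule H01I)
    show "C1c \<Omega> (\<lambda>x. \<phi> n x + (-1) * \<psi> n x) (\<lambda>x. G n x + (-1) *\<^sub>R H n x)" for n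
      by (rule C1c_add_scaled[OF 1(3) 2(3)])
    have "n2 ?M (\<lambda>x. (\<phi> n x + (-1) * \<psi> n x) - (u x - w x)) \<le> n2 ?M (\<lambda>x. \<phi> n x - u x) + n2 ?M (\<lambda>x. \<psi> n x - w x)" for n
    proof -
      have "(\<lambda>x. (\<phi> n x + (-1) * \<psi> n x) - (u x - w x)) = (\<lambda>x. (\<phi> n x - u x) + - (\<psi> n x - w x))" by auto
      then show ?thesis
        using n2_triangle[OF L2_diff[OF C1c_L2(1)[OF 1(3)] 1(1), of n] L2_minus[OF L2_diff[OF C1c_L2(1)[OF 2(3)] 2(1), of n]]]
        by (simp only: n2_minus)
    qed
    from n2_null_comparison[OF _ this]
    show "(\<lambda>n. n2 ?M (\<lambda>x. (\<phi> n x + (-1) * \<psi> n x) - (u x - w x))) \<longlonglongrightarrow> 0"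
      using tendsto_add[OF 1(4) 2(4)] by simp
    have "n2 ?M (\<lambda>x. (G n x + (-1) *\<^sub>R H n x) - (g x - h x)) \<le> n2 ?M (\<lambda>x. G n x - g x) + n2 ?M (\<lambda>x. H n x - h x)" for n
    proof -
      have "(\<lambda>x. (G n x + (-1) *\<^sub>R H n x) - (g x - h x)) = (\<lambda>x. (G n x - g x) + - (H n x - h x))" by auto
      then show ?thesis
        using n2_triangle[OF L2_diff[OF C1c_L2(2)[OF 1(3)] 1(2), of n] L2_minus[OF L2_diff[OF C1c_L2(2)[OF 2(3)] 2(2), of n]]]
        by (simp only: n2_minus)
    qed
    from n2_null_comparison[OF _ this]
    show "(\<lambda>n. n2 ?M (\<lambda>x. (G n x + (-1) *\<^sub>R H n x) - (g x - h x))) \<longlonglongrightarrow> 0"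
      using tendsto_add[OF 1(5) 2(5)] by simp
  qed (use 1 2 in \<open>auto intro: L2_diff\<close>)
qed

text \<open>With \<psi> and its gradient bounded, multiplication is continuous in the H1 norm, so
  the products with the approximants converge. The multiplier needs no compact support, which admits
  the weights and the bumps crossing the boundary.\<close>

lemma H01_mult:
  fixes \<psi> :: "'a::euclidean_space \<Rightarrow> real"
  assumes "H01 \<Omega> u g" "\<And>x. (\<psi> has_derivative (\<lambda>h. H x \<bullet> h)) (at x)" "continuous_on UNIV H"
    "\<And>x. \<bar>\<psi> x\<bar> \<le> C" "\<And>x. norm (H x) \<le> D"
  shows "H01 \<Omega> (\<lambda>x. \<psi> x * u x) (\<lambda>x. \<psi> x *\<^sub>R g x + u x *\<^sub>R H x)"
proof -
  let ?M = "lebesgue_on \<Omega>"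
  obtain \<phi> G where 1: "L2 ?M u" "L2 ?M g" "\<And>n. C1c \<Omega> (\<phi> n) (G n)"
    "(\<lambda>n. n2 ?M (\<lambda>x. \<phi> n x - u x)) \<longlonglongrightarrow> 0" "(\<lambda>n. n2 ?M (\<lambda>x. G n x - g x)) \<longlonglongrightarrow> 0"
    using H01E[OF assms(1)] by blast
  have "continuous_on UNIV \<psi>"
    using assms(2) by (auto intro!: continuous_at_imp_continuous_on has_derivative_continuous)
  then have m: "\<psi> \<in> borel_measurable ?M" "H \<in> borel_measurable ?M"
    using assms(3) by (auto intro!: borel_measurable_lebesgue_on borel_measurable_continuous_onI)
  note du = L2_diff[OF C1c_L2(1)[OF 1(3)] 1(1)] and dg = L2_diff[OF C1c_L2(2)[OF 1(3)] 1(2)]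
  show ?thesis
  proof (rule H01I)
    show "L2 ?M (\<lambda>x. \<psi> x * u x)" using L2_mult_bounded[OF 1(1) m(1) assms(4)] by simp
    show "L2 ?M (\<lambda>x. \<psi> x *\<^sub>R g x + u x *\<^sub>R H x)"
      by (intro L2_add L2_mult_bounded[OF 1(2) m(1) assms(4)] L2_real_scaleR_bounded[OF 1(1) m(2) assms(5)])
    show "C1c \<Omega> (\<lambda>x. \<psi> x * \<phi> n x) (\<lambda>x. \<psi> x *\<^sub>R G n x + \<phi> n x *\<^sub>R H x)" for n
      by (rule C1c_mult[OF 1(3) assms(2,3)])
    have "n2 ?M (\<lambda>x. \<psi> x * \<phi> n x - \<psi> x * u x) \<le> C * n2 ?M (\<lambda>x. \<phi> n x - u x)" for n
      using n2_mult_bounded[OF du m(1) assms(4), of n] by (simp add: algebra_simps)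
    from n2_null_comparison[OF _ this]
    show "(\<lambda>n. n2 ?M (\<lambda>x. \<psi> x * \<phi> n x - \<psi> x * u x)) \<longlonglongrightarrow> 0"
      using tendsto_mult[OF tendsto_const 1(4), of C] by simp
    have "n2 ?M (\<lambda>x. (\<psi> x *\<^sub>R G n x + \<phi> n x *\<^sub>R H x) - (\<psi> x *\<^sub>R g x + u x *\<^sub>R H x))
      \<le> C * n2 ?M (\<lambda>x. G n x - g x) + D * n2 ?M (\<lambda>x. \<phi> n x - u x)" for n
    proof -
      have "n2 ?M (\<lambda>x. (\<psi> x *\<^sub>R G n x + \<phi> n x *\<^sub>R H x) - (\<psi> x *\<^sub>R g x + u x *\<^sub>R H x))
        = n2 ?M (\<lambda>x. \<psi> x *\<^sub>R (G n x - g x) + (\<phi> n x - u x) *\<^sub>R H x)"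
        by (simp add: algebra_simps)
      also have "\<dots> \<le> n2 ?M (\<lambda>x. \<psi> x *\<^sub>R (G n x - g x)) + n2 ?M (\<lambda>x. (\<phi> n x - u x) *\<^sub>R H x)"
        by (intro n2_triangle L2_mult_bounded[OF dg m(1) assms(4)] L2_real_scaleR_bounded[OF du m(2) assms(5)])
      also have "\<dots> \<le> C * n2 ?M (\<lambda>x. G n x - g x) + D * n2 ?M (\<lambda>x. \<phi> n x - u x)"
        by (intro add_mono n2_mult_bounded[OF dg m(1) assms(4)] n2_real_scaleR_bounded[OF du m(2) assms(5)])
      finally show ?thesis .
    qed
    from n2_null_comparison[OF _ this]
    show "(\<lambda>n. n2 ?M (\<lambda>x. (\<psi> x *\<^sub>R G n x + \<phi> n x *\<^sub>R H x) - (\<psi> x *\<^sub>R g x + u x *\<^sub>R H x))) \<longlonglongrightarrow> 0"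
      using tendsto_add[OF tendsto_mult[OF tendsto_const 1(5), of C] tendsto_mult[OF tendsto_const 1(4), of D]] by simp
  qed
qed

text \<open>Since \<open>\<beta>'\<close> is merely continuous, \<open>\<beta>' (\<phi> n)\<close>
  converges only pointwise, and only along a subsequence with almost everywhere convergence;
  dominated convergence then handles the gradients.\<close>

lemma H01_chain:
  fixes \<beta> \<beta>' :: "real \<Rightarrow> real"
  assumes "H01 \<Omega> u g" and d: "\<And>t. (\<beta> has_real_derivative \<beta>' t) (at t)" and c: "continuous_on UNIV \<beta>'"
    and "\<beta> 0 = 0" and bd: "\<And>t. \<bar>\<beta>' t\<bar> \<le> C"
  shows "H01 \<Omega> (\<lambda>x. \<beta> (u x)) (\<lambda>x. \<beta>' (u x) *\<^sub>R g x)"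
proof -
  let ?M = "lebesgue_on \<Omega>"
  obtain \<phi>0 G0 where 0: "L2 ?M u" "L2 ?M g" "\<And>n. C1c \<Omega> (\<phi>0 n) (G0 n)"
    "(\<lambda>n. n2 ?M (\<lambda>x. \<phi>0 n x - u x)) \<longlonglongrightarrow> 0" "(\<lambda>n. n2 ?M (\<lambda>x. G0 n x - g x)) \<longlonglongrightarrow> 0"
    using H01E[OF assms(1)] by blast
  obtain r :: "nat \<Rightarrow> nat" where r: "strict_mono r" "AE x in ?M. (\<lambda>n. \<phi>0 (r n) x) \<longlonglongrightarrow> u x"
    using n2_tendsto_subseq_AE[OF C1c_L2(1)[OF 0(3)] 0(1,4)] by blast
  define \<phi> G where "\<phi> n = \<phi>0 (r n)" and "G n = G0 (r n)" for n
  have 1: "L2 ?M u" "L2 ?M g" "\<And>n. C1c \<Omega> (\<phi> n) (G n)"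
    "(\<lambda>n. n2 ?M (\<lambda>x. \<phi> n x - u x)) \<longlonglongrightarrow> 0" "(\<lambda>n. n2 ?M (\<lambda>x. G n x - g x)) \<longlonglongrightarrow> 0"
    "AE x in ?M. (\<lambda>n. \<phi> n x) \<longlonglongrightarrow> u x"
    using 0 r LIMSEQ_subseq_LIMSEQ[OF 0(4) r(1)] LIMSEQ_subseq_LIMSEQ[OF 0(5) r(1)]
    by (auto simp: \<phi>_def G_def o_def)
  have cb: "continuous_on UNIV \<beta>"
    using d by (auto intro!: continuous_at_imp_continuous_on DERIV_isCont)
  have bm: "\<beta> \<in> borel_measurable borel" "\<beta>' \<in> borel_measurable borel"
    using cb c by (auto intro: borel_measurable_continuous_onI)
  have lip: "\<bar>\<beta> s - \<beta> t\<bar> \<le> C * \<bar>s - t\<bar>" for s t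
  proof -
    have "norm (\<beta> s - \<beta> t) \<le> C * norm (s - t)"
      by (rule field_differentiable_bound[where S=UNIV and f'=\<beta>'])
         (use d bd in \<open>auto\<close>)
    then show ?thesis by simp
  qed
  have C: "0 \<le> C" using bd by (meson abs_ge_zero order_trans)
  have um [measurable]: "u \<in> borel_measurable ?M" and gm [measurable]: "g \<in> borel_measurable ?M"
    using 1 by (auto simp: L2_measurable)
  have pm [measurable]: "\<phi> n \<in> borel_measurable ?M" for n using C1c_L2(1)[OF 1(3)] by (rule L2_measurable)
  have b1 [measurable]: "(\<lambda>x. \<beta> (w x)) \<in> borel_measurable ?M" "(\<lambda>x. \<beta>' (w x)) \<in> borel_measurable ?M"
    if "w \<in> borel_measurable ?M" for w
    using measurable_compose[OF that bm(1)] measurable_compose[OF that bm(2)] by auto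
  note du = L2_diff[OF C1c_L2(1)[OF 1(3)] 1(1)] and dg = L2_diff[OF C1c_L2(2)[OF 1(3)] 1(2)]
  show ?thesis
  proof (rule H01I)
    show "L2 ?M (\<lambda>x. \<beta> (u x))"
      by (rule L2_bound[OF L2_scaleR[OF 1(1), of C]]) (use lip[of _ 0] \<open>\<beta> 0 = 0\<close> C in \<open>auto simp: abs_mult\<close>)
    show "L2 ?M (\<lambda>x. \<beta>' (u x) *\<^sub>R g x)" by (rule L2_mult_bounded[OF 1(2) _ bd]) measurable
    show "C1c \<Omega> (\<lambda>x. \<beta> (\<phi> n x)) (\<lambda>x. \<beta>' (\<phi> n x) *\<^sub>R G n x)" for n
      by (rule C1c_compose[OF 1(3) d c \<open>\<beta> 0 = 0\<close>])
    have "n2 ?M (\<lambda>x. \<beta> (\<phi> n x) - \<beta> (u x)) \<le> C * n2 ?M (\<lambda>x. \<phi> n x - u x)" for n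
    proof -
      have "n2 ?M (\<lambda>x. \<beta> (\<phi> n x) - \<beta> (u x)) \<le> n2 ?M (\<lambda>x. C *\<^sub>R (\<phi> n x - u x))"
        by (rule n2_mono[OF L2_scaleR[OF du]]) (use lip C in \<open>auto simp: abs_mult\<close>)
      then show ?thesis using C by (simp add: n2_scaleR del: real_scaleR_def)
    qed
    from n2_null_comparison[OF _ this]
    show "(\<lambda>n. n2 ?M (\<lambda>x. \<beta> (\<phi> n x) - \<beta> (u x))) \<longlonglongrightarrow> 0"
      using tendsto_mult[OF tendsto_const 1(4), of C] by simp
    \<comment> \<open>The gradient error splits into \<open>\<beta>' (\<phi> n) (G n - g)\<close>,
      controlled by the bound on \<open>\<beta>'\<close>, and this \<open>e n\<close>, dominated by
      \<open>2 C |g|\<close>.\<close>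
    define e where "e n x = (\<beta>' (\<phi> n x) - \<beta>' (u x)) *\<^sub>R g x" for n x
    have ebd: "norm (e n x) \<le> 2 * C * norm (g x)" for n x
      unfolding e_def norm_scaleR real_norm_def
      by (intro mult_right_mono) (use bd[of "\<phi> n x"] bd[of "u x"] in auto)
    have em [measurable]: "e n \<in> borel_measurable ?M" for n unfolding e_def by measurable
    have eL: "L2 ?M (e n)" for n
      by (rule L2_bound[OF L2_scaleR[OF 1(2), of "2 * C"]]) (use ebd C in auto)
    have "(\<lambda>n. \<integral>x. (norm (e n x))\<^sup>2 \<partial>?M) \<longlonglongrightarrow> (\<integral>x. 0 \<partial>?M)"
    proof (rule integral_dominated_convergence[where w="\<lambda>x. 4 * C\<^sup>2 * (norm (g x))\<^sup>2"])
      show "integrable ?M (\<lambda>x. 4 * C\<^sup>2 * (norm (g x))\<^sup>2)" using L2_integrable_sq[OF 1(2)] by simp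
      show "AE x in ?M. (\<lambda>n. (norm (e n x))\<^sup>2) \<longlonglongrightarrow> 0"
        using 1(6)
      proof eventually_elim
        case (elim x)
        have "(\<lambda>n. \<beta>' (\<phi> n x)) \<longlonglongrightarrow> \<beta>' (u x)"
          by (rule isCont_tendsto_compose[OF _ elim]) (use c in \<open>simp add: continuous_on_eq_continuous_at\<close>)
        then have "(\<lambda>n. (norm ((\<beta>' (\<phi> n x) - \<beta>' (u x)) *\<^sub>R g x))\<^sup>2) \<longlonglongrightarrow> (norm ((\<beta>' (u x) - \<beta>' (u x)) *\<^sub>R g x))\<^sup>2"
          by (intro tendsto_intros)
        then show ?case by (simp add: e_def)
      qed
      show "AE x in ?M. norm ((norm (e n x))\<^sup>2) \<le> 4 * C\<^sup>2 * (norm (g x))\<^sup>2" for n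
      proof (rule AE_I2)
        fix x
        have "(norm (e n x))\<^sup>2 \<le> (2 * C * norm (g x))\<^sup>2" by (intro power_mono ebd) simp
        then show "norm ((norm (e n x))\<^sup>2) \<le> 4 * C\<^sup>2 * (norm (g x))\<^sup>2"
          by (simp add: power_mult_distrib)
      qed
    qed measurable
    then have e0: "(\<lambda>n. n2 ?M (e n)) \<longlonglongrightarrow> 0" by (simp add: n2_tendsto_0_iff)
    have "n2 ?M (\<lambda>x. \<beta>' (\<phi> n x) *\<^sub>R G n x - \<beta>' (u x) *\<^sub>R g x) \<le> C * n2 ?M (\<lambda>x. G n x - g x) + n2 ?M (e n)" for n
    proof -
      have "n2 ?M (\<lambda>x. \<beta>' (\<phi> n x) *\<^sub>R G n x - \<beta>' (u x) *\<^sub>R g x) = n2 ?M (\<lambda>x. \<beta>' (\<phi> n x) *\<^sub>R (G n x - g x) + e n x)"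
        by (simp add: e_def algebra_simps)
      also have "\<dots> \<le> n2 ?M (\<lambda>x. \<beta>' (\<phi> n x) *\<^sub>R (G n x - g x)) + n2 ?M (e n)"
        by (intro n2_triangle eL L2_mult_bounded[OF dg _ bd]) measurable
      also have "\<dots> \<le> C * n2 ?M (\<lambda>x. G n x - g x) + n2 ?M (e n)"
        by (intro add_mono n2_mult_bounded[OF dg _ bd]) auto
      finally show ?thesis .
    qed
    from n2_null_comparison[OF _ this]
    show "(\<lambda>n. n2 ?M (\<lambda>x. \<beta>' (\<phi> n x) *\<^sub>R G n x - \<beta>' (u x) *\<^sub>R g x)) \<longlonglongrightarrow> 0"
      using tendsto_add[OF tendsto_mult[OF tendsto_const 1(5), of C] e0] by simp
  qed
qed

end

subsection \<open>Translations, bumps and the Poincare inequality\<close>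

lemma nn_integral_lborel_translation:
  fixes f :: "'a::euclidean_space \<Rightarrow> ennreal"
  assumes [measurable]: "f \<in> borel_measurable borel"
  shows "(\<integral>\<^sup>+x. f (x + c) \<partial>lborel) = (\<integral>\<^sup>+x. f x \<partial>lborel)"
proof -
  have "(\<integral>\<^sup>+x. f x \<partial>lborel) = (\<integral>\<^sup>+x. f x \<partial>(distr lborel borel ((+) c)))"
    by (simp add: lborel_distr_plus)
  also have "\<dots> = (\<integral>\<^sup>+x. f (x + c) \<partial>lborel)"
    by (subst nn_integral_distr) (simp_all add: add.commute)
  finally show ?thesis by simp
qed

lemma integral_lborel_affine:
  fixes f :: "'a::euclidean_space \<Rightarrow> real"
  assumes [measurable]: "f \<in> borel_measurable borel" and c: "c > 0"
  shows "(\<integral>x. f x \<partial>lborel) = c ^ DIM('a) * (\<integral>y. f (t + c *\<^sub>R y) \<partial>lborel)"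
proof -
  have "(\<integral>x. f x \<partial>lborel) = (\<integral>x. f x \<partial>density (distr lborel borel (\<lambda>x. t + c *\<^sub>R x)) (\<lambda>_. ennreal (c ^ DIM('a))))"
    using lborel_affine[of c t] c by simp
  also have "\<dots> = (\<integral>x. c ^ DIM('a) * f x \<partial>distr lborel borel (\<lambda>x. t + c *\<^sub>R x))"
    by (subst integral_density) (use c in auto)
  also have "\<dots> = (\<integral>y. c ^ DIM('a) * f (t + c *\<^sub>R y) \<partial>lborel)"
    by (subst integral_distr) auto
  finally show ?thesis by simp
qed

text \<open>Jensen's inequality, by integrating the tangent-line bound
  \<open>2 c y - c\<^sup>2 \<le> y\<^sup>2\<close>.\<close>

lemma square_le_integral_square:
  fixes f :: "real \<Rightarrow> real"
  assumes "(f has_integral c) {0..1}" "continuous_on {0..1} f"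
  shows "c\<^sup>2 \<le> integral {0..1} (\<lambda>t. (f t)\<^sup>2)"
proof -
  have 1: "((\<lambda>t. 2 * c * f t - c\<^sup>2) has_integral (2 * c * c - c\<^sup>2)) {0..1}"
    using has_integral_diff[OF has_integral_mult_right[OF assms(1), of "2 * c"] has_integral_const_real[of "c\<^sup>2" 0 1]] by simp
  have 2: "((\<lambda>t. (f t)\<^sup>2) has_integral integral {0..1} (\<lambda>t. (f t)\<^sup>2)) {0..1}"
    by (intro integrable_integral integrable_continuous_real continuous_intros assms(2))
  have "2 * c * f t - c\<^sup>2 \<le> (f t)\<^sup>2" for t
    using sum_squares_bound[of c "f t"] by simp
  from has_integral_le[OF 1 2 this] show ?thesis by (simp add: power2_eq_square)
qed

text \<open>The increment is the integral of \<open>G \<bullet> h\<close> along the segment. After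
  Jensen and Fubini, translation invariance removes the position on the segment. Extension by zero
  makes it harmless that segments leave \<Omega>.\<close>

lemma translation_estimate:
  fixes \<phi> :: "'a::euclidean_space \<Rightarrow> real"
  assumes C: "C1c \<Omega> \<phi> G"
  shows "(\<integral>\<^sup>+x. ennreal ((\<phi> (x + h) - \<phi> x)\<^sup>2) \<partial>lborel) \<le> ennreal ((norm h)\<^sup>2 * (\<integral>x. (norm (G x))\<^sup>2 \<partial>lborel))"
proof -
  note [measurable] = C1c_borel[OF C]
  have d: "\<And>x. (\<phi> has_derivative (\<lambda>k. G x \<bullet> k)) (at x)" using C by (simp add: C1c_def)
  have cG: "continuous_on S (\<lambda>t. G (x + t *\<^sub>R h))" for x and S :: "real set"
    by (rule continuous_on_compose2[OF C1c_continuous(2)[OF C]]) (auto intro!: continuous_intros)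
  have pt: "ennreal ((\<phi> (x + h) - \<phi> x)\<^sup>2) \<le> (\<integral>\<^sup>+t. ennreal ((norm h)\<^sup>2 * (norm (G (x + t *\<^sub>R h)))\<^sup>2) * indicator {0..1::real} t \<partial>lborel)" for x
  proof -
    have hi: "((\<lambda>t. G (x + t *\<^sub>R h) \<bullet> h) has_integral (\<phi> (x + 1 *\<^sub>R h) - \<phi> (x + 0 *\<^sub>R h))) {0..1}"
    proof (rule fundamental_theorem_of_calculus)
      fix t :: real
      have "((\<lambda>t. x + t *\<^sub>R h) has_derivative (\<lambda>s. s *\<^sub>R h)) (at t within {0..1})"
        by (auto intro!: derivative_eq_intros)
      from has_derivative_compose[OF this d]
      show "((\<lambda>t. \<phi> (x + t *\<^sub>R h)) has_vector_derivative G (x + t *\<^sub>R h) \<bullet> h) (at t within {0..1})"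
        by (simp add: has_vector_derivative_def)
    qed simp
    then have "(\<phi> (x + h) - \<phi> x)\<^sup>2 \<le> integral {0..1} (\<lambda>t. (G (x + t *\<^sub>R h) \<bullet> h)\<^sup>2)"
      using square_le_integral_square[OF hi] by (simp add: cG continuous_on_inner)
    also have "\<dots> \<le> integral {0..1} (\<lambda>t. (norm h)\<^sup>2 * (norm (G (x + t *\<^sub>R h)))\<^sup>2)"
    proof (rule integral_le)
      fix t
      show "(G (x + t *\<^sub>R h) \<bullet> h)\<^sup>2 \<le> (norm h)\<^sup>2 * (norm (G (x + t *\<^sub>R h)))\<^sup>2"
        using Cauchy_Schwarz_ineq[of "G (x + t *\<^sub>R h)" h] by (simp add: power2_norm_eq_inner mult.commute)
    qed (auto intro!: integrable_continuous_real continuous_intros cG)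
    finally have "ennreal ((\<phi> (x + h) - \<phi> x)\<^sup>2) \<le> ennreal (integral {0..1} (\<lambda>t. (norm h)\<^sup>2 * (norm (G (x + t *\<^sub>R h)))\<^sup>2))"
      by (rule ennreal_leI)
    also have "\<dots> = (\<integral>\<^sup>+t. ennreal ((norm h)\<^sup>2 * (norm (G (x + t *\<^sub>R h)))\<^sup>2) * indicator {0..1::real} t \<partial>lborel)"
    proof (rule nn_integral_has_integral_lebesgue'[symmetric])
      show "((\<lambda>t. (norm h)\<^sup>2 * (norm (G (x + t *\<^sub>R h)))\<^sup>2) has_integral integral {0..1} (\<lambda>t. (norm h)\<^sup>2 * (norm (G (x + t *\<^sub>R h)))\<^sup>2)) {0..1}"
        by (intro integrable_integral integrable_continuous_real continuous_intros cG)
    qed auto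
    finally show ?thesis .
  qed
  define I where "I = (\<integral>x. (norm (G x))\<^sup>2 \<partial>lborel)"
  have I0: "0 \<le> I" by (simp add: I_def)
  have nnI: "(\<integral>\<^sup>+x. ennreal ((norm (G x))\<^sup>2) \<partial>lborel) = ennreal I"
    unfolding I_def by (rule nn_integral_eq_integral) (use C1c_integrable_lborel[OF C] in auto)
  have "(\<integral>\<^sup>+x. ennreal ((\<phi> (x + h) - \<phi> x)\<^sup>2) \<partial>lborel)
      \<le> (\<integral>\<^sup>+x. (\<integral>\<^sup>+t. ennreal ((norm h)\<^sup>2 * (norm (G (x + t *\<^sub>R h)))\<^sup>2) * indicator {0..1::real} t \<partial>lborel) \<partial>lborel)"
    by (intro nn_integral_mono pt)
  also have "\<dots> = (\<integral>\<^sup>+t. (\<integral>\<^sup>+x. ennreal ((norm h)\<^sup>2 * (norm (G (x + t *\<^sub>R h)))\<^sup>2) * indicator {0..1::real} t \<partial>lborel) \<partial>lborel)"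
    by (rule lborel_pair.Fubini'[symmetric]) measurable
  also have "\<dots> = (\<integral>\<^sup>+t. ennreal ((norm h)\<^sup>2 * I) * indicator {0..1::real} t \<partial>lborel)"
  proof (rule nn_integral_cong)
    fix t :: real
    have "(\<integral>\<^sup>+x. ennreal ((norm h)\<^sup>2 * (norm (G (x + t *\<^sub>R h)))\<^sup>2) * indicator {0..1::real} t \<partial>lborel)
      = (\<integral>\<^sup>+x. ennreal ((norm h)\<^sup>2 * (norm (G (x + t *\<^sub>R h)))\<^sup>2) \<partial>lborel) * indicator {0..1::real} t"
      by (rule nn_integral_multc) measurable
    also have "(\<integral>\<^sup>+x. ennreal ((norm h)\<^sup>2 * (norm (G (x + t *\<^sub>R h)))\<^sup>2) \<partial>lborel) = (\<integral>\<^sup>+x. ennreal ((norm h)\<^sup>2 * (norm (G x))\<^sup>2) \<partial>lborel)"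
      by (rule nn_integral_lborel_translation) measurable
    also have "\<dots> = ennreal ((norm h)\<^sup>2 * I)"
      by (simp add: ennreal_mult I0 nn_integral_cmult nnI)
    finally show "(\<integral>\<^sup>+x. ennreal ((norm h)\<^sup>2 * (norm (G (x + t *\<^sub>R h)))\<^sup>2) * indicator {0..1::real} t \<partial>lborel)
      = ennreal ((norm h)\<^sup>2 * I) * indicator {0..1::real} t" .
  qed
  also have "\<dots> = ennreal ((norm h)\<^sup>2 * I)"
    by (simp add: nn_integral_cmult_indicator)
  finally show ?thesis by (simp add: I_def)
qed

text \<open>The kernel \<open>k\<close> is integrated in both orders. With \<open>h\<close>
  innermost the density hypothesis gives at least \<open>V / 2\<close> times the squared norm of
  \<phi>; with \<open>x\<close> innermost each \<open>h\<close> in the ball contributes at most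
  \<open>r\<^sup>2 * I\<close>, in total \<open>r\<^sup>2 * I * V\<close>. The quotient is the
  constant \<open>2 * r\<^sup>2\<close>.\<close>

lemma Poincare_C1c:
  fixes \<phi> :: "'a::euclidean_space \<Rightarrow> real"
  assumes C: "C1c \<Omega> \<phi> G" and "open \<Omega>" and r: "r > 0"
    and dens: "\<And>x. measure lborel (ball (0::'a) r) / 2 \<le> measure lborel (ball x r - \<Omega>)"
  shows "(\<integral>x. (\<phi> x)\<^sup>2 \<partial>lborel) \<le> 2 * r\<^sup>2 * (\<integral>x. (norm (G x))\<^sup>2 \<partial>lborel)"
proof -
  note [measurable] = C1c_borel[OF C]
  have [measurable]: "\<Omega> \<in> sets borel" "ball (0::'a) r \<in> sets borel" using \<open>open \<Omega>\<close> by auto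
  define I where "I = (\<integral>x. (norm (G x))\<^sup>2 \<partial>lborel)"
  define P where "P = (\<integral>x. (\<phi> x)\<^sup>2 \<partial>lborel)"
  define V where "V = measure lborel (ball (0::'a) r)"
  have V: "V > 0" using r by (simp add: V_def content_ball_pos)
  have I0: "0 \<le> I" by (simp add: I_def)
  have nnP: "(\<integral>\<^sup>+x. ennreal ((\<phi> x)\<^sup>2) \<partial>lborel) = ennreal P"
    unfolding P_def by (rule nn_integral_eq_integral) (use C1c_integrable_lborel[OF C] in auto)
  have P0: "0 \<le> P" by (simp add: P_def)
  define k where "k x h = ennreal ((\<phi> x)\<^sup>2) * indicator (-\<Omega>) (x + h) * indicator (ball 0 r) h" for x h :: 'a
  have km [measurable]: "(\<lambda>(x,h). k x h) \<in> borel_measurable (lborel \<Otimes>\<^sub>M lborel)"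
    unfolding k_def by measurable
  have "ennreal (P * (V / 2)) = (\<integral>\<^sup>+x. ennreal ((\<phi> x)\<^sup>2) * ennreal (V/2) \<partial>lborel)"
    using P0 V ennreal_mult[of P "V/2"] by (simp add: nn_integral_multc nnP)
  also have "\<dots> \<le> (\<integral>\<^sup>+x. (\<integral>\<^sup>+h. k x h \<partial>lborel) \<partial>lborel)"
  proof (rule nn_integral_mono)
    fix x :: 'a
    have "(\<integral>\<^sup>+h. k x h \<partial>lborel) = ennreal ((\<phi> x)\<^sup>2) * (\<integral>\<^sup>+h. indicator (-\<Omega>) (x + h) * indicator (ball 0 r) h \<partial>lborel)"
      unfolding k_def mult.assoc by (rule nn_integral_cmult) measurable
    also have "(\<integral>\<^sup>+h. indicator (-\<Omega>) (x + h) * indicator (ball 0 r) h \<partial>lborel) = (\<integral>\<^sup>+h. indicator (ball x r - \<Omega>) (h + x) \<partial>lborel)"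
      by (rule nn_integral_cong) (auto simp: indicator_def add.commute dist_norm)
    also have "\<dots> = (\<integral>\<^sup>+h. indicator (ball x r - \<Omega>) h \<partial>lborel)"
      by (rule nn_integral_lborel_translation, rule borel_measurable_indicator) (use \<open>open \<Omega>\<close> in auto)
    also have "\<dots> = emeasure lborel (ball x r - \<Omega>)" by (rule nn_integral_indicator) (use \<open>open \<Omega>\<close> in auto)
    also have "\<dots> = ennreal (measure lborel (ball x r - \<Omega>))"
    proof (rule emeasure_eq_ennreal_measure)
      have "emeasure lborel (ball x r - \<Omega>) \<le> emeasure lborel (ball x r)" by (rule emeasure_mono) auto
      also have "\<dots> < top" using emeasure_bounded_finite[OF bounded_ball, of x r] by simp
      finally show "emeasure lborel (ball x r - \<Omega>) \<noteq> top" by simp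
    qed
    finally have eq: "(\<integral>\<^sup>+h. k x h \<partial>lborel) = ennreal ((\<phi> x)\<^sup>2) * ennreal (measure lborel (ball x r - \<Omega>))" .
    show "ennreal ((\<phi> x)\<^sup>2) * ennreal (V/2) \<le> (\<integral>\<^sup>+h. k x h \<partial>lborel)"
      unfolding eq using dens[of x] by (intro mult_left_mono ennreal_leI) (auto simp: V_def)
  qed
  also have "\<dots> = (\<integral>\<^sup>+h. (\<integral>\<^sup>+x. k x h \<partial>lborel) \<partial>lborel)"
    by (rule lborel_pair.Fubini'[symmetric]) measurable
  also have "\<dots> \<le> (\<integral>\<^sup>+h. ennreal (r\<^sup>2 * I) * indicator (ball (0::'a) r) h \<partial>lborel)"
  proof (rule nn_integral_mono)
    fix h :: 'a
    show "(\<integral>\<^sup>+x. k x h \<partial>lborel) \<le> ennreal (r\<^sup>2 * I) * indicator (ball (0::'a) r) h"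
    proof (cases "h \<in> ball 0 r")
      case True
      have "(\<integral>\<^sup>+x. k x h \<partial>lborel) \<le> (\<integral>\<^sup>+x. ennreal ((\<phi> (x + h) - \<phi> x)\<^sup>2) \<partial>lborel)"
        by (rule nn_integral_mono) (use C1c_outside(1)[OF C] in \<open>auto simp: k_def indicator_def\<close>)
      also have "\<dots> \<le> ennreal ((norm h)\<^sup>2 * I)"
        unfolding I_def by (rule translation_estimate[OF C])
      also have "\<dots> \<le> ennreal (r\<^sup>2 * I)"
        using True I0 r by (intro ennreal_leI mult_right_mono power_mono) auto
      finally show ?thesis using True by simp
    qed (simp add: k_def)
  qed
  also have "\<dots> = ennreal (r\<^sup>2 * I) * emeasure lborel (ball (0::'a) r)"
    by (simp add: nn_integral_cmult_indicator)
  also have "emeasure lborel (ball (0::'a) r) = ennreal V"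
    unfolding V_def by (rule emeasure_eq_ennreal_measure) (use emeasure_bounded_finite[OF bounded_ball, of "0::'a" r] in simp)
  also have "ennreal (r\<^sup>2 * I) * ennreal V = ennreal (r\<^sup>2 * I * V)"
    using I0 V by (simp add: ennreal_mult)
  finally have "P * (V / 2) \<le> r\<^sup>2 * I * V"
    using I0 V P0 by (simp add: ennreal_le_iff)
  then show ?thesis using V by (simp add: P_def I_def field_simps)
qed

text \<open>The choice \<open>xi = eta\<^sup>2 / 4\<close> makes \<open>D xi (y) = - eta y *\<^sub>R y\<close>, so the derivative in \<open>s\<close> of the \<open>eta\<close>-average of
  \<open>\<phi>\<close> at scale \<open>s\<close> is, up to a factor, the Dirichlet pairing of \<open>\<phi>\<close> with a rescaled copy of \<open>xi\<close>.\<close>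

definition eta :: "'a::euclidean_space \<Rightarrow> real" where
  "eta y = max 0 (1 - (norm y)\<^sup>2)"

definition xi :: "'a::euclidean_space \<Rightarrow> real" where
  "xi y = (eta y)\<^sup>2 / 4"

definition bump :: "'a::euclidean_space \<Rightarrow> real \<Rightarrow> 'a \<Rightarrow> real" where
  "bump x s z = xi ((z - x) /\<^sub>R s)"

definition bumpG :: "'a::euclidean_space \<Rightarrow> real \<Rightarrow> 'a \<Rightarrow> 'a" where
  "bumpG x s z = - (eta ((z - x) /\<^sub>R s) / s) *\<^sub>R ((z - x) /\<^sub>R s)"

abbreviation eta_mass :: "'a::euclidean_space itself \<Rightarrow> real" where
  "eta_mass t \<equiv> integral\<^sup>L lborel (eta :: 'a \<Rightarrow> real)"

abbreviation xi_mass :: "'a::euclidean_space itself \<Rightarrow> real" where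
  "xi_mass t \<equiv> integral\<^sup>L lborel (xi :: 'a \<Rightarrow> real)"

lemma eta_nonneg [simp]: "0 \<le> eta y" and eta_le_1 [simp]: "eta y \<le> 1"
  by (auto simp: eta_def)

lemma eta_outside: "norm y \<ge> 1 \<Longrightarrow> eta y = 0"
  using one_le_power[of "norm y" 2] by (simp add: eta_def)

lemma xi_nonneg [simp]: "0 \<le> xi y"
  by (simp add: xi_def)

lemma continuous_on_eta: "continuous_on S eta"
  unfolding eta_def by (intro continuous_intros)

text \<open>Squaring removes the kink at 0, which makes \<open>xi\<close> a C1 function across the
  unit sphere.\<close>

lemma max0_square_deriv: "((\<lambda>t::real. (max 0 t)\<^sup>2 / 4) has_real_derivative (max 0 t / 2)) (at t)"
proof -
  consider "t > 0" | "t < 0" | "t = 0" by linarith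
  then show ?thesis
  proof cases
    case 1
    have "((\<lambda>t::real. t\<^sup>2 / 4) has_real_derivative (max 0 t / 2)) (at t)"
      using 1 by (auto intro!: derivative_eq_intros)
    then show ?thesis
      by (rule has_field_derivative_transform_within_open[where S="{0<..}"]) (use 1 in auto)
  next
    case 2
    have "((\<lambda>t::real. 0) has_real_derivative (max 0 t / 2)) (at t)"
      using 2 by (auto intro!: derivative_eq_intros)
    then show ?thesis
      by (rule has_field_derivative_transform_within_open[where S="{..<0}"]) (use 2 in auto)
  next
    case 3
    have "((\<lambda>h::real. ((max 0 (0 + h))\<^sup>2 / 4 - (max 0 0)\<^sup>2 / 4) / h) \<longlongrightarrow> 0) (at 0)"
    proof (rule Lim_null_comparison)
      show "\<forall>\<^sub>F h::real in at 0. norm (((max 0 (0 + h))\<^sup>2 / 4 - (max 0 0)\<^sup>2 / 4) / h) \<le> \<bar>h\<bar>"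
        by (rule always_eventually) (auto simp: max_def power2_eq_square)
      show "((\<lambda>h::real. \<bar>h\<bar>) \<longlongrightarrow> 0) (at 0)" by (intro tendsto_eq_intros) auto
    qed
    then show ?thesis using 3 by (simp add: DERIV_def)
  qed
qed

lemma xi_deriv: "(xi has_derivative (\<lambda>h. (- eta y *\<^sub>R y) \<bullet> h)) (at (y::'a::euclidean_space))"
proof -
  have "((\<lambda>y::'a. 1 - (norm y)\<^sup>2) has_derivative (\<lambda>h. - 2 * (y \<bullet> h))) (at y)"
    unfolding power2_norm_eq_inner by (auto intro!: derivative_eq_intros simp: inner_commute)
  from has_derivative_compose[OF this max0_square_deriv[unfolded has_field_derivative_def]]
  show ?thesis by (simp add: xi_def[abs_def] eta_def algebra_simps)
qed

lemma bump_deriv: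
  fixes x :: "'a::euclidean_space"
  assumes "s > 0"
  shows "(bump x s has_derivative (\<lambda>h. bumpG x s z \<bullet> h)) (at z)"
proof -
  have "((\<lambda>z. (z - x) /\<^sub>R s) has_derivative (\<lambda>h. h /\<^sub>R s)) (at z)"
    by (auto intro!: derivative_eq_intros)
  from has_derivative_compose[OF this xi_deriv] show ?thesis
    unfolding bump_def[abs_def]
    by (rule has_derivative_eq_rhs) (simp add: bumpG_def fun_eq_iff divide_inverse)
qed

lemma C1c_bump:
  fixes x :: "'a::euclidean_space"
  assumes "s > 0" "cball x s \<subseteq> \<Omega>"
  shows "C1c \<Omega> (bump x s) (bumpG x s)"
proof (rule C1cI[where K="cball x s"])
  have "continuous_on UNIV (\<lambda>z::'a. eta ((z - x) /\<^sub>R s))"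
    by (rule continuous_on_compose2[OF continuous_on_eta[of UNIV]]) (auto intro!: continuous_intros)
  then show "continuous_on UNIV (bumpG x s)"
    unfolding bumpG_def[abs_def] using assms(1) by (auto intro!: continuous_intros)
  show "bump x s z = 0" if "z \<notin> cball x s" for z
    using that assms(1) by (auto simp: bump_def xi_def intro!: eta_outside)
      (simp add: dist_norm norm_minus_commute field_simps)
qed (use assms in \<open>auto intro: bump_deriv\<close>)

lemma bump_nonneg [simp]: "0 \<le> bump x s z"
  by (simp add: bump_def)

lemma bump_le_1: "bump x s z \<le> 1"
  using power_mono[OF eta_le_1 eta_nonneg, of "(z - x) /\<^sub>R s" 2] by (simp add: bump_def xi_def)

lemma norm_bumpG_le:
  assumes "s > 0"
  shows "norm (bumpG x s z) \<le> 1 / s"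
proof -
  define y where "y = (z - x) /\<^sub>R s"
  have "eta y * norm y \<le> 1"
  proof (cases "norm y \<ge> 1")
    case False
    then have "eta y * norm y \<le> 1 * 1" by (intro mult_mono) auto
    then show ?thesis by simp
  qed (simp add: eta_outside)
  then have "eta y * norm y / s \<le> 1 / s" using assms by (simp add: divide_right_mono)
  moreover have "norm (bumpG x s z) = eta y * norm y / s"
    using assms unfolding bumpG_def y_def[symmetric] by simp
  ultimately show ?thesis by simp
qed

lemma eta_integrable: "integrable lborel (eta :: 'a::euclidean_space \<Rightarrow> real)"
  by (rule integrable_lborel_compact_support[OF continuous_on_eta compact_cball[of 0 1]])
     (auto intro: eta_outside)

lemma xi_integrable: "integrable lborel (xi :: 'a::euclidean_space \<Rightarrow> real)"
proof (rule integrable_lborel_compact_support[OF _ compact_cball[of 0 1]])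
  show "continuous_on UNIV (xi :: 'a \<Rightarrow> real)"
    unfolding xi_def[abs_def] by (intro continuous_intros continuous_on_eta) auto
qed (auto simp: xi_def eta_outside)

lemma continuous_nonneg_integral_pos:
  fixes f :: "'a::euclidean_space \<Rightarrow> real"
  assumes "continuous_on UNIV f" "integrable lborel f" "\<And>x. 0 \<le> f x" "f a > 0"
  shows "0 < integral\<^sup>L lborel f"
proof (rule ccontr)
  assume "\<not> 0 < integral\<^sup>L lborel f"
  then have "integral\<^sup>L lborel f = 0" using assms(3) by (simp add: antisym_conv1 not_less)
  then have "AE x in lborel. f x = 0"
    using integral_nonneg_eq_0_iff_AE[OF assms(2)] assms(3) by simp
  then have ae: "AE x in lborel. \<not> f x \<noteq> 0" by simp
  have op: "open {x. f x \<noteq> 0}"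
    using assms(1) by (intro open_Collect_neq) auto
  then have "emeasure lborel {x. f x \<noteq> 0} = 0"
    using ae AE_iff_measurable[of "{x. f x \<noteq> 0}" lborel "\<lambda>x. \<not> f x \<noteq> 0"] by simp
  with op have "{x. f x \<noteq> 0} = {}"
    using open_not_negligible[of "{x. f x \<noteq> 0}"]
    by (auto simp: negligible_iff_null_sets null_sets_def)
  then show False using assms(4) by auto
qed

lemma eta_integral_pos: "0 < integral\<^sup>L lborel (eta :: 'a::euclidean_space \<Rightarrow> real)"
  by (rule continuous_nonneg_integral_pos[where a=0]) (auto simp: continuous_on_eta eta_integrable, simp add: eta_def)

text \<open>Jensen's inequality for the density \<open>eta\<close>, again from tangent lines. Only a
  lower bound on the mean is assumed, and multiplying it by \<open>2 * c\<close> needs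
  \<open>c\<close> nonnegative.\<close>

lemma eta_integral_max_mean:
  fixes f :: "'a::euclidean_space \<Rightarrow> real"
  assumes "integrable lborel (\<lambda>y. eta y * f y)" "integrable lborel (\<lambda>y. eta y * (f y)\<^sup>2)"
    "c \<ge> 0" "eta_mass TYPE('a) * c \<le> (\<integral>y. eta y * f y \<partial>lborel)"
  shows "eta_mass TYPE('a) * c\<^sup>2 \<le> (\<integral>y. eta y * (f y)\<^sup>2 \<partial>lborel)"
proof -
  define E where "E = eta_mass TYPE('a)"
  have "E * c\<^sup>2 = 2 * c * (E * c) - c\<^sup>2 * E" by (simp add: power2_eq_square)
  also have "\<dots> \<le> 2 * c * (\<integral>y. eta y * f y \<partial>lborel) - c\<^sup>2 * E"
    using assms(3,4) by (auto intro!: mult_left_mono simp: E_def)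
  also have "\<dots> = (\<integral>y. 2 * c * (eta y * f y) - c\<^sup>2 * eta y \<partial>lborel)"
    using assms(1) eta_integrable[where 'a='a] by (simp add: E_def)
  also have "\<dots> \<le> (\<integral>y. eta y * (f y)\<^sup>2 \<partial>lborel)"
  proof (rule integral_mono)
    fix y :: 'a
    have "eta y * (2 * c * f y) \<le> eta y * (c\<^sup>2 + (f y)\<^sup>2)"
      by (intro mult_left_mono sum_squares_bound) auto
    then show "2 * c * (eta y * f y) - c\<^sup>2 * eta y \<le> eta y * (f y)\<^sup>2"
      by (simp add: algebra_simps)
  qed (use assms eta_integrable in auto)
  finally show ?thesis by (simp add: E_def)
qed

lemma integrable_eta_mult:
  fixes g :: "'a::euclidean_space \<Rightarrow> real"
  assumes "continuous_on UNIV g"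
  shows "integrable lborel (\<lambda>y. eta y * g y)"
  by (rule integrable_lborel_compact_support[OF _ compact_cball[of 0 1]])
     (use assms in \<open>auto intro!: continuous_intros continuous_on_eta eta_outside\<close>)

text \<open>Replaces the Lebesgue differentiation theorem: averages at a small scale \<open>s\<close> that stay below \<open>K\<close> force
  \<open>\<phi> \<le> K\<close> up to an \<open>L\<^sup>2\<close> error of order \<open>s\<close>.\<close>

lemma mean_bound_imp_excess_small:
  fixes \<phi> :: "'a::euclidean_space \<Rightarrow> real"
  assumes C: "C1c \<Omega> \<phi> G" and s: "s > 0" and K: "K \<ge> 0"
    and mean: "\<And>x. (\<integral>y. eta y * \<phi> (x + s *\<^sub>R y) \<partial>lborel) \<le> eta_mass TYPE('a) * K"
  shows "(\<integral>\<^sup>+x. ennreal ((max 0 (\<phi> x - K))\<^sup>2) \<partial>lborel) \<le> ennreal (s\<^sup>2 * (\<integral>x. (norm (G x))\<^sup>2 \<partial>lborel))"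
proof -
  note [measurable] = C1c_borel[OF C]
  have [measurable]: "(eta :: 'a \<Rightarrow> real) \<in> borel_measurable borel"
    by (intro borel_measurable_continuous_onI continuous_on_eta)
  define E where "E = eta_mass TYPE('a)"
  define I where "I = (\<integral>x. (norm (G x))\<^sup>2 \<partial>lborel)"
  have E: "E > 0" by (simp add: E_def eta_integral_pos)
  have I0: "0 \<le> I" by (simp add: I_def)
  have nnE: "(\<integral>\<^sup>+y. ennreal (eta (y::'a)) \<partial>lborel) = ennreal E"
    unfolding E_def by (rule nn_integral_eq_integral) (auto simp: eta_integrable)
  have cp: "continuous_on UNIV (\<lambda>y. \<phi> (x + s *\<^sub>R y))" for x
    by (rule continuous_on_compose2[OF C1c_continuous(1)[OF C]]) (auto intro!: continuous_intros)
  define k where "k x y = ennreal (eta y * (\<phi> x - \<phi> (x + s *\<^sub>R y))\<^sup>2)" for x y :: 'a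
  have [measurable]: "(\<lambda>(x,y). k x y) \<in> borel_measurable (lborel \<Otimes>\<^sub>M lborel)"
    unfolding k_def by measurable
  \<comment> \<open>Where \<phi> exceeds \<open>K\<close>, the \<open>eta\<close>-mean of
    \<open>\<phi> x - \<phi> (x + s y)\<close> is at least \<open>\<phi> x - K\<close>, because the
    mean of \<phi> around \<open>x\<close> is at most \<open>K\<close>; Jensen squares this.
    Integrated over \<open>x\<close>, the right side is an average of translation
    differences.\<close>
  have pt: "ennreal E * ennreal ((max 0 (\<phi> x - K))\<^sup>2) \<le> (\<integral>\<^sup>+y. k x y \<partial>lborel)" for x
  proof (cases "\<phi> x \<ge> K")
    case True
    have i1: "integrable lborel (\<lambda>y::'a. eta y * (\<phi> x - \<phi> (x + s *\<^sub>R y)))"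
      and i2: "integrable lborel (\<lambda>y::'a. eta y * (\<phi> x - \<phi> (x + s *\<^sub>R y))\<^sup>2)"
      by (intro integrable_eta_mult continuous_intros cp)+
    have "(\<integral>y. eta y * (\<phi> x - \<phi> (x + s *\<^sub>R y)) \<partial>lborel) = \<phi> x * E - (\<integral>y. eta y * \<phi> (x + s *\<^sub>R y) \<partial>lborel)"
      using integrable_eta_mult[OF cp[of x]] eta_integrable[where 'a='a] by (simp add: right_diff_distrib E_def)
    then have "E * (\<phi> x - K) \<le> (\<integral>y. eta y * (\<phi> x - \<phi> (x + s *\<^sub>R y)) \<partial>lborel)"
      using mean[of x] by (simp add: E_def algebra_simps)
    from eta_integral_max_mean[OF i1 i2 _ this[unfolded E_def]] True
    have "E * (\<phi> x - K)\<^sup>2 \<le> (\<integral>y. eta y * (\<phi> x - \<phi> (x + s *\<^sub>R y))\<^sup>2 \<partial>lborel)"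
      by (simp add: E_def)
    moreover have "(\<integral>\<^sup>+y. k x y \<partial>lborel) = ennreal (\<integral>y. eta y * (\<phi> x - \<phi> (x + s *\<^sub>R y))\<^sup>2 \<partial>lborel)"
      unfolding k_def by (rule nn_integral_eq_integral[OF i2]) auto
    ultimately show ?thesis using True E by (simp add: ennreal_leI flip: ennreal_mult)
  qed (simp add: max_def)
  have "ennreal E * (\<integral>\<^sup>+x. ennreal ((max 0 (\<phi> x - K))\<^sup>2) \<partial>lborel) = (\<integral>\<^sup>+x. ennreal E * ennreal ((max 0 (\<phi> x - K))\<^sup>2) \<partial>lborel)"
    by (rule nn_integral_cmult[symmetric]) measurable
  also have "\<dots> \<le> (\<integral>\<^sup>+x. (\<integral>\<^sup>+y. k x y \<partial>lborel) \<partial>lborel)"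
    by (intro nn_integral_mono pt)
  also have "\<dots> = (\<integral>\<^sup>+y. (\<integral>\<^sup>+x. k x y \<partial>lborel) \<partial>lborel)"
    by (rule lborel_pair.Fubini'[symmetric]) measurable
  also have "\<dots> \<le> (\<integral>\<^sup>+y. ennreal (eta (y::'a)) * ennreal (s\<^sup>2 * I) \<partial>lborel)"
  proof (rule nn_integral_mono)
    fix y :: 'a
    show "(\<integral>\<^sup>+x. k x y \<partial>lborel) \<le> ennreal (eta y) * ennreal (s\<^sup>2 * I)"
    proof (cases "norm y \<ge> 1")
      case False
      have "(\<integral>\<^sup>+x. k x y \<partial>lborel) = ennreal (eta y) * (\<integral>\<^sup>+x. ennreal ((\<phi> (x + s *\<^sub>R y) - \<phi> x)\<^sup>2) \<partial>lborel)"
        unfolding k_def by (subst nn_integral_cmult[symmetric]) (auto simp: ennreal_mult power2_commute)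
      also have "\<dots> \<le> ennreal (eta y) * ennreal ((norm (s *\<^sub>R y))\<^sup>2 * I)"
        unfolding I_def by (intro mult_left_mono translation_estimate[OF C]) simp
      also have "\<dots> \<le> ennreal (eta y) * ennreal (s\<^sup>2 * I)"
        using False I0 s by (intro mult_left_mono ennreal_leI mult_right_mono power_mono) auto
      finally show ?thesis .
    qed (simp add: k_def eta_outside)
  qed
  also have "\<dots> = ennreal E * ennreal (s\<^sup>2 * I)"
    by (simp add: nn_integral_multc nnE)
  finally show ?thesis
    using E by (simp add: I_def ennreal_mult_le_mult_iff)
qed

subsection \<open>The first eigenvalue and the torsion function\<close>

text \<open>Every ball of radius \<open>r\<close> has at least half of its volume outside \<open>\<Omega>\<close>. This holds with
  \<open>r\<^sup>m = 2 |\<Omega>| / \<omega>\<^sub>m\<close> for arbitrary \<open>\<Omega>\<close>, and with \<open>r = 2\<close> for any union of unit balls that are far apart.\<close>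

definition half_empty :: "'a::euclidean_space set \<Rightarrow> real \<Rightarrow> bool" where
  "half_empty \<Omega> r \<longleftrightarrow> 0 < r \<and> (\<forall>x. measure lborel (ball (0::'a) r) / 2 \<le> measure lborel (ball x r - \<Omega>))"

lemma measure_ball_translate: "measure lborel (ball (x::'a::euclidean_space) r) = measure lborel (ball (0::'a) r)"
proof (cases "r \<ge> 0")
  case True
  then show ?thesis using content_ball_conv_unit_ball[of r x] content_ball_conv_unit_ball[of r "0::'a"] by simp
qed (simp add: ball_empty)

lemma half_emptyI:
  fixes \<Omega> :: "'a::euclidean_space set"
  assumes "open \<Omega>" "r > 0"
    "\<And>x. measure lborel (ball x r \<inter> \<Omega>) \<le> measure lborel (ball (0::'a) r) / 2"
  shows "half_empty \<Omega> r"
  unfolding half_empty_def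
proof (intro conjI allI)
  fix x :: 'a
  have fin: "ball x r \<in> fmeasurable lborel"
    by (rule fmeasurableI) (use emeasure_bounded_finite[OF bounded_ball, of x r] in auto)
  have "measure lborel (ball x r - (ball x r \<inter> \<Omega>)) = measure lborel (ball x r) - measure lborel (ball x r \<inter> \<Omega>)"
    using fin assms(1)
    by (intro measurable_measure_Diff) auto
  moreover have "ball x r - (ball x r \<inter> \<Omega>) = ball x r - \<Omega>" by auto
  ultimately show "measure lborel (ball (0::'a) r) / 2 \<le> measure lborel (ball x r - \<Omega>)"
    using assms(3)[of x] measure_ball_translate[of x r] by simp
qed (use assms in auto)

context admissible_domain
begin

abbreviation M where "M \<equiv> lebesgue_on \<Omega>"

lemma C1c_integral_eq:
  assumes "C1c \<Omega> \<phi> G"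
  shows "(\<integral>x. \<phi> x \<partial>M) = (\<integral>x. \<phi> x \<partial>lborel)"
    and "(n2 M \<phi>)\<^sup>2 = (\<integral>x. (\<phi> x)\<^sup>2 \<partial>lborel)"
    and "(n2 M G)\<^sup>2 = (\<integral>x. (norm (G x))\<^sup>2 \<partial>lborel)"
proof -
  note m [measurable] = C1c_borel[OF assms] and z = C1c_outside[OF assms]
  show "(\<integral>x. \<phi> x \<partial>M) = (\<integral>x. \<phi> x \<partial>lborel)"
    by (rule integral_lebesgue_on_eq_lborel[OF m(1) sets_domain z(1)])
  show "(n2 M \<phi>)\<^sup>2 = (\<integral>x. (\<phi> x)\<^sup>2 \<partial>lborel)"
    unfolding n2_sq real_norm_def power2_abs
    by (rule integral_lebesgue_on_eq_lborel[OF _ sets_domain]) (use z in auto)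
  show "(n2 M G)\<^sup>2 = (\<integral>x. (norm (G x))\<^sup>2 \<partial>lborel)"
    unfolding n2_sq
    by (rule integral_lebesgue_on_eq_lborel[OF _ sets_domain]) (use z in auto)
qed

lemma ex_half_empty:
  obtains r where "half_empty \<Omega> r" "measure lborel (ball (0::'a) 1) * r ^ DIM('a) = 2 * measure lebesgue \<Omega>"
proof -
  define w where "w = measure lborel (ball (0::'a) 1)"
  have w: "w > 0" by (simp add: w_def content_ball_pos)
  define r where "r = root DIM('a) (2 * measure lebesgue \<Omega> / w)"
  have r: "r > 0" using w measure_domain_pos by (simp add: r_def)
  have rp: "r ^ DIM('a) = 2 * measure lebesgue \<Omega> / w"
    using w measure_domain_pos by (simp add: r_def real_root_pow_pos2)
  have fin: "\<Omega> \<in> fmeasurable lborel"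
    using adm by (auto simp: admissible_def fmeasurable_def)
  have ml: "measure lebesgue \<Omega> = measure lborel \<Omega>"
    using open_domain by (intro measure_completion) auto
  have "half_empty \<Omega> r"
  proof (rule half_emptyI[OF open_domain r])
    fix x
    have "measure lborel (ball x r \<inter> \<Omega>) \<le> measure lborel \<Omega>"
      by (rule measure_mono_fmeasurable[OF _ _ fin]) (use open_domain in auto)
    also have "measure lborel \<Omega> = w * r ^ DIM('a) / 2"
      unfolding rp using w ml by simp
    also have "\<dots> = measure lborel (ball (0::'a) r) / 2"
      using content_ball_conv_unit_ball[of r "0::'a"] r by (simp add: w_def)
    finally show "measure lborel (ball x r \<inter> \<Omega>) \<le> measure lborel (ball (0::'a) r) / 2" .
  qed
  then show ?thesis using that rp w by (simp add: w_def)
qed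

lemma H01_Poincare:
  assumes "half_empty \<Omega> r" "H01 \<Omega> u g"
  shows "n2 M u \<le> sqrt 2 * r * n2 M g"
proof -
  have r: "r > 0" using assms(1) by (simp add: half_empty_def)
  have c: "n2 M \<phi> \<le> sqrt 2 * r * n2 M G" if "C1c \<Omega> \<phi> G" for \<phi> G
  proof (rule power2_le_imp_le)
    have "(\<integral>x. (\<phi> x)\<^sup>2 \<partial>lborel) \<le> 2 * r\<^sup>2 * (\<integral>x. (norm (G x))\<^sup>2 \<partial>lborel)"
      by (rule Poincare_C1c[OF that open_domain]) (use assms(1) in \<open>auto simp: half_empty_def\<close>)
    then show "(n2 M \<phi>)\<^sup>2 \<le> (sqrt 2 * r * n2 M G)\<^sup>2"
      by (simp add: power_mult_distrib C1c_integral_eq[OF that])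
  qed (use r in simp)
  obtain \<phi> G where 1: "L2 M u" "L2 M g" "\<And>n. C1c \<Omega> (\<phi> n) (G n)"
    "(\<lambda>n. n2 M (\<lambda>x. \<phi> n x - u x)) \<longlonglongrightarrow> 0" "(\<lambda>n. n2 M (\<lambda>x. G n x - g x)) \<longlonglongrightarrow> 0"
    using H01E[OF assms(2)] by blast
  have "(\<lambda>n. n2 M (\<phi> n)) \<longlonglongrightarrow> n2 M u"
    by (rule n2_tendsto[OF C1c_L2(1)[OF 1(3)] 1(1,4)])
  moreover have "(\<lambda>n. sqrt 2 * r * n2 M (G n)) \<longlonglongrightarrow> sqrt 2 * r * n2 M g"
    by (intro tendsto_mult tendsto_const n2_tendsto[OF C1c_L2(2)[OF 1(3)] 1(2,5)])
  ultimately show ?thesis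
    by (rule LIMSEQ_le) (use c[OF 1(3)] in auto)
qed

text \<open>Provides a nonzero competitor, so that the infimum defining \<open>lambda1\<close> is
  over a nonempty set and can be bounded from below.\<close>

lemma ex_bump:
  obtains x s where "s > 0" "C1c \<Omega> (bump x s) (bumpG x s)" "0 < n2 M (bump x s)"
proof -
  have "\<Omega> \<noteq> {}" using measure_domain_pos by auto
  then obtain x where x: "x \<in> \<Omega>" by auto
  then obtain s where s: "s > 0" "cball x s \<subseteq> \<Omega>"
    using open_domain open_contains_cball by blast
  have C: "C1c \<Omega> (bump x s) (bumpG x s)" by (rule C1c_bump[OF s])
  have "0 < (\<integral>z. (bump x s z)\<^sup>2 \<partial>lborel)"
  proof (rule continuous_nonneg_integral_pos[where a=x])
    show "0 < (bump x s x)\<^sup>2" by (simp add: bump_def xi_def eta_def)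
  qed (use C1c_integrable_lborel[OF C] C1c_continuous[OF C] in \<open>auto intro!: continuous_intros\<close>)
  then have "0 < n2 M (bump x s)"
    using C1c_integral_eq(2)[OF C] n2_nonneg[of M "bump x s"] by (metis less_irrefl order_le_less zero_power2)
  with s C show ?thesis using that by blast
qed

lemma lambda1_alt:
  "lambda1 \<Omega> = Inf {(n2 M g)\<^sup>2 / (n2 M u)\<^sup>2 | u g. H01 \<Omega> u g \<and> n2 M u \<noteq> 0}"
proof -
  have "((\<integral>x. (u x)\<^sup>2 \<partial>M) \<noteq> 0) = (n2 M u \<noteq> 0)" for u :: "'a \<Rightarrow> real"
    by (simp add: n2_def)
  then show ?thesis unfolding lambda1_def by (simp add: n2_sq)
qed

lemma lambda1_bound:
  assumes "H01 \<Omega> u g"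
  shows "lambda1 \<Omega> * (n2 M u)\<^sup>2 \<le> (n2 M g)\<^sup>2"
proof (cases "n2 M u = 0")
  case False
  have "lambda1 \<Omega> \<le> (n2 M g)\<^sup>2 / (n2 M u)\<^sup>2"
    unfolding lambda1_alt
    by (rule cInf_lower) (use assms False in \<open>auto intro!: bdd_belowI[where m=0]\<close>)
  then show ?thesis using False by (simp add: field_simps)
qed simp

lemma lambda1_ge:
  assumes "half_empty \<Omega> r"
  shows "1 / (2 * r\<^sup>2) \<le> lambda1 \<Omega>"
  unfolding lambda1_alt
proof (rule cInf_greatest)
  obtain x s where "C1c \<Omega> (bump x s) (bumpG x s)" "0 < n2 M (bump x s)" using ex_bump by blast
  then have "H01 \<Omega> (bump x s) (bumpG x s) \<and> n2 M (bump x s) \<noteq> 0" using C1c_H01 by auto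
  then show "{(n2 M g)\<^sup>2 / (n2 M u)\<^sup>2 | u g. H01 \<Omega> u g \<and> n2 M u \<noteq> 0} \<noteq> {}" by blast
next
  fix y assume "y \<in> {(n2 M g)\<^sup>2 / (n2 M u)\<^sup>2 | u g. H01 \<Omega> u g \<and> n2 M u \<noteq> 0}"
  then obtain u g where y: "y = (n2 M g)\<^sup>2 / (n2 M u)\<^sup>2" "H01 \<Omega> u g" "n2 M u \<noteq> 0" by blast
  have r: "r > 0" using assms by (simp add: half_empty_def)
  have "(n2 M u)\<^sup>2 \<le> (sqrt 2 * r * n2 M g)\<^sup>2"
    by (intro power_mono H01_Poincare[OF assms y(2)]) simp
  then have "(n2 M u)\<^sup>2 \<le> 2 * r\<^sup>2 * (n2 M g)\<^sup>2" by (simp add: power_mult_distrib)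
  then have "1 / (2 * r\<^sup>2) * (n2 M u)\<^sup>2 \<le> (n2 M g)\<^sup>2"
    using r by (simp add: pos_divide_le_eq mult.commute)
  then show "1 / (2 * r\<^sup>2) \<le> y" unfolding y(1) using y(3) by (subst pos_le_divide_eq) auto
qed

lemma lambda1_pos: "0 < lambda1 \<Omega>"
proof -
  obtain r where "half_empty \<Omega> r" using ex_half_empty by blast
  moreover from this have "0 < 1 / (2 * r\<^sup>2)" by (simp add: half_empty_def)
  ultimately show ?thesis using lambda1_ge[of r] by linarith
qed

section \<open>Existence and uniqueness of the torsion function\<close>

lemma torsion_H01: "torsion_sol \<Omega> v g \<Longrightarrow> H01 \<Omega> v g"
  by (simp add: torsion_sol_def)

text \<open>Density: both sides are continuous in the H1 norm, the right one because \<Omega> has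
  finite measure.\<close>

lemma torsion_test:
  assumes "torsion_sol \<Omega> v g" "H01 \<Omega> u h"
  shows "(\<integral>x. g x \<bullet> h x \<partial>M) = (\<integral>x. u x \<partial>M)"
proof -
  obtain \<phi> G where 1: "L2 M u" "L2 M h" "\<And>n. C1c \<Omega> (\<phi> n) (G n)"
    "(\<lambda>n. n2 M (\<lambda>x. \<phi> n x - u x)) \<longlonglongrightarrow> 0" "(\<lambda>n. n2 M (\<lambda>x. G n x - h x)) \<longlonglongrightarrow> 0"
    using H01E[OF assms(2)] by blast
  have g: "L2 M g" using H01_L2(2)[OF torsion_H01[OF assms(1)]] .
  have "(\<lambda>n. \<integral>x. G n x \<bullet> g x \<partial>M) \<longlonglongrightarrow> (\<integral>x. h x \<bullet> g x \<partial>M)"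
    by (rule L2_inner_tendsto[OF C1c_L2(2)[OF 1(3)] 1(2,5) g])
  moreover have "(\<integral>x. G n x \<bullet> g x \<partial>M) = (\<integral>x. \<phi> n x \<partial>M)" for n
  proof -
    have "(\<lambda>x. G n x \<bullet> g x) = (\<lambda>x. g x \<bullet> G n x)" by (auto simp: inner_commute)
    then show ?thesis using assms(1) 1(3)[of n] by (simp add: torsion_sol_def)
  qed
  ultimately have "(\<lambda>n. \<integral>x. \<phi> n x \<partial>M) \<longlonglongrightarrow> (\<integral>x. h x \<bullet> g x \<partial>M)" by simp
  moreover have "(\<lambda>n. \<integral>x. \<phi> n x \<partial>M) \<longlonglongrightarrow> (\<integral>x. u x \<partial>M)"
    by (rule L2_integral_tendsto[OF finite_measure_domain C1c_L2(1)[OF 1(3)] 1(1,4)])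
  ultimately have "(\<integral>x. h x \<bullet> g x \<partial>M) = (\<integral>x. u x \<partial>M)"
    by (rule LIMSEQ_unique)
  moreover have "(\<lambda>x. h x \<bullet> g x) = (\<lambda>x. g x \<bullet> h x)" by (auto simp: inner_commute)
  ultimately show ?thesis by simp
qed

text \<open>Testing both equations with the difference shows that its gradient has norm zero, and
  \<open>lambda1\<close> is positive.\<close>

lemma torsion_unique:
  assumes "torsion_sol \<Omega> v g" "torsion_sol \<Omega> v' g'"
  shows "AE x in M. v x = v' x"
proof -
  have H: "H01 \<Omega> (\<lambda>x. v x - v' x) (\<lambda>x. g x - g' x)"
    by (intro H01_diff torsion_H01 assms)
  have L: "L2 M g" "L2 M g'" "L2 M (\<lambda>x. g x - g' x)" "L2 M (\<lambda>x. v x - v' x)"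
    using H01_L2 H torsion_H01 assms by blast+
  have "(n2 M (\<lambda>x. g x - g' x))\<^sup>2 = (\<integral>x. g x \<bullet> (g x - g' x) \<partial>M) - (\<integral>x. g' x \<bullet> (g x - g' x) \<partial>M)"
    unfolding n2_sq power2_norm_eq_inner
    by (subst Bochner_Integration.integral_diff[symmetric]) (auto intro: L2_inner_integrable L simp: inner_diff_left)
  also have "\<dots> = 0"
    using torsion_test[OF assms(1) H] torsion_test[OF assms(2) H] by simp
  finally have "(n2 M (\<lambda>x. v x - v' x))\<^sup>2 \<le> 0"
    using lambda1_bound[OF H] lambda1_pos by (simp add: mult_le_0_iff)
  then have "(n2 M (\<lambda>x. v x - v' x))\<^sup>2 = 0" by simp
  then have "(\<integral>x. (norm (v x - v' x))\<^sup>2 \<partial>M) = 0" unfolding n2_sq .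
  then have "AE x in M. (norm (v x - v' x))\<^sup>2 = 0"
    using integral_nonneg_eq_0_iff_AE[OF L2_integrable_sq[OF L(4)]] by simp
  then show ?thesis by eventually_elim simp
qed

text \<open>Direct method: the energy \<open>J\<close> is minimised over test functions. Uniform
  convexity makes the gradients of a minimising sequence Cauchy, the Poincare inequality does the
  same for the functions, and the first variation at the limit is the weak equation.\<close>

lemma torsion_exists: "\<exists>v g. torsion_sol \<Omega> v g"
proof -
  interpret finite_measure M by (rule finite_measure_domain)
  obtain r where he: "half_empty \<Omega> r" using ex_half_empty by blast
  then have r: "r > 0" by (simp add: half_empty_def)
  define J where "J \<phi> G = (n2 M G)\<^sup>2 - 2 * (\<integral>x. \<phi> x \<partial>M)" for \<phi> :: "'a \<Rightarrow> real" and G :: "'a \<Rightarrow> 'a"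
  define S where "S = {J \<phi> G | \<phi> G. C1c \<Omega> \<phi> G}"
  define a where "a = n2 M (\<lambda>x. 1::real) * (sqrt 2 * r)"
  have L1: "L2 M (\<lambda>x. 1::real)" by (simp add: L2_def)
  \<comment> \<open>Poincare bounds the linear term by \<open>2 * a * n2 M G\<close>, and completing
    the square leaves \<open>- a\<^sup>2\<close>.\<close>
  have lower: "- a\<^sup>2 \<le> J \<phi> G" if "C1c \<Omega> \<phi> G" for \<phi> G
  proof -
    have "\<bar>\<integral>x. \<phi> x \<partial>M\<bar> \<le> n2 M \<phi> * n2 M (\<lambda>x. 1::real)"
      using L2_Cauchy_Schwarz[OF C1c_L2(1)[OF that] L1] by simp
    also have "\<dots> \<le> (sqrt 2 * r * n2 M G) * n2 M (\<lambda>x. 1::real)"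
      by (intro mult_right_mono H01_Poincare[OF he] C1c_H01[OF that]) simp
    finally have "(\<integral>x. \<phi> x \<partial>M) \<le> a * n2 M G" by (simp add: a_def mult_ac)
    moreover have "0 \<le> (n2 M G - a)\<^sup>2" by simp
    ultimately show ?thesis unfolding J_def by (simp add: power2_diff algebra_simps)
  qed
  have bdd: "bdd_below S" using lower by (auto simp: S_def intro!: bdd_belowI[where m="- a\<^sup>2"])
  have ne: "S \<noteq> {}" using C1c_zero by (auto simp: S_def)
  define m where "m = Inf S"
  have mle: "m \<le> J \<phi> G" if "C1c \<Omega> \<phi> G" for \<phi> G
    unfolding m_def by (rule cInf_lower[OF _ bdd]) (use that in \<open>auto simp: S_def\<close>)
  have "\<exists>\<phi> G. C1c \<Omega> \<phi> G \<and> J \<phi> G < m + 1 / real (Suc n)" for n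
  proof -
    have "Inf S < m + 1 / real (Suc n)" by (simp add: m_def)
    then show ?thesis using cInf_less_iff[OF ne bdd] by (auto simp: S_def)
  qed
  then obtain \<phi> G where C: "\<And>n. C1c \<Omega> (\<phi> n) (G n)" and Jn: "\<And>n. J (\<phi> n) (G n) < m + 1 / real (Suc n)"
    by metis
  note LG = C1c_L2(2)[OF C] and Lp = C1c_L2(1)[OF C]
  have ip: "integrable M (\<phi> n)" for n by (rule L2_integrable[OF finite_measure_domain Lp])
  have Jexp: "J (\<lambda>x. \<phi> n x + t * \<psi> x) (\<lambda>x. G n x + t *\<^sub>R H x)
      = J (\<phi> n) (G n) + 2 * t * ((\<integral>x. G n x \<bullet> H x \<partial>M) - (\<integral>x. \<psi> x \<partial>M)) + t\<^sup>2 * (n2 M H)\<^sup>2"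
    if "C1c \<Omega> \<psi> H" for n t \<psi> H
    using n2_expand[OF LG[of n] C1c_L2(2)[OF that], of t] ip[of n] L2_integrable[OF finite_measure_domain C1c_L2(1)[OF that]]
    by (simp add: J_def algebra_simps)
  \<comment> \<open>Parallelogram argument: moving from \<open>\<phi> i\<close> along the
    difference, \<open>t = -1\<close> reaches \<open>\<phi> j\<close> and \<open>t = -1/2\<close>
    the midpoint, whose energy is at least \<open>m\<close>. Eliminating the linear coefficient
    \<open>p\<close> leaves a bound by the two excesses over \<open>m\<close>.\<close>
  have par: "(n2 M (\<lambda>x. G i x - G j x))\<^sup>2 \<le> 2 * (1 / real (Suc i) + 1 / real (Suc j))" for i j
  proof -
    have Cd: "C1c \<Omega> (\<lambda>x. \<phi> i x + (-1) * \<phi> j x) (\<lambda>x. G i x + (-1) *\<^sub>R G j x)"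
      by (rule C1c_add_scaled[OF C C])
    define D where "D = (\<lambda>x. G i x - G j x)"
    have Deq: "G i x + (-1) *\<^sub>R G j x = D x" for x by (simp add: D_def)
    define p where "p = (\<integral>x. G i x \<bullet> D x \<partial>M) - (\<integral>x. \<phi> i x + (-1) * \<phi> j x \<partial>M)"
    have e: "J (\<lambda>x. \<phi> i x + t * (\<phi> i x + (-1) * \<phi> j x)) (\<lambda>x. G i x + t *\<^sub>R D x) = J (\<phi> i) (G i) + 2 * t * p + t\<^sup>2 * (n2 M D)\<^sup>2" for t
      using Jexp[OF Cd, of i t] unfolding Deq p_def .
    have "J (\<phi> j) (G j) = J (\<phi> i) (G i) - 2 * p + (n2 M D)\<^sup>2"
      using e[of "-1"] by (simp add: D_def)
    moreover have "m \<le> J (\<phi> i) (G i) - p + (n2 M D)\<^sup>2 / 4"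
    proof -
      have "C1c \<Omega> (\<lambda>x. \<phi> i x + (-1/2) * (\<phi> i x + (-1) * \<phi> j x)) (\<lambda>x. G i x + (-1/2) *\<^sub>R D x)"
        using C1c_add_scaled[OF C Cd, of i "-1/2"] unfolding Deq .
      from mle[OF this] show ?thesis unfolding e by (simp add: power2_eq_square)
    qed
    moreover have "d / 4 \<le> (a - m) / 2 + (b - m) / 2"
      if "b = a - 2 * p + d" "m \<le> a - p + d / 4" for a b d p m :: real
      using that by (simp add: field_simps)
    ultimately have "(n2 M D)\<^sup>2 / 4 \<le> (J (\<phi> i) (G i) - m) / 2 + (J (\<phi> j) (G j) - m) / 2" by blast
    also have "\<dots> \<le> (1 / real (Suc i)) / 2 + (1 / real (Suc j)) / 2"
      using Jn[of i] Jn[of j] by (intro add_mono divide_right_mono) auto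
    finally have "(n2 M D)\<^sup>2 / 4 \<le> (1 / real (Suc i)) / 2 + (1 / real (Suc j)) / 2" .
    moreover have "d \<le> 2 * (a + b)" if "d / 4 \<le> a / 2 + b / 2" for a b d :: real
      using that by simp
    ultimately show ?thesis unfolding D_def by blast
  qed
  have cauG: "\<exists>N. \<forall>i\<ge>N. \<forall>j\<ge>N. n2 M (\<lambda>x. G i x - G j x) < e" if e: "e > 0" for e
  proof -
    obtain N where N: "1 / real (Suc N) < e\<^sup>2 / 4"
      using nat_approx_posE[of "e\<^sup>2 / 4"] e by auto
    show ?thesis
    proof (intro exI[of _ N] allI impI)
      fix i j assume ij: "N \<le> i" "N \<le> j"
      have "1 / real (Suc i) \<le> 1 / real (Suc N)" "1 / real (Suc j) \<le> 1 / real (Suc N)"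
        using ij by (auto intro!: divide_left_mono)
      moreover have "d < e" if "d \<le> 2 * (a + b)" "c < e / 4" "a \<le> c" "b \<le> c" for a b c d e :: real
        using that by simp
      ultimately have "(n2 M (\<lambda>x. G i x - G j x))\<^sup>2 < e\<^sup>2" using par[of i j] N by blast
      then show "n2 M (\<lambda>x. G i x - G j x) < e" using e by (auto intro: power2_less_imp_less)
    qed
  qed
  have cauP: "\<exists>N. \<forall>i\<ge>N. \<forall>j\<ge>N. n2 M (\<lambda>x. \<phi> i x - \<phi> j x) < e" if e: "e > 0" for e
  proof -
    have "e / (sqrt 2 * r) > 0" using e r by simp
    from cauG[OF this] obtain N where N: "\<And>i j. i \<ge> N \<Longrightarrow> j \<ge> N \<Longrightarrow> n2 M (\<lambda>x. G i x - G j x) < e / (sqrt 2 * r)" by blast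
    show ?thesis
    proof (intro exI[of _ N] allI impI)
      fix i j assume ij: "N \<le> i" "N \<le> j"
      have "n2 M (\<lambda>x. \<phi> i x - \<phi> j x) \<le> sqrt 2 * r * n2 M (\<lambda>x. G i x - G j x)"
        by (rule H01_Poincare[OF he H01_diff[OF C1c_H01[OF C] C1c_H01[OF C]]])
      also have "\<dots> < e" using N[OF ij] r by (simp add: field_simps)
      finally show "n2 M (\<lambda>x. \<phi> i x - \<phi> j x) < e" .
    qed
  qed
  obtain g where g: "L2 M g" "(\<lambda>n. n2 M (\<lambda>x. G n x - g x)) \<longlonglongrightarrow> 0"
    using L2_complete[of M G, OF LG cauG] by blast
  obtain v where v: "L2 M v" "(\<lambda>n. n2 M (\<lambda>x. \<phi> n x - v x)) \<longlonglongrightarrow> 0"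
    using L2_complete[of M \<phi>, OF Lp cauP] by blast
  have H: "H01 \<Omega> v g" by (rule H01I[OF v(1) g(1) C v(2) g(2)])
  have "(\<integral>x. g x \<bullet> H x \<partial>M) = (\<integral>x. \<psi> x \<partial>M)" if CH: "C1c \<Omega> \<psi> H" for \<psi> H
  proof -
    define d where "d = (\<integral>x. g x \<bullet> H x \<partial>M) - (\<integral>x. \<psi> x \<partial>M)"
    define B where "B = (n2 M H)\<^sup>2"
    \<comment> \<open>Perturbing \<open>\<phi> n\<close> by \<open>t\<close> times the test function
      cannot bring the energy below \<open>m\<close>, and the energy of \<open>\<phi> n\<close>
      exceeds \<open>m\<close> by less than \<open>1 / (n + 1)\<close>; then \<open>n\<close> tends
      to infinity.\<close>
    have q: "0 \<le> 2 * t * d + t\<^sup>2 * B" for t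
    proof -
      have l1: "(\<lambda>n. 2 * t * ((\<integral>x. G n x \<bullet> H x \<partial>M) - (\<integral>x. \<psi> x \<partial>M)) + t\<^sup>2 * B + 1 / real (Suc n))
          \<longlonglongrightarrow> 2 * t * d + t\<^sup>2 * B + 0"
        unfolding d_def
        by (intro tendsto_intros L2_inner_tendsto[OF LG g C1c_L2(2)[OF CH]] LIMSEQ_Suc[OF lim_1_over_n, unfolded o_def])
      have "0 \<le> 2 * t * ((\<integral>x. G n x \<bullet> H x \<partial>M) - (\<integral>x. \<psi> x \<partial>M)) + t\<^sup>2 * B + 1 / real (Suc n)" for n
        using mle[OF C1c_add_scaled[OF C CH, of n t]] Jn[of n] unfolding Jexp[OF CH] B_def by linarith
      with LIMSEQ_le_const[OF l1, of 0] show ?thesis by auto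
    qed
    have "d = 0"
    proof (rule ccontr)
      assume "d \<noteq> 0"
      have B0: "B \<ge> 0" by (simp add: B_def)
      \<comment> \<open>Adding 1 keeps the denominator positive even if
        \<open>B = 0\<close>.\<close>
      define t where "t = - d / (B + 1)"
      have "B + 1 \<noteq> 0" using B0 by simp
      then have d: "d = - (t * (B + 1))" by (simp add: t_def)
      have "2 * t * d + t\<^sup>2 * B = - (t\<^sup>2 * (B + 2))" unfolding d by (simp add: algebra_simps power2_eq_square)
      also have "\<dots> < 0" using B0 \<open>d \<noteq> 0\<close> by (simp add: t_def)
      finally show False using q[of t] by simp
    qed
    then show ?thesis by (simp add: d_def)
  qed
  with H show ?thesis unfolding torsion_sol_def by blast
qed

lemma torsion_energy:
  assumes "torsion_sol \<Omega> v g"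
  shows "(n2 M g)\<^sup>2 = (\<integral>x. v x \<partial>M)"
  unfolding n2_sq power2_norm_eq_inner by (rule torsion_test[OF assms torsion_H01[OF assms]])

text \<open>Almost everywhere uniqueness is what makes the definite description in \<open>Tp\<close>
  single-valued.\<close>

lemma Tp_eq:
  assumes "torsion_sol \<Omega> v g"
  shows "Tp \<Omega> p = Lp_norm \<Omega> p v"
  unfolding Tp_def
proof (rule the_equality)
  fix t assume "\<exists>v g. torsion_sol \<Omega> v g \<and> t = Lp_norm \<Omega> p v"
  then obtain v' g' where t: "torsion_sol \<Omega> v' g'" "t = Lp_norm \<Omega> p v'" by blast
  have [measurable]: "v \<in> borel_measurable M" "v' \<in> borel_measurable M"
    using L2_measurable[OF H01_L2(1)[OF torsion_H01]] t(1) assms by blast+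
  have "AE x in M. \<bar>v' x\<bar> powr p = \<bar>v x\<bar> powr p"
    using torsion_unique[OF t(1) assms] by eventually_elim simp
  then have "(\<integral>x. \<bar>v' x\<bar> powr p \<partial>M) = (\<integral>x. \<bar>v x\<bar> powr p \<partial>M)"
    by (intro integral_cong_AE) measurable
  then show "t = Lp_norm \<Omega> p v" by (simp add: t(2) Lp_norm_def)
qed (use assms in blast)

lemma Tinf_eq:
  assumes "torsion_sol \<Omega> v g"
  shows "Tinf \<Omega> = Linf_norm \<Omega> v"
  unfolding Tinf_def
proof (rule the_equality)
  fix t assume "\<exists>v g. torsion_sol \<Omega> v g \<and> t = Linf_norm \<Omega> v"
  then obtain v' g' where t: "torsion_sol \<Omega> v' g'" "t = Linf_norm \<Omega> v'" by blast
  have "(AE x in M. \<bar>v' x\<bar> \<le> C) \<longleftrightarrow> (AE x in M. \<bar>v x\<bar> \<le> C)" for C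
    using torsion_unique[OF t(1) assms] by (intro eventually_cong) auto
  then show "t = Linf_norm \<Omega> v" by (simp add: t(2) Linf_norm_def)
qed (use assms in blast)

end

subsection \<open>Weighted averages of the torsion function\<close>

lemma nn_integral_inverse_one_plus_square: "(\<integral>\<^sup>+t. ennreal (inverse (1 + t\<^sup>2)) \<partial>lborel) < \<infinity>"
proof -
  have half: "(\<integral>\<^sup>+t. ennreal (inverse (1 + t\<^sup>2)) * indicator {0..} t \<partial>lborel) = ennreal (pi / 2 - arctan 0)"
    by (rule nn_integral_FTC_atLeast) (auto intro!: DERIV_arctan tendsto_arctan_at_top)
  have "(\<integral>\<^sup>+t. ennreal (inverse (1 + t\<^sup>2)) * indicator {..0} t \<partial>lborel)
      = (\<integral>\<^sup>+t. ennreal (inverse (1 + (0 + (-1) * t)\<^sup>2)) * indicator {..0} (0 + (-1) * t) \<partial>lborel)"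
    by (subst nn_integral_real_affine[where c="-1" and t=0]) auto
  also have "\<dots> = (\<integral>\<^sup>+t. ennreal (inverse (1 + t\<^sup>2)) * indicator {0..} t \<partial>lborel)"
    by (rule nn_integral_cong) (auto simp: indicator_def)
  finally have half': "(\<integral>\<^sup>+t. ennreal (inverse (1 + t\<^sup>2)) * indicator {..0} t \<partial>lborel) = ennreal (pi / 2 - arctan 0)"
    using half by simp
  have "(\<integral>\<^sup>+t. ennreal (inverse (1 + t\<^sup>2)) \<partial>lborel)
      \<le> (\<integral>\<^sup>+t. ennreal (inverse (1 + t\<^sup>2)) * indicator {0..} t + ennreal (inverse (1 + t\<^sup>2)) * indicator {..0} t \<partial>lborel)"
    by (rule nn_integral_mono) (auto simp: indicator_def)
  also have "\<dots> = (\<integral>\<^sup>+t. ennreal (inverse (1 + t\<^sup>2)) * indicator {0..} t \<partial>lborel) + (\<integral>\<^sup>+t. ennreal (inverse (1 + t\<^sup>2)) * indicator {..0} t \<partial>lborel)"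
    by (rule nn_integral_add) auto
  also have "\<dots> < \<infinity>" unfolding half half' by simp
  finally show ?thesis .
qed

text \<open>One factor per coordinate, each at most
  \<open>inverse (1 + (y \<bullet> b)\<^sup>2)\<close>, reduces the integral to a power of the
  one-dimensional arctangent integral. The exponent \<open>2 * DIM('a)\<close> is that of the
  squared weight.\<close>

lemma integrable_weight:
  "integrable lborel (\<lambda>y::'a::euclidean_space. (inverse (1 + (norm y)\<^sup>2)) ^ (2 * DIM('a)))"
proof (rule integrableI_nonneg)
  have "(\<integral>\<^sup>+y. ennreal ((inverse (1 + (norm (y::'a))\<^sup>2)) ^ (2 * DIM('a))) \<partial>lborel)
      \<le> (\<integral>\<^sup>+y. (\<Prod>b\<in>Basis. ennreal (inverse (1 + ((y::'a) \<bullet> b)\<^sup>2))) \<partial>lborel)"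
  proof (rule nn_integral_mono)
    fix y :: 'a
    have p: "1 + (norm y)\<^sup>2 > 0" by (simp add: add_pos_nonneg)
    have "(inverse (1 + (norm y)\<^sup>2)) ^ (2 * DIM('a)) \<le> (inverse (1 + (norm y)\<^sup>2)) ^ DIM('a)"
      using p by (intro power_decreasing) (auto simp: field_simps)
    also have "\<dots> = (\<Prod>b\<in>(Basis::'a set). inverse (1 + (norm y)\<^sup>2))" by simp
    also have "\<dots> \<le> (\<Prod>b\<in>Basis. inverse (1 + (y \<bullet> b)\<^sup>2))"
    proof (rule prod_mono)
      fix b :: 'a assume b: "b \<in> Basis"
      have "(y \<bullet> b)\<^sup>2 \<le> (norm y)\<^sup>2" using Basis_le_norm[OF b, of y] by (simp add: abs_le_square_iff[symmetric])
      then show "0 \<le> inverse (1 + (norm y)\<^sup>2) \<and> inverse (1 + (norm y)\<^sup>2) \<le> inverse (1 + (y \<bullet> b)\<^sup>2)"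
        using p by (auto intro!: le_imp_inverse_le simp: add_pos_nonneg)
    qed
    finally have "ennreal ((inverse (1 + (norm y)\<^sup>2)) ^ (2 * DIM('a))) \<le> ennreal (\<Prod>b\<in>Basis. inverse (1 + (y \<bullet> b)\<^sup>2))"
      by (rule ennreal_leI)
    also have "\<dots> = (\<Prod>b\<in>Basis. ennreal (inverse (1 + (y \<bullet> b)\<^sup>2)))"
      by (rule prod_ennreal[symmetric]) simp
    finally show "ennreal ((inverse (1 + (norm y)\<^sup>2)) ^ (2 * DIM('a))) \<le> (\<Prod>b\<in>Basis. ennreal (inverse (1 + (y \<bullet> b)\<^sup>2)))" .
  qed
  also have "\<dots> = (\<Prod>b\<in>(Basis::'a set). \<integral>\<^sup>+t. ennreal (inverse (1 + t\<^sup>2)) \<partial>lborel)"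
    by (rule nn_integral_lborel_prod) auto
  also have "\<dots> < \<infinity>"
    using nn_integral_inverse_one_plus_square by (simp add: power_less_top_ennreal)
  finally show "(\<integral>\<^sup>+y. ennreal ((inverse (1 + (norm (y::'a))\<^sup>2)) ^ (2 * DIM('a))) \<partial>lborel) < \<infinity>" .
qed auto

abbreviation weight_mass :: "'a::euclidean_space itself \<Rightarrow> real" where
  "weight_mass t \<equiv> (\<integral>y. (inverse (1 + (norm (y::'a))\<^sup>2)) ^ (2 * DIM('a)) \<partial>lborel)"

text \<open>Plays the role of an exponential \<open>exp (- a |z - x|)\<close>: the gradient is
  bounded by a multiple of \<open>a\<close> times the function, but this one is smooth at
  \<open>x\<close>.\<close>

definition weight :: "'a::euclidean_space \<Rightarrow> real \<Rightarrow> 'a \<Rightarrow> real" where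
  "weight x a z = (inverse (1 + a\<^sup>2 * (norm (z - x))\<^sup>2)) ^ DIM('a)"

definition weightG :: "'a::euclidean_space \<Rightarrow> real \<Rightarrow> 'a \<Rightarrow> 'a" where
  "weightG x a z = (- (real DIM('a) * 2 * a\<^sup>2 * inverse (1 + a\<^sup>2 * (norm (z - x))\<^sup>2) * weight x a z)) *\<^sub>R (z - x)"

lemma one_plus_pos: "0 < 1 + a\<^sup>2 * (norm (y::'a::euclidean_space))\<^sup>2"
  by (simp add: add_pos_nonneg)

lemma weight_nonneg: "0 \<le> weight x a z" and weight_le_1: "weight x a z \<le> 1"
proof -
  have "1 \<le> 1 + a\<^sup>2 * (norm (z - x))\<^sup>2" by simp
  then have "inverse (1 + a\<^sup>2 * (norm (z - x))\<^sup>2) \<le> 1" using inverse_le_1_iff by blast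
  moreover have i: "0 \<le> inverse (1 + a\<^sup>2 * (norm (z - x))\<^sup>2)" by simp
  ultimately show "weight x a z \<le> 1" unfolding weight_def by (intro power_le_one)
  show "0 \<le> weight x a z" unfolding weight_def using i by (rule zero_le_power)
qed

lemma weight_deriv: "(weight x a has_derivative (\<lambda>h. weightG x a z \<bullet> h)) (at (z::'a::euclidean_space))"
proof -
  let ?q = "\<lambda>z. 1 + a\<^sup>2 * (norm (z - x))\<^sup>2"
  have q: "(?q has_derivative (\<lambda>h. 2 * a\<^sup>2 * ((z - x) \<bullet> h))) (at z)"
    unfolding power2_norm_eq_inner by (auto intro!: derivative_eq_intros simp: inner_commute)
  have q0: "?q z \<noteq> 0" using one_plus_pos[of a "z - x"] by simp
  obtain n where n: "DIM('a) = Suc n" using DIM_positive[where 'a='a] by (metis Suc_pred)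
  have "((\<lambda>t::real. (inverse t) ^ DIM('a)) has_real_derivative - (real DIM('a) * inverse (?q z) * (inverse (?q z)) ^ DIM('a))) (at (?q z))"
    using DERIV_power[OF DERIV_inverse[OF q0], of "DIM('a)"] by (simp add: n mult.assoc)
  from has_derivative_compose[OF q this[unfolded has_field_derivative_def]]
  show ?thesis unfolding weight_def[abs_def]
    by (rule has_derivative_eq_rhs) (simp add: weightG_def weight_def fun_eq_iff)
qed

lemma weightG_continuous: "continuous_on UNIV (weightG x a)"
proof -
  have "\<forall>z\<in>UNIV. 1 + a\<^sup>2 * (norm (z - x))\<^sup>2 \<noteq> 0"
    using one_plus_pos[of a] by (metis less_irrefl)
  then show ?thesis
    unfolding weightG_def[abs_def] weight_def[abs_def] by (intro continuous_intros)
qed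

text \<open>The logarithmic gradient has size
  \<open>2 m a\<^sup>2 N / (1 + a\<^sup>2 N\<^sup>2)\<close>, and
  \<open>2 a N \<le> 1 + a\<^sup>2 N\<^sup>2\<close>.\<close>

lemma norm_weightG_le:
  assumes "a \<ge> 0"
  shows "norm (weightG x a (z::'a::euclidean_space)) \<le> real DIM('a) * a * weight x a z"
proof -
  define N q where "N = norm (z - x)" and "q = 1 + a\<^sup>2 * N\<^sup>2"
  have q: "q > 0" using one_plus_pos[of a "z - x"] by (simp add: q_def N_def)
  have "2 * (a * N) \<le> q" using sum_squares_bound[of 1 "a * N"] by (simp add: q_def power_mult_distrib)
  then have "2 * (a * N) * inverse q \<le> 1" using q by (simp add: field_simps)
  then have "(real DIM('a) * a * weight x a z) * (2 * (a * N) * inverse q) \<le> real DIM('a) * a * weight x a z * 1"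
    using assms weight_nonneg[of x a z] by (intro mult_left_mono) auto
  moreover have "norm (weightG x a z) = (real DIM('a) * a * weight x a z) * (2 * (a * N) * inverse q)"
    unfolding weightG_def norm_scaleR N_def[symmetric] unfolding q_def[symmetric]
    using q weight_nonneg[of x a z] assms by (simp add: abs_mult power2_eq_square)
  ultimately show ?thesis by simp
qed

lemma weight_borel: "weight x a \<in> borel_measurable borel"
  using weight_deriv[of x a]
  by (intro borel_measurable_continuous_onI continuous_at_imp_continuous_on ballI)
     (rule has_derivative_continuous)

lemma integral_weight_sq:
  assumes "a > 0"
  shows "integrable lborel (\<lambda>z::'a::euclidean_space. (weight x a z)\<^sup>2)"
    and "(\<integral>z. (weight x a z)\<^sup>2 \<partial>lborel) = (1 / a) ^ DIM('a) * weight_mass TYPE('a)"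
proof -
  note [measurable] = weight_borel[of x a]
  have sub: "(weight x a (x + (1/a) *\<^sub>R y))\<^sup>2 = (inverse (1 + (norm y)\<^sup>2)) ^ (2 * DIM('a))" for y :: 'a
    using assms by (simp add: weight_def power_divide mult.commute flip: power_mult)
  show "(\<integral>z. (weight x a z)\<^sup>2 \<partial>lborel) = (1 / a) ^ DIM('a) * weight_mass TYPE('a)"
    using integral_lborel_affine[of "\<lambda>z. (weight x a z)\<^sup>2" "1/a" x] assms by (simp add: sub)
  have "lborel = density (distr lborel borel (\<lambda>y. x + (1/a) *\<^sub>R y)) (\<lambda>_. ennreal ((1/a) ^ DIM('a)))"
    using lborel_affine[of "1/a" x] assms by simp
  moreover have "integrable (density (distr lborel borel (\<lambda>y. x + (1/a) *\<^sub>R y)) (\<lambda>_. ennreal ((1/a) ^ DIM('a)))) (\<lambda>z. (weight x a z)\<^sup>2)"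
    using assms integrable_weight[where 'a='a]
    by (subst integrable_density) (auto simp: integrable_distr_eq sub)
  ultimately show "integrable lborel (\<lambda>z. (weight x a z)\<^sup>2)" by simp
qed

context admissible_domain
begin

lemma integral_domain_le_lborel:
  fixes f :: "'a \<Rightarrow> real"
  assumes "integrable lborel f" "\<And>x. 0 \<le> f x"
  shows "integrable M f" "(\<integral>x. f x \<partial>M) \<le> (\<integral>x. f x \<partial>lborel)"
proof -
  have f: "f \<in> borel_measurable lborel" using assms by auto
  then have i: "integrable lebesgue f" using assms(1) integrable_completion by blast
  have ii: "integrable lebesgue (\<lambda>x. indicator \<Omega> x *\<^sub>R f x)" by (rule integrable_mult_indicator[OF sets_domain i])
  then show "integrable M f"
    using sets_domain integrable_restrict_space[of \<Omega> lebesgue f] by simp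
  have "(\<integral>x. f x \<partial>M) = (\<integral>x. indicator \<Omega> x *\<^sub>R f x \<partial>lebesgue)"
    using sets_domain by (intro integral_restrict_space) simp
  also have "\<dots> \<le> (\<integral>x. f x \<partial>lebesgue)"
    by (intro integral_mono ii i) (use assms(2) in \<open>auto simp: indicator_def\<close>)
  also have "\<dots> = (\<integral>x. f x \<partial>lborel)" by (rule integral_completion[OF f])
  finally show "(\<integral>x. f x \<partial>M) \<le> (\<integral>x. f x \<partial>lborel)" .
qed

text \<open>Rests on the identity \<open>|D(\<psi> v)|\<^sup>2 = Dv \<bullet> D(\<psi>\<^sup>2 v) +
  v\<^sup>2 |D\<psi>|\<^sup>2\<close>: the first term is evaluated by the equation, the left side is
  bounded below by \<open>lambda1\<close>.\<close>

lemma weighted_torsion_bound: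
  assumes T: "torsion_sol \<Omega> v g" and a: "a > 0" "(real DIM('a) * a)\<^sup>2 = lambda1 \<Omega> / 2"
  shows "(\<integral>z. (weight x a z * v z)\<^sup>2 \<partial>M) \<le> 4 / (lambda1 \<Omega>)\<^sup>2 * (\<integral>z. (weight x a z)\<^sup>2 \<partial>lborel)"
proof -
  define l where "l = lambda1 \<Omega>"
  have l: "l > 0" by (simp add: l_def lambda1_pos)
  define \<alpha> where "\<alpha> = real DIM('a) * a"
  have al: "\<alpha> > 0" "\<alpha>\<^sup>2 = l / 2" using a by (auto simp: \<alpha>_def l_def)
  define \<psi> H where "\<psi> = weight x a" and "H = weightG x a"
  have psi: "0 \<le> \<psi> z" "\<psi> z \<le> 1" for z by (auto simp: \<psi>_def weight_nonneg weight_le_1)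
  have absp: "\<bar>\<psi> z\<bar> \<le> 1" for z using psi[of z] by simp
  have Hb: "norm (H z) \<le> \<alpha> * \<psi> z" for z
    using norm_weightG_le[of a x z] a by (simp add: H_def \<psi>_def \<alpha>_def)
  have Hb': "norm (H z) \<le> \<alpha>" for z
    using Hb[of z] psi[of z] al by (meson mult_left_le order_trans less_imp_le)
  have d: "(\<psi> has_derivative (\<lambda>h. H z \<bullet> h)) (at z)" for z
    unfolding \<psi>_def H_def by (rule weight_deriv)
  have cH: "continuous_on UNIV H" unfolding H_def by (rule weightG_continuous)
  have Hv: "H01 \<Omega> v g" using T by (rule torsion_H01)
  have H1: "H01 \<Omega> (\<lambda>z. \<psi> z * v z) (\<lambda>z. \<psi> z *\<^sub>R g z + v z *\<^sub>R H z)"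
    by (rule H01_mult[OF Hv d cH absp Hb'])
  \<comment> \<open>Applying the product rule twice yields the gradient of
    \<open>\<psi>\<^sup>2 v\<close> in the nested form that matches the identity.\<close>
  have H2: "H01 \<Omega> (\<lambda>z. \<psi> z * (\<psi> z * v z)) (\<lambda>z. \<psi> z *\<^sub>R (\<psi> z *\<^sub>R g z + v z *\<^sub>R H z) + (\<psi> z * v z) *\<^sub>R H z)"
    by (rule H01_mult[OF H1 d cH absp Hb'])
  note L1 = H01_L2[OF H1] and L2 = H01_L2[OF H2] and Lv = H01_L2[OF Hv]
  define N where "N = (n2 M (\<lambda>z. \<psi> z * v z))\<^sup>2"
  have Neq: "N = (\<integral>z. (\<psi> z * v z)\<^sup>2 \<partial>M)" by (simp add: N_def n2_sq)
  have iN: "integrable M (\<lambda>z. (\<psi> z * v z)\<^sup>2)" using L2_integrable_sq[OF L1(1)] by simp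
  have iP: "integrable M (\<lambda>z. (\<psi> z)\<^sup>2)" and leP: "(\<integral>z. (\<psi> z)\<^sup>2 \<partial>M) \<le> (\<integral>z. (\<psi> z)\<^sup>2 \<partial>lborel)"
    using integral_domain_le_lborel[OF integral_weight_sq(1)[OF a(1), of x]] by (simp_all add: \<psi>_def)
  have iV: "integrable M (\<lambda>z. \<psi> z * (\<psi> z * v z))"
    by (rule L2_integrable[OF finite_measure_domain L2(1)])
  have LH: "L2 M (\<lambda>z. v z *\<^sub>R H z)"
    by (rule L2_real_scaleR_bounded[OF Lv(1) _ Hb'])
       (intro borel_measurable_lebesgue_on borel_measurable_continuous_onI cH)
  have "l * N \<le> (n2 M (\<lambda>z. \<psi> z *\<^sub>R g z + v z *\<^sub>R H z))\<^sup>2"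
    unfolding l_def N_def by (rule lambda1_bound[OF H1])
  also have "\<dots> = (\<integral>z. g z \<bullet> (\<psi> z *\<^sub>R (\<psi> z *\<^sub>R g z + v z *\<^sub>R H z) + (\<psi> z * v z) *\<^sub>R H z) + (norm (v z *\<^sub>R H z))\<^sup>2 \<partial>M)"
    unfolding n2_sq power2_norm_eq_inner
    by (intro Bochner_Integration.integral_cong refl)
       (simp add: inner_add_left inner_add_right inner_commute algebra_simps)
  also have "\<dots> = (\<integral>z. g z \<bullet> (\<psi> z *\<^sub>R (\<psi> z *\<^sub>R g z + v z *\<^sub>R H z) + (\<psi> z * v z) *\<^sub>R H z) \<partial>M) + (\<integral>z. (norm (v z *\<^sub>R H z))\<^sup>2 \<partial>M)"
    by (rule Bochner_Integration.integral_add[OF L2_inner_integrable[OF Lv(2) L2(2)] L2_integrable_sq[OF LH]])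
  also have "(\<integral>z. g z \<bullet> (\<psi> z *\<^sub>R (\<psi> z *\<^sub>R g z + v z *\<^sub>R H z) + (\<psi> z * v z) *\<^sub>R H z) \<partial>M) = (\<integral>z. \<psi> z * (\<psi> z * v z) \<partial>M)"
    by (rule torsion_test[OF T H2])
  \<comment> \<open>Young's inequality with weight \<open>l / 4\<close>. The gradient term will cost
    \<open>l / 2\<close>, so of the coefficient \<open>l\<close> on the left a quarter
    survives.\<close>
  also have "\<dots> \<le> (\<integral>z. l / 4 * (\<psi> z * v z)\<^sup>2 + 1 / l * (\<psi> z)\<^sup>2 \<partial>M)"
  proof (rule integral_mono[OF iV])
    fix z
    have "0 \<le> (\<psi> z)\<^sup>2 * (l * v z - 2)\<^sup>2 / (4 * l)" using l by simp
    also have "\<dots> = l / 4 * (\<psi> z * v z)\<^sup>2 + 1 / l * (\<psi> z)\<^sup>2 - \<psi> z * (\<psi> z * v z)"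
      using l by (simp add: field_simps power2_eq_square)
    finally show "\<psi> z * (\<psi> z * v z) \<le> l / 4 * (\<psi> z * v z)\<^sup>2 + 1 / l * (\<psi> z)\<^sup>2" by simp
  qed (use iN iP in auto)
  also have "\<dots> = l / 4 * N + 1 / l * (\<integral>z. (\<psi> z)\<^sup>2 \<partial>M)"
    using iN iP by (simp add: Neq)
  also have "(\<integral>z. (norm (v z *\<^sub>R H z))\<^sup>2 \<partial>M) \<le> (\<integral>z. \<alpha>\<^sup>2 * (\<psi> z * v z)\<^sup>2 \<partial>M)"
  proof (rule integral_mono[OF L2_integrable_sq[OF LH]])
    fix z
    have "(norm (v z *\<^sub>R H z))\<^sup>2 \<le> (\<bar>v z\<bar> * (\<alpha> * \<psi> z))\<^sup>2"
      unfolding norm_scaleR real_norm_def using Hb[of z] by (intro power_mono mult_left_mono) auto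
    also have "\<dots> = \<alpha>\<^sup>2 * (\<psi> z * v z)\<^sup>2" by (simp add: power_mult_distrib)
    finally show "(norm (v z *\<^sub>R H z))\<^sup>2 \<le> \<alpha>\<^sup>2 * (\<psi> z * v z)\<^sup>2" .
  qed (use iN in auto)
  also have "\<dots> = l / 2 * N" by (simp add: Neq al)
  finally have "l / 4 * N \<le> 1 / l * (\<integral>z. (\<psi> z)\<^sup>2 \<partial>M)" by (simp add: field_simps)
  also have "\<dots> \<le> 1 / l * (\<integral>z. (\<psi> z)\<^sup>2 \<partial>lborel)"
    using l leP by (intro mult_left_mono) auto
  finally have "N \<le> 4 / l\<^sup>2 * (\<integral>z. (\<psi> z)\<^sup>2 \<partial>lborel)"
    using l by (simp add: field_simps power2_eq_square)
  then show ?thesis by (simp add: Neq \<psi>_def l_def)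
qed

end

subsection \<open>The sub-mean-value property\<close>

text \<open>Passes to an integral over a compact box, on which the mean can be differentiated under
  the integral sign.\<close>

lemma integral_lborel_eq_cbox:
  fixes f :: "'a::euclidean_space \<Rightarrow> real"
  assumes "integrable lborel f" "\<And>y. norm y > 1 \<Longrightarrow> f y = 0"
  shows "(\<integral>y. f y \<partial>lborel) = integral (cbox (- One) One) f"
proof -
  have "f y = 0" if "y \<notin> cbox (- One) One" for y
  proof (rule assms(2), rule ccontr)
    assume "\<not> norm y > 1"
    then have "\<bar>y \<bullet> b\<bar> \<le> 1" if "b \<in> Basis" for b using Basis_le_norm[OF that, of y] by linarith
    then have "y \<in> cbox (- One) One" by (auto simp: mem_box abs_le_iff minus_le_iff)
    with that show False by simp
  qed
  then have "(\<lambda>y. if y \<in> cbox (- One) One then f y else 0) = f" by auto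
  then have "integral (cbox (- One) One) f = integral UNIV f"
    by (metis integral_restrict_UNIV)
  then show ?thesis using integral_lborel[OF assms(1)] by simp
qed

lemma mean_deriv:
  fixes \<phi> :: "'a::euclidean_space \<Rightarrow> real"
  assumes C: "C1c \<Omega> \<phi> G"
  shows "((\<lambda>s. \<integral>y. eta y * \<phi> (x + s *\<^sub>R y) \<partial>lborel) has_real_derivative (\<integral>y. eta y * (G (x + \<tau> *\<^sub>R y) \<bullet> y) \<partial>lborel)) (at \<tau>)"
proof -
  have cp: "continuous_on UNIV (\<lambda>y. \<phi> (x + s *\<^sub>R y))" for s
    by (rule continuous_on_compose2[OF C1c_continuous(1)[OF C]]) (auto intro!: continuous_intros)
  have cG: "continuous_on UNIV (\<lambda>y. G (x + s *\<^sub>R y))" for s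
    by (rule continuous_on_compose2[OF C1c_continuous(2)[OF C]]) (auto intro!: continuous_intros)
  let ?B = "cbox (- One) (One :: 'a)"
  have 1: "(\<integral>y. eta y * \<phi> (x + s *\<^sub>R y) \<partial>lborel) = integral ?B (\<lambda>y. eta y * \<phi> (x + s *\<^sub>R y))" for s
    by (rule integral_lborel_eq_cbox[OF integrable_eta_mult[OF cp]]) (simp add: eta_outside)
  have 2: "(\<integral>y. eta y * (G (x + s *\<^sub>R y) \<bullet> y) \<partial>lborel) = integral ?B (\<lambda>y. eta y * (G (x + s *\<^sub>R y) \<bullet> y))" for s
    by (rule integral_lborel_eq_cbox[OF integrable_eta_mult]) (auto intro!: continuous_intros cG simp: eta_outside)
  have "((\<lambda>s. integral ?B (\<lambda>y. eta y * \<phi> (x + s *\<^sub>R y))) has_real_derivative integral ?B (\<lambda>y. eta y * (G (x + \<tau> *\<^sub>R y) \<bullet> y))) (at \<tau> within UNIV)"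
  proof (rule leibniz_rule_field_derivative)
    fix s :: real and y :: 'a
    have "((\<lambda>s. x + s *\<^sub>R y) has_derivative (\<lambda>t. t *\<^sub>R y)) (at s)" by (auto intro!: derivative_eq_intros)
    moreover have "(\<phi> has_derivative (\<lambda>h. G (x + s *\<^sub>R y) \<bullet> h)) (at (x + s *\<^sub>R y))" using C by (simp add: C1c_def)
    ultimately have "((\<lambda>s. \<phi> (x + s *\<^sub>R y)) has_derivative (\<lambda>t. G (x + s *\<^sub>R y) \<bullet> (t *\<^sub>R y))) (at s)"
      by (rule has_derivative_compose)
    then have "((\<lambda>s. \<phi> (x + s *\<^sub>R y)) has_real_derivative G (x + s *\<^sub>R y) \<bullet> y) (at s)"
      by (simp add: has_field_derivative_def mult_commute_abs)
    then show "((\<lambda>s. eta y * \<phi> (x + s *\<^sub>R y)) has_real_derivative eta y * (G (x + s *\<^sub>R y) \<bullet> y)) (at s within UNIV)"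
      using DERIV_cmult by blast
  next
    fix s :: real
    show "(\<lambda>y. eta y * \<phi> (x + s *\<^sub>R y)) integrable_on ?B"
      by (intro integrable_continuous continuous_intros continuous_on_eta continuous_on_subset[OF cp]) auto
  next
    have "continuous_on (UNIV \<times> ?B) (\<lambda>p. G (x + fst p *\<^sub>R snd p))"
      by (rule continuous_on_compose2[OF C1c_continuous(2)[OF C]]) (auto intro!: continuous_intros)
    moreover have "continuous_on (UNIV \<times> ?B) (\<lambda>p. eta (snd p))"
      by (rule continuous_on_compose2[OF continuous_on_eta[of UNIV]]) (auto intro!: continuous_intros)
    ultimately show "continuous_on (UNIV \<times> ?B) (\<lambda>(s, y). eta y * (G (x + s *\<^sub>R y) \<bullet> y))"
      unfolding split_beta by (intro continuous_intros)
  qed auto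
  then show ?thesis unfolding 1 2 by simp
qed

lemma mean_deriv_eq:
  fixes \<phi> :: "'a::euclidean_space \<Rightarrow> real"
  assumes C: "C1c \<Omega> \<phi> G" and t: "\<tau> > 0"
  shows "\<tau> ^ DIM('a) * (\<integral>y. eta y * (G (x + \<tau> *\<^sub>R y) \<bullet> y) \<partial>lborel) = - \<tau> * (\<integral>z. G z \<bullet> bumpG x \<tau> z \<partial>lborel)"
proof -
  note [measurable] = C1c_borel[OF C] C1c_borel[OF C1c_bump[OF t subset_UNIV, of x]]
  have sub: "G (x + \<tau> *\<^sub>R y) \<bullet> bumpG x \<tau> (x + \<tau> *\<^sub>R y) = (- 1 / \<tau>) * (eta y * (G (x + \<tau> *\<^sub>R y) \<bullet> y))" for y
    using t by (simp add: bumpG_def)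
  have "(\<integral>z. G z \<bullet> bumpG x \<tau> z \<partial>lborel) = \<tau> ^ DIM('a) * (\<integral>y. G (x + \<tau> *\<^sub>R y) \<bullet> bumpG x \<tau> (x + \<tau> *\<^sub>R y) \<partial>lborel)"
    by (rule integral_lborel_affine) (use t in auto)
  also have "\<dots> = \<tau> ^ DIM('a) * ((- 1 / \<tau>) * (\<integral>y. eta y * (G (x + \<tau> *\<^sub>R y) \<bullet> y) \<partial>lborel))"
    unfolding sub by simp
  finally show ?thesis using t by simp
qed

lemma integral_bump:
  fixes x :: "'a::euclidean_space"
  assumes "\<tau> > 0"
  shows "(\<integral>z. bump x \<tau> z \<partial>lborel) = \<tau> ^ DIM('a) * xi_mass TYPE('a)"
  using integral_lborel_affine[OF C1c_borel(1)[OF C1c_bump[OF assms subset_UNIV, of x]] assms, of x] assms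
  by (simp add: bump_def)

text \<open>The hypothesis bounds the derivative of the mean in the scale from below, and
  integrating from \<open>s\<close> to \<open>r\<close> gives the claim. The slack \<open>e\<close>
  accommodates approximants; its factor \<open>1 / s ^ DIM('a)\<close> is harmless while
  \<open>s\<close> is fixed.\<close>

lemma mean_value_ineq:
  fixes \<phi> :: "'a::euclidean_space \<Rightarrow> real"
  assumes C: "C1c \<Omega> \<phi> G" and s: "0 < s" "s \<le> r" and e: "e \<ge> 0"
    and sub: "\<And>\<tau>. s \<le> \<tau> \<Longrightarrow> \<tau> \<le> r \<Longrightarrow> (\<integral>z. G z \<bullet> bumpG x \<tau> z \<partial>lborel) \<le> (\<integral>z. bump x \<tau> z \<partial>lborel) + e"
  shows "(\<integral>y. eta y * \<phi> (x + s *\<^sub>R y) \<partial>lborel)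
      \<le> (\<integral>y. eta y * \<phi> (x + r *\<^sub>R y) \<partial>lborel) + r\<^sup>2 * (xi_mass TYPE('a) + e / s ^ DIM('a))"
proof -
  define A where "A s = (\<integral>y. eta y * \<phi> (x + s *\<^sub>R y) \<partial>lborel)" for s
  define A' where "A' \<tau> = (\<integral>y. eta y * (G (x + \<tau> *\<^sub>R y) \<bullet> y) \<partial>lborel)" for \<tau>
  define X where "X = xi_mass TYPE('a)"
  have X: "X \<ge> 0" by (simp add: X_def)
  \<comment> \<open>Bounds \<open>\<tau> * (X + e / \<tau> ^ DIM('a))\<close> on the whole interval
    from \<open>s\<close> to \<open>r\<close>, so that adding \<open>c * \<tau>\<close> makes the
    mean nondecreasing.\<close>
  define c where "c = r * (X + e / s ^ DIM('a))"
  have c0: "c \<ge> 0" using X s e by (auto simp: c_def)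
  have A'ge: "0 \<le> A' \<tau> + c" if t: "s \<le> \<tau>" "\<tau> \<le> r" for \<tau>
  proof -
    have t0: "\<tau> > 0" using s t by simp
    then have p: "\<tau> ^ DIM('a) > 0" by simp
    have "\<tau> ^ DIM('a) * A' \<tau> = - \<tau> * (\<integral>z. G z \<bullet> bumpG x \<tau> z \<partial>lborel)"
      unfolding A'_def by (rule mean_deriv_eq[OF C t0])
    also have "\<dots> \<ge> - \<tau> * (\<tau> ^ DIM('a) * X + e)"
      using sub[OF t] t0 by (simp add: integral_bump X_def)
    also have "- \<tau> * (\<tau> ^ DIM('a) * X + e) = \<tau> ^ DIM('a) * (- \<tau> * (X + e / \<tau> ^ DIM('a)))"
      using t0 by (simp add: algebra_simps)
    finally have "A' \<tau> \<ge> - \<tau> * (X + e / \<tau> ^ DIM('a))"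
      using p by (simp only: mult_le_cancel_left_pos)
    moreover have "\<tau> * (X + e / \<tau> ^ DIM('a)) \<le> c"
      unfolding c_def using t t0 s e X
      by (intro mult_mono add_mono divide_left_mono power_mono) auto
    ultimately show ?thesis by simp
  qed
  have "A s + c * s \<le> A r + c * r"
  proof (rule DERIV_nonneg_imp_nondecreasing[OF s(2)])
    fix \<tau> assume t: "s \<le> \<tau>" "\<tau> \<le> r"
    have "((\<lambda>\<tau>. A \<tau> + c * \<tau>) has_real_derivative (A' \<tau> + c)) (at \<tau>)"
      using DERIV_add[OF mean_deriv[OF C, of x \<tau>] DERIV_cmult_Id[of c \<tau> UNIV]]
      by (simp add: A_def A'_def)
    then show "\<exists>y. ((\<lambda>\<tau>. A \<tau> + c * \<tau>) has_real_derivative y) (at \<tau>) \<and> 0 \<le> y"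
      using A'ge[OF t] by blast
  qed
  moreover have "c * r - c * s \<le> r * c" using c0 s by (simp add: mult.commute)
  ultimately have "A s \<le> A r + r * c" by linarith
  then show ?thesis by (simp add: A_def c_def X_def power2_eq_square mult.assoc)
qed

context admissible_domain
begin

lemma L2_const: "L2 M (\<lambda>x. c :: real)"
proof -
  interpret finite_measure M by (rule finite_measure_domain)
  show ?thesis by (simp add: L2_def)
qed

lemma n2_bounded_le:
  assumes "f \<in> borel_measurable M" "\<And>x. norm (f x) \<le> c"
  shows "L2 M f" "n2 M f \<le> c * n2 M (\<lambda>x. 1::real)"
proof -
  have c: "c \<ge> 0" using assms(2) by (meson norm_ge_zero order_trans)
  have b: "AE x in M. norm (f x) \<le> norm c" using assms(2) c by simp
  show "L2 M f" by (rule L2_bound[OF L2_const assms(1) b])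
  have "n2 M f \<le> n2 M (\<lambda>x. c)" by (rule n2_mono[OF L2_const assms(1) b])
  also have "\<dots> = c * n2 M (\<lambda>x. 1::real)" using c n2_scaleR[of M c "\<lambda>x. 1::real"] by simp
  finally show "n2 M f \<le> c * n2 M (\<lambda>x. 1::real)" .
qed

text \<open>The sub-mean-value inequality is applied to the smooth approximants of \<open>W\<close>, for which it holds up to an
  error that vanishes for fixed \<open>s\<close>; only afterwards \<open>s\<close> tends to zero.\<close>

lemma subsolution_bounded:
  fixes W :: "'a \<Rightarrow> real"
  assumes H: "H01 \<Omega> W gW" and W0: "\<And>x. 0 \<le> W x" and r: "r > 0" and Q: "Q \<ge> 0"
    and sub: "\<And>x \<tau>. \<tau> > 0 \<Longrightarrow> (\<integral>z. gW z \<bullet> bumpG x \<tau> z \<partial>M) \<le> (\<integral>z. bump x \<tau> z \<partial>lborel)"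
    and avg: "\<And>x. (\<integral>z. eta ((z - x) /\<^sub>R r) * W z \<partial>M) \<le> r ^ DIM('a) * Q"
  shows "AE x in M. W x \<le> (Q + r\<^sup>2 * xi_mass TYPE('a)) / eta_mass TYPE('a)"
proof -
  define X E where "X = xi_mass TYPE('a)" and "E = eta_mass TYPE('a)"
  have E: "E > 0" by (simp add: E_def eta_integral_pos)
  have X: "X \<ge> 0" by (simp add: X_def)
  define K where "K = (Q + r\<^sup>2 * X) / E"
  have K: "K \<ge> 0" using Q X E by (simp add: K_def)
  define \<mu> where "\<mu> = n2 M (\<lambda>x. 1::real)"
  have mu: "\<mu> \<ge> 0" by (simp add: \<mu>_def)
  obtain \<phi> G where 1: "L2 M W" "L2 M gW" "\<And>n. C1c \<Omega> (\<phi> n) (G n)"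
    "(\<lambda>n. n2 M (\<lambda>x. \<phi> n x - W x)) \<longlonglongrightarrow> 0" "(\<lambda>n. n2 M (\<lambda>x. G n x - gW x)) \<longlonglongrightarrow> 0"
    using H01E[OF H] by blast
  define e f where "e n = n2 M (\<lambda>x. \<phi> n x - W x)" and "f n = n2 M (\<lambda>x. G n x - gW x)" for n
  have e0: "e n \<ge> 0" and f0: "f n \<ge> 0" for n by (auto simp: e_def f_def)
  define P where "P x = max 0 (W x - K)" for x
  have Wm [measurable]: "W \<in> borel_measurable M" using 1(1) by (rule L2_measurable)
  have Pm [measurable]: "P \<in> borel_measurable M" unfolding P_def by measurable
  have LP: "L2 M P"
    by (rule L2_bound[OF 1(1) Pm]) (use W0 K in \<open>auto simp: P_def\<close>)
  \<comment> \<open>The excess \<open>P\<close> of \<open>W\<close> over \<open>K\<close> does not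
    depend on \<open>s\<close>, so an estimate of order \<open>s\<close> for all small
    \<open>s\<close> forces it to vanish.\<close>
  have main: "n2 M P \<le> s * n2 M gW" if s: "0 < s" "s \<le> r" for s
  proof -
    \<comment> \<open>First summand: replacing \<open>W\<close> by \<open>\<phi> n\<close> in the
      average at scale \<open>r\<close>. Second: replacing \<open>gW\<close> by \<open>G n\<close>
      in the subsolution inequality, where the bump gradients are at most \<open>1 / s\<close>. Both
      use Cauchy-Schwarz on \<Omega>.\<close>
    define c where "c n = \<mu> * e n / r ^ DIM('a) + r\<^sup>2 * ((f n * ((1 / s) * \<mu>)) / s ^ DIM('a))" for n
    have c0: "c n \<ge> 0" for n using e0 f0 mu s r by (simp add: c_def)
    have climit: "c \<longlonglongrightarrow> 0"
    proof -
      have "c \<longlonglongrightarrow> \<mu> * 0 / r ^ DIM('a) + r\<^sup>2 * ((0 * ((1 / s) * \<mu>)) / s ^ DIM('a))"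
        unfolding c_def e_def f_def using r s by (intro tendsto_intros 1(4,5)) auto
      then show ?thesis by simp
    qed
    \<comment> \<open>The approximant satisfies the mean bound only with a raised threshold, which
      tends to \<open>K\<close> with \<open>n\<close>.\<close>
    define Kn where "Kn n = K + c n / E" for n
    have Kn0: "Kn n \<ge> 0" for n using K c0 E by (simp add: Kn_def)
    have mean: "(\<integral>y. eta y * \<phi> n (x + s *\<^sub>R y) \<partial>lborel) \<le> E * Kn n" for n x
    proof -
      note [measurable] = C1c_borel[OF 1(3)[of n]]
      have kc: "continuous_on UNIV (\<lambda>z. eta ((z - x) /\<^sub>R r))"
        by (rule continuous_on_compose2[OF continuous_on_eta[of UNIV]]) (use r in \<open>auto intro!: continuous_intros\<close>)
      then have kb [measurable]: "(\<lambda>z. eta ((z - x) /\<^sub>R r)) \<in> borel_measurable borel"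
        by (rule borel_measurable_continuous_onI)
      have km: "(\<lambda>z. eta ((z - x) /\<^sub>R r)) \<in> borel_measurable M" by (rule borel_measurable_lebesgue_on[OF kb])
      have k1: "norm (eta ((z - x) /\<^sub>R r)) \<le> 1" for z by simp
      note kL = n2_bounded_le[OF km k1]
      have d: "L2 M (\<lambda>z. \<phi> n z - W z)" and dG: "L2 M (\<lambda>z. G n z - gW z)"
        by (intro L2_diff C1c_L2[OF 1(3)] 1(1,2))+
      have "r ^ DIM('a) * (\<integral>y. eta y * \<phi> n (x + r *\<^sub>R y) \<partial>lborel) = (\<integral>z. eta ((z - x) /\<^sub>R r) * \<phi> n z \<partial>lborel)"
        using integral_lborel_affine[of "\<lambda>z. eta ((z - x) /\<^sub>R r) * \<phi> n z" r x] r by simp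
      also have "\<dots> = (\<integral>z. eta ((z - x) /\<^sub>R r) * \<phi> n z \<partial>M)"
        by (rule integral_lebesgue_on_eq_lborel[OF _ sets_domain, symmetric])
           (use C1c_outside[OF 1(3)[of n]] in auto)
      also have "\<dots> = (\<integral>z. eta ((z - x) /\<^sub>R r) * W z \<partial>M) + (\<integral>z. eta ((z - x) /\<^sub>R r) * (\<phi> n z - W z) \<partial>M)"
      proof -
        have "eta ((z - x) /\<^sub>R r) * \<phi> n z = eta ((z - x) /\<^sub>R r) * W z + eta ((z - x) /\<^sub>R r) * (\<phi> n z - W z)" for z
          by (simp add: right_diff_distrib)
        then show ?thesis
          using Bochner_Integration.integral_add[OF L2_mult_integrable[OF kL(1) 1(1)] L2_mult_integrable[OF kL(1) d]]
          by simp
      qed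
      also have "\<dots> \<le> r ^ DIM('a) * Q + \<mu> * e n"
      proof (rule add_mono[OF avg])
        have "(\<integral>z. eta ((z - x) /\<^sub>R r) * (\<phi> n z - W z) \<partial>M) \<le> n2 M (\<lambda>z. eta ((z - x) /\<^sub>R r)) * e n"
          using L2_Cauchy_Schwarz[OF kL(1) d] by (simp add: e_def)
        also have "\<dots> \<le> \<mu> * e n" using kL(2) e0 by (intro mult_right_mono) (auto simp: \<mu>_def)
        finally show "(\<integral>z. eta ((z - x) /\<^sub>R r) * (\<phi> n z - W z) \<partial>M) \<le> \<mu> * e n" .
      qed
      finally have Ar: "(\<integral>y. eta y * \<phi> n (x + r *\<^sub>R y) \<partial>lborel) \<le> Q + \<mu> * e n / r ^ DIM('a)"
        using r by (simp add: field_simps)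
      have "(\<integral>y. eta y * \<phi> n (x + s *\<^sub>R y) \<partial>lborel)
        \<le> (\<integral>y. eta y * \<phi> n (x + r *\<^sub>R y) \<partial>lborel) + r\<^sup>2 * (X + f n * ((1 / s) * \<mu>) / s ^ DIM('a))"
        unfolding X_def
      proof (rule mean_value_ineq[OF 1(3) s])
        show "0 \<le> f n * ((1 / s) * \<mu>)" using f0 mu s by simp
        fix \<tau> assume t: "s \<le> \<tau>" "\<tau> \<le> r"
        then have t0: "\<tau> > 0" using s by simp
        have bb [measurable]: "bumpG x \<tau> \<in> borel_measurable borel"
          using C1c_borel(2)[OF C1c_bump[OF t0 subset_UNIV, of x]] .
        have bn: "norm (bumpG x \<tau> z) \<le> 1 / s" for z
          using norm_bumpG_le[OF t0, of x z] s t by (meson order_trans divide_left_mono frac_le order_refl zero_le_one)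
        note bL = n2_bounded_le[OF borel_measurable_lebesgue_on[OF bb] bn]
        have "(\<integral>z. G n z \<bullet> bumpG x \<tau> z \<partial>lborel) = (\<integral>z. G n z \<bullet> bumpG x \<tau> z \<partial>M)"
          by (rule integral_lebesgue_on_eq_lborel[OF _ sets_domain, symmetric])
             (use C1c_outside[OF 1(3)[of n]] in auto)
        also have "\<dots> = (\<integral>z. gW z \<bullet> bumpG x \<tau> z \<partial>M) + (\<integral>z. (G n z - gW z) \<bullet> bumpG x \<tau> z \<partial>M)"
        proof -
          have "G n z \<bullet> bumpG x \<tau> z = gW z \<bullet> bumpG x \<tau> z + (G n z - gW z) \<bullet> bumpG x \<tau> z" for z
            by (simp add: inner_diff_left)
          then show ?thesis
            using Bochner_Integration.integral_add[OF L2_inner_integrable[OF 1(2) bL(1)] L2_inner_integrable[OF dG bL(1)]]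
            by simp
        qed
        also have "\<dots> \<le> (\<integral>z. bump x \<tau> z \<partial>lborel) + f n * ((1 / s) * \<mu>)"
        proof (rule add_mono[OF sub[OF t0]])
          have "(\<integral>z. (G n z - gW z) \<bullet> bumpG x \<tau> z \<partial>M) \<le> f n * n2 M (bumpG x \<tau>)"
            using L2_Cauchy_Schwarz[OF dG bL(1)] by (simp add: f_def)
          also have "\<dots> \<le> f n * ((1 / s) * \<mu>)" using bL(2) f0 by (intro mult_left_mono) (auto simp: \<mu>_def)
          finally show "(\<integral>z. (G n z - gW z) \<bullet> bumpG x \<tau> z \<partial>M) \<le> f n * ((1 / s) * \<mu>)" .
        qed
        finally show "(\<integral>z. G n z \<bullet> bumpG x \<tau> z \<partial>lborel) \<le> (\<integral>z. bump x \<tau> z \<partial>lborel) + f n * ((1 / s) * \<mu>)" .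
      qed
      also have "\<dots> \<le> (Q + \<mu> * e n / r ^ DIM('a)) + r\<^sup>2 * (X + f n * ((1 / s) * \<mu>) / s ^ DIM('a))"
        using Ar by simp
      also have "\<dots> = (Q + r\<^sup>2 * X) + c n"
        by (simp add: c_def distrib_left)
      also have "\<dots> = E * Kn n"
      proof -
        have "a + b = E * (a / E + b / E)" for a b using E by (simp add: field_simps)
        then show ?thesis unfolding Kn_def K_def by blast
      qed
      finally show ?thesis .
    qed
    define Pn where "Pn n x = max 0 (\<phi> n x - Kn n)" for n x
    have Pnm: "Pn n \<in> borel_measurable borel" for n
      unfolding Pn_def using C1c_borel(1)[OF 1(3)[of n]] by measurable
    have pn: "L2 M (Pn n) \<and> n2 M (Pn n) \<le> s * n2 M (G n)" for n
    proof -
      have "L2 M (Pn n)"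
        by (rule L2_bound[OF C1c_L2(1)[OF 1(3)[of n]] borel_measurable_lebesgue_on[OF Pnm]])
           (use Kn0[of n] in \<open>auto simp: Pn_def\<close>)
      have z: "x \<notin> \<Omega> \<Longrightarrow> (Pn n x)\<^sup>2 = 0" for x
        using C1c_outside(1)[OF 1(3)[of n]] Kn0[of n] by (simp add: Pn_def)
      have sm: "(\<lambda>x. (Pn n x)\<^sup>2) \<in> borel_measurable borel" using Pnm[of n] by measurable
      have iL: "integrable lborel (\<lambda>x. (Pn n x)\<^sup>2)"
        using integrable_lebesgue_on_eq_lborel[OF sm sets_domain z] L2_integrable_sq[OF \<open>L2 M (Pn n)\<close>] by simp
      have "(\<integral>\<^sup>+x. ennreal ((Pn n x)\<^sup>2) \<partial>lborel) \<le> ennreal (s\<^sup>2 * (\<integral>x. (norm (G n x))\<^sup>2 \<partial>lborel))"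
        unfolding Pn_def by (rule mean_bound_imp_excess_small[OF 1(3) s(1) Kn0 mean[unfolded E_def]])
      then have "(\<integral>x. (Pn n x)\<^sup>2 \<partial>lborel) \<le> s\<^sup>2 * (\<integral>x. (norm (G n x))\<^sup>2 \<partial>lborel)"
        by (subst (asm) nn_integral_eq_integral[OF iL]) (auto simp: ennreal_le_iff)
      moreover have "(n2 M (Pn n))\<^sup>2 = (\<integral>x. (Pn n x)\<^sup>2 \<partial>lborel)"
        unfolding n2_sq real_norm_def power2_abs
        by (rule integral_lebesgue_on_eq_lborel[OF sm sets_domain z])
      ultimately have "(n2 M (Pn n))\<^sup>2 \<le> (s * n2 M (G n))\<^sup>2"
        by (simp add: power_mult_distrib C1c_integral_eq(3)[OF 1(3)])
      then have "n2 M (Pn n) \<le> s * n2 M (G n)"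
        by (rule power2_le_imp_le) (use s in simp)
      with \<open>L2 M (Pn n)\<close> show ?thesis by simp
    qed
    \<comment> \<open>Positive parts are 1-Lipschitz, so the excesses differ by at most the distance
      of the functions plus that of the thresholds.\<close>
    have "n2 M (\<lambda>x. Pn n x - P x) \<le> e n + c n / E * \<mu>" for n
    proof -
      have La: "L2 M (\<lambda>x. \<bar>\<phi> n x - W x\<bar>)"
        by (rule L2_bound[OF L2_diff[OF C1c_L2(1)[OF 1(3)] 1(1), of n]])
           (use L2_measurable[OF L2_diff[OF C1c_L2(1)[OF 1(3)] 1(1), of n]] in auto)
      have "n2 M (\<lambda>x. Pn n x - P x) \<le> n2 M (\<lambda>x. \<bar>\<phi> n x - W x\<bar> + c n / E)"
      proof (rule n2_mono[OF L2_add[OF La L2_const]])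
        show "(\<lambda>x. Pn n x - P x) \<in> borel_measurable M"
          using borel_measurable_lebesgue_on[OF Pnm] Pm by (rule borel_measurable_diff)
        have "c n / E \<ge> 0" using c0 E by simp
        then show "AE x in M. norm (Pn n x - P x) \<le> norm (\<bar>\<phi> n x - W x\<bar> + c n / E)"
          by (auto simp: Pn_def P_def Kn_def max_def)
      qed
      also have "\<dots> \<le> n2 M (\<lambda>x. \<bar>\<phi> n x - W x\<bar>) + n2 M (\<lambda>x. c n / E)"
        by (rule n2_triangle[OF La L2_const])
      also have "n2 M (\<lambda>x. \<bar>\<phi> n x - W x\<bar>) = e n" by (simp add: e_def n2_def)
      also have "n2 M (\<lambda>x. c n / E) = c n / E * \<mu>"
        using n2_scaleR[of M "c n / E" "\<lambda>x. 1::real"] c0 E by (simp add: \<mu>_def)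
      finally show ?thesis .
    qed
    moreover have "(\<lambda>n. e n + c n / E * \<mu>) \<longlonglongrightarrow> 0 + 0 / E * \<mu>"
      using E unfolding e_def by (intro tendsto_intros climit 1(4)) auto
    ultimately have "(\<lambda>n. n2 M (\<lambda>x. Pn n x - P x)) \<longlonglongrightarrow> 0"
      by (intro n2_null_comparison[where b="\<lambda>n. e n + c n / E * \<mu>"]) auto
    from n2_tendsto[OF _ LP this] pn have "(\<lambda>n. n2 M (Pn n)) \<longlonglongrightarrow> n2 M P" by blast
    moreover have "(\<lambda>n. s * n2 M (G n)) \<longlonglongrightarrow> s * n2 M gW"
      by (intro tendsto_mult tendsto_const n2_tendsto[OF C1c_L2(2)[OF 1(3)] 1(2,5)])
    ultimately show ?thesis by (rule LIMSEQ_le) (use pn in blast)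
  qed
  have "n2 M P = 0"
  proof (rule ccontr)
    assume "n2 M P \<noteq> 0"
    then have p: "n2 M P > 0" using n2_nonneg[of M P] by linarith
    \<comment> \<open>Small enough that \<open>s * n2 M gW\<close> is at most half of
      \<open>n2 M P\<close>, which contradicts \<open>main\<close>.\<close>
    define s where "s = min r (n2 M P / (2 * (n2 M gW + 1)))"
    have d: "n2 M gW + 1 > 0" using n2_nonneg[of M gW] by linarith
    have s: "0 < s" "s \<le> r" using r p d by (auto simp: s_def)
    have "n2 M P \<le> s * n2 M gW" by (rule main[OF s])
    also have "\<dots> \<le> s * (n2 M gW + 1)" using s by simp
    also have "\<dots> \<le> n2 M P / (2 * (n2 M gW + 1)) * (n2 M gW + 1)"
      using d by (intro mult_right_mono) (auto simp: s_def)
    also have "\<dots> = n2 M P / 2" using d by (simp add: divide_simps)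
    finally show False using p by simp
  qed
  then have "(\<integral>x. (norm (P x))\<^sup>2 \<partial>M) = 0" using n2_sq[of M P] by simp
  then have "AE x in M. (norm (P x))\<^sup>2 = 0"
    using integral_nonneg_eq_0_iff_AE[OF L2_integrable_sq[OF LP]] by simp
  then have "AE x in M. W x \<le> K" by eventually_elim (auto simp: P_def max_def split: if_splits)
  then show ?thesis by (simp add: K_def X_def E_def)
qed

end

subsection \<open>The torsion function is bounded by a multiple of \<open>1 / \<lambda>\<^sub>1\<close>\<close>

text \<open>The first two summands are the local average bound \<open>Q\<close>, the third is
  \<open>r\<^sup>2 * xi_mass\<close> at the radius \<open>r = 1 / a\<close>, where
  \<open>r\<^sup>2 = 2 m\<^sup>2 / \<lambda>\<^sub>1\<close>; all are multiplied by
  \<open>\<lambda>\<^sub>1\<close>. The final 1 pays for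
  \<open>\<delta> = 1 / \<lambda>\<^sub>1\<close> when returning from \<open>W\<close> to
  |v|.\<close>

definition torsion_const :: "'a::euclidean_space itself \<Rightarrow> real" where
  "torsion_const _ =
     (2 * 4 ^ DIM('a) * weight_mass TYPE('a)
       + eta_mass TYPE('a) / 2
       + 2 * (real DIM('a))\<^sup>2 * xi_mass TYPE('a)) / eta_mass TYPE('a) + 1"

lemma torsion_const_pos: "torsion_const TYPE('a::euclidean_space) > 0"
proof -
  have "0 \<le> (2 * 4 ^ DIM('a) * weight_mass TYPE('a)
       + eta_mass TYPE('a) / 2
       + 2 * (real DIM('a))\<^sup>2 * xi_mass TYPE('a)) / eta_mass TYPE('a)"
    by (intro divide_nonneg_nonneg add_nonneg_nonneg mult_nonneg_nonneg Bochner_Integration.integral_nonneg) auto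
  then show ?thesis unfolding torsion_const_def by linarith
qed

lemma smooth_abs_bounds:
  fixes \<delta> t :: real
  assumes "\<delta> > 0"
  shows "\<delta> \<le> sqrt (t\<^sup>2 + \<delta>\<^sup>2)" "0 < sqrt (t\<^sup>2 + \<delta>\<^sup>2)" "\<bar>t\<bar> \<le> sqrt (t\<^sup>2 + \<delta>\<^sup>2)"
    "\<bar>t / sqrt (t\<^sup>2 + \<delta>\<^sup>2)\<bar> \<le> 1"
proof -
  show "\<delta> \<le> sqrt (t\<^sup>2 + \<delta>\<^sup>2)" by (rule real_le_rsqrt) simp
  then show p: "0 < sqrt (t\<^sup>2 + \<delta>\<^sup>2)" using assms by linarith
  show "\<bar>t\<bar> \<le> sqrt (t\<^sup>2 + \<delta>\<^sup>2)" by (rule real_le_rsqrt) simp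
  then show "\<bar>t / sqrt (t\<^sup>2 + \<delta>\<^sup>2)\<bar> \<le> 1"
    using p by (simp only: abs_divide abs_of_pos divide_le_eq_1_pos)
qed

lemma smooth_abs_deriv:
  fixes \<delta> t :: real
  assumes "\<delta> > 0"
  shows "((\<lambda>t. sqrt (t\<^sup>2 + \<delta>\<^sup>2) - \<delta>) has_real_derivative t / sqrt (t\<^sup>2 + \<delta>\<^sup>2)) (at t)"
    and "((\<lambda>t. t / sqrt (t\<^sup>2 + \<delta>\<^sup>2)) has_real_derivative \<delta>\<^sup>2 / (sqrt (t\<^sup>2 + \<delta>\<^sup>2)) ^ 3) (at t)"
proof -
  have p: "t\<^sup>2 + \<delta>\<^sup>2 > 0" using assms by (simp add: add_nonneg_pos)
  then have R: "sqrt (t\<^sup>2 + \<delta>\<^sup>2) > 0" by simp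
  have sq: "((\<lambda>t. sqrt (t\<^sup>2 + \<delta>\<^sup>2)) has_real_derivative t / sqrt (t\<^sup>2 + \<delta>\<^sup>2)) (at t)"
    using p by (auto intro!: derivative_eq_intros simp: field_simps)
  then show "((\<lambda>t. sqrt (t\<^sup>2 + \<delta>\<^sup>2) - \<delta>) has_real_derivative t / sqrt (t\<^sup>2 + \<delta>\<^sup>2)) (at t)"
    using DERIV_diff[OF sq DERIV_const[of \<delta>]] by simp
  define S where "S = sqrt (t\<^sup>2 + \<delta>\<^sup>2)"
  have S: "S > 0" "S * S = t\<^sup>2 + \<delta>\<^sup>2" using R p by (auto simp: S_def)
  have "((\<lambda>t. t / sqrt (t\<^sup>2 + \<delta>\<^sup>2)) has_real_derivative (1 * S - t * (t / S)) / (S * S)) (at t)"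
    using DERIV_divide[OF DERIV_ident sq less_imp_neq[OF R, symmetric]] unfolding S_def .
  moreover have "(1 * S - t * (t / S)) / (S * S) = \<delta>\<^sup>2 / S ^ 3"
  proof -
    have "1 * S - t * (t / S) = (S * S - t\<^sup>2) / S" using S(1) by (simp add: field_simps power2_eq_square)
    also have "\<dots> = \<delta>\<^sup>2 / S" by (simp add: S(2))
    finally show ?thesis by (simp add: power3_eq_cube)
  qed
  ultimately show "((\<lambda>t. t / sqrt (t\<^sup>2 + \<delta>\<^sup>2)) has_real_derivative \<delta>\<^sup>2 / (sqrt (t\<^sup>2 + \<delta>\<^sup>2)) ^ 3) (at t)"
    by (simp add: S_def)
qed

context admissible_domain
begin

text \<open>Test function: \<open>bump * \<beta>(v)\<close> with \<open>\<beta> t = t / sqrt (t\<^sup>2 + \<delta>\<^sup>2)\<close>; the term with \<open>\<beta>' \<ge> 0\<close> is discarded.\<close>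

lemma torsion_smooth_abs_subsolution:
  assumes T: "torsion_sol \<Omega> v g" and \<delta>: "\<delta> > 0" and \<tau>: "\<tau> > 0"
  shows "(\<integral>z. ((v z / sqrt ((v z)\<^sup>2 + \<delta>\<^sup>2)) *\<^sub>R g z) \<bullet> bumpG x \<tau> z \<partial>M) \<le> (\<integral>z. bump x \<tau> z \<partial>lborel)"
proof -
  define \<beta> \<beta>' where "\<beta> t = t / sqrt (t\<^sup>2 + \<delta>\<^sup>2)" and "\<beta>' t = \<delta>\<^sup>2 / (sqrt (t\<^sup>2 + \<delta>\<^sup>2)) ^ 3" for t :: real
  have pos: "sqrt (t\<^sup>2 + \<delta>\<^sup>2) \<ge> \<delta>" for t
    by (rule smooth_abs_bounds(1)[OF \<delta>])
  have b1: "\<bar>\<beta> t\<bar> \<le> 1" for t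
    unfolding \<beta>_def by (rule smooth_abs_bounds(4)[OF \<delta>])
  have b'0: "0 \<le> \<beta>' t" for t using pos[of t] \<delta> by (simp add: \<beta>'_def)
  have b'1: "\<bar>\<beta>' t\<bar> \<le> \<delta>\<^sup>2 / \<delta> ^ 3" for t
  proof -
    have "\<delta> ^ 3 \<le> (sqrt (t\<^sup>2 + \<delta>\<^sup>2)) ^ 3" using \<delta> pos[of t] by (intro power_mono) auto
    then have "\<beta>' t \<le> \<delta>\<^sup>2 / \<delta> ^ 3"
      unfolding \<beta>'_def using \<delta> smooth_abs_bounds(2)[OF \<delta>, of t]
      by (intro divide_left_mono mult_pos_pos zero_less_power) auto
    then show ?thesis using b'0[of t] by simp
  qed
  have d: "(\<beta> has_real_derivative \<beta>' t) (at t)" for t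
    unfolding \<beta>_def[abs_def] \<beta>'_def by (rule smooth_abs_deriv[OF \<delta>])
  have s0: "sqrt (t\<^sup>2 + \<delta>\<^sup>2) \<noteq> 0" for t using pos[of t] \<delta> by linarith
  have c: "continuous_on UNIV \<beta>'"
    unfolding \<beta>'_def[abs_def] using s0 by (intro continuous_intros) auto
  have Hv: "H01 \<Omega> v g" using T by (rule torsion_H01)
  have H1: "H01 \<Omega> (\<lambda>z. \<beta> (v z)) (\<lambda>z. \<beta>' (v z) *\<^sub>R g z)"
    by (rule H01_chain[OF Hv d c _ b'1]) (simp add: \<beta>_def)
  note C = C1c_bump[OF \<tau> subset_UNIV, of x]
  \<comment> \<open>The bump may reach beyond \<Omega>; the product is admissible because
    \<open>\<beta> (v)\<close> already lies in \<open>H01\<close>. This is what makes the inequality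
    hold around every point of the space.\<close>
  have H2: "H01 \<Omega> (\<lambda>z. bump x \<tau> z * \<beta> (v z)) (\<lambda>z. bump x \<tau> z *\<^sub>R (\<beta>' (v z) *\<^sub>R g z) + \<beta> (v z) *\<^sub>R bumpG x \<tau> z)"
    by (rule H01_mult[OF H1 bump_deriv[OF \<tau>] C1c_continuous(2)[OF C], where C=1, OF _ norm_bumpG_le[OF \<tau>]])
       (simp add: bump_le_1)
  have vm: "v \<in> borel_measurable M" using H01_L2(1)[OF Hv] by (rule L2_measurable)
  have bm: "\<beta> \<in> borel_measurable borel"
    using d by (intro borel_measurable_continuous_onI continuous_at_imp_continuous_on) (auto intro: DERIV_isCont)
  have Lg: "L2 M g" using H01_L2(2)[OF Hv] .
  have LbG: "L2 M (bumpG x \<tau>)" using C1c_L2(2)[OF C] .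
  have LW: "L2 M (\<lambda>z. \<beta> (v z) *\<^sub>R g z)"
    by (rule L2_mult_bounded[OF Lg measurable_compose[OF vm bm] b1])
  have ib: "integrable M (bump x \<tau>)" "(\<integral>z. bump x \<tau> z \<partial>M) \<le> (\<integral>z. bump x \<tau> z \<partial>lborel)"
    using integral_domain_le_lborel[OF C1c_integrable_lborel(1)[OF C]] by auto
  have "(\<integral>z. (\<beta> (v z) *\<^sub>R g z) \<bullet> bumpG x \<tau> z \<partial>M)
      \<le> (\<integral>z. g z \<bullet> (bump x \<tau> z *\<^sub>R (\<beta>' (v z) *\<^sub>R g z) + \<beta> (v z) *\<^sub>R bumpG x \<tau> z) \<partial>M)"
  proof (rule integral_mono[OF L2_inner_integrable[OF LW LbG] L2_inner_integrable[OF Lg H01_L2(2)[OF H2]]])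
    fix z
    have "0 \<le> bump x \<tau> z * (\<beta>' (v z) * (g z \<bullet> g z))" using b'0[of "v z"] by simp
    then show "(\<beta> (v z) *\<^sub>R g z) \<bullet> bumpG x \<tau> z \<le> g z \<bullet> (bump x \<tau> z *\<^sub>R (\<beta>' (v z) *\<^sub>R g z) + \<beta> (v z) *\<^sub>R bumpG x \<tau> z)"
      by (simp add: inner_add_right)
  qed
  also have "\<dots> = (\<integral>z. bump x \<tau> z * \<beta> (v z) \<partial>M)" by (rule torsion_test[OF T H2])
  also have "\<dots> \<le> (\<integral>z. bump x \<tau> z \<partial>M)"
  proof (rule integral_mono[OF L2_integrable[OF finite_measure_domain H01_L2(1)[OF H2]] ib(1)])
    show "bump x \<tau> z * \<beta> (v z) \<le> bump x \<tau> z" for z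
      using b1[of "v z"] by (intro mult_left_le) (auto simp: abs_le_iff)
  qed
  also note ib(2)
  finally show ?thesis by (simp add: \<beta>_def)
qed

text \<open>Two pointwise bounds reduce this to \<open>weighted_torsion_bound\<close>:
  \<open>|v| \<le> l/2 v\<^sup>2 + 1/(2 l)\<close>, and \<open>weight\<close> is at least
  \<open>2 powr (- m)\<close> on the ball of radius \<open>1 / a\<close>, whence the factor
  \<open>4 ^ DIM('a)\<close> after squaring.\<close>

lemma torsion_local_average:
  assumes T: "torsion_sol \<Omega> v g" and l: "l = lambda1 \<Omega>" and a: "a > 0" "(real DIM('a) * a)\<^sup>2 = l / 2"
    and W: "W \<in> borel_measurable M" "\<And>z. 0 \<le> W z" "\<And>z. W z \<le> \<bar>v z\<bar>"
  shows "(\<integral>z. eta ((z - x) /\<^sub>R (1/a)) * W z \<partial>M)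
     \<le> (1/a) ^ DIM('a) * ((2 * 4 ^ DIM('a) * weight_mass TYPE('a)
       + eta_mass TYPE('a) / 2) / l)"
proof -
  have lp: "l > 0" using lambda1_pos by (simp add: l)
  define J where "J = weight_mass TYPE('a)"
  define E where "E = eta_mass TYPE('a)"
  define k where "k z = eta ((z - x) /\<^sub>R (1/a))" for z
  have k01: "0 \<le> k z" "k z \<le> 1" for z by (auto simp: k_def)
  have kc: "continuous_on UNIV k"
    unfolding k_def[abs_def] by (rule continuous_on_compose2[OF continuous_on_eta[of UNIV]]) (auto intro!: continuous_intros)
  then have kb: "k \<in> borel_measurable borel" by (rule borel_measurable_continuous_onI)
  have km: "k \<in> borel_measurable M" by (rule borel_measurable_lebesgue_on[OF kb])
  have Lv: "L2 M v" using H01_L2(1)[OF torsion_H01[OF T]] .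
  have LW: "L2 M W" by (rule L2_bound[OF Lv W(1)]) (use W in auto)
  have Lk: "L2 M k" by (rule n2_bounded_le(1)[OF km, of 1]) (use k01 in auto)
  have kout: "k z = 0" if "norm (z - x) \<ge> 1/a" for z
  proof -
    have "norm ((z - x) /\<^sub>R (1/a)) = a * norm (z - x)" using a by simp
    also have "\<dots> \<ge> 1" using that a by (simp add: field_simps)
    finally show ?thesis unfolding k_def by (rule eta_outside)
  qed
  have ik: "integrable lborel k"
    by (rule integrable_lborel_compact_support[OF kc compact_cball[of x "1/a"]])
       (use kout in \<open>auto simp: dist_norm norm_minus_commute\<close>)
  have wm: "weight x a \<in> borel_measurable M" by (rule borel_measurable_lebesgue_on[OF weight_borel])
  have "L2 M (\<lambda>z. weight x a z *\<^sub>R v z)"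
    by (rule L2_mult_bounded[OF Lv wm, of 1]) (simp add: weight_nonneg weight_le_1)
  then have iw: "integrable M (\<lambda>z. (weight x a z * v z)\<^sup>2)" using L2_integrable_sq by fastforce
  have kw: "k z * (v z)\<^sup>2 \<le> 4 ^ DIM('a) * (weight x a z * v z)\<^sup>2" for z
  proof (cases "norm (z - x) \<ge> 1/a")
    case True
    then show ?thesis by (simp add: kout)
  next
    case False
    then have "a * norm (z - x) \<le> 1" using a by (simp add: field_simps)
    then have "(a * norm (z - x))\<^sup>2 \<le> 1" using a by (intro power_le_one) auto
    then have "inverse 2 \<le> inverse (1 + a\<^sup>2 * (norm (z - x))\<^sup>2)"
      using one_plus_pos[of a "z - x"] by (intro le_imp_inverse_le) (auto simp: power_mult_distrib)
    then have "inverse 2 ^ DIM('a) \<le> weight x a z" unfolding weight_def by (intro power_mono) auto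
    then have "(inverse 2 ^ DIM('a))\<^sup>2 \<le> (weight x a z)\<^sup>2" by (intro power_mono) auto
    also have "(inverse 2 ^ DIM('a))\<^sup>2 = (inverse (4::real)) ^ DIM('a)"
      by (simp add: power2_eq_square flip: power_mult_distrib)
    finally have "1 \<le> 4 ^ DIM('a) * (weight x a z)\<^sup>2"
      by (simp add: field_simps power_inverse)
    then have "k z \<le> 4 ^ DIM('a) * (weight x a z)\<^sup>2" using k01(2)[of z] by linarith
    then have "k z * (v z)\<^sup>2 \<le> (4 ^ DIM('a) * (weight x a z)\<^sup>2) * (v z)\<^sup>2" by (intro mult_right_mono) auto
    then show ?thesis by (simp add: power_mult_distrib mult.assoc)
  qed
  have "(\<integral>z. k z * W z \<partial>M) \<le> (\<integral>z. (l / 2 * 4 ^ DIM('a)) * (weight x a z * v z)\<^sup>2 + 1 / (2 * l) * k z \<partial>M)"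
  proof (rule integral_mono[OF L2_mult_integrable[OF Lk LW]])
    show "integrable M (\<lambda>z. (l / 2 * 4 ^ DIM('a)) * (weight x a z * v z)\<^sup>2 + 1 / (2 * l) * k z)"
      using iw L2_integrable[OF finite_measure_domain Lk] by auto
    fix z
    have "\<bar>v z\<bar> \<le> l / 2 * (v z)\<^sup>2 + 1 / (2 * l)"
    proof -
      have "0 \<le> (l * \<bar>v z\<bar> - 1)\<^sup>2 / (2 * l)" using lp by simp
      also have "\<dots> = l / 2 * (v z)\<^sup>2 + 1 / (2 * l) - \<bar>v z\<bar>"
        using lp by (simp add: power2_diff power_mult_distrib field_simps) (simp add: power2_eq_square algebra_simps)
      finally show ?thesis by simp
    qed
    then have "k z * W z \<le> k z * (l / 2 * (v z)\<^sup>2 + 1 / (2 * l))"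
      using W(3)[of z] k01 by (intro mult_left_mono) auto
    also have "\<dots> = l / 2 * (k z * (v z)\<^sup>2) + 1 / (2 * l) * k z" by (simp add: algebra_simps)
    also have "\<dots> \<le> l / 2 * (4 ^ DIM('a) * (weight x a z * v z)\<^sup>2) + 1 / (2 * l) * k z"
      using kw[of z] lp by (intro add_right_mono mult_left_mono) auto
    finally show "k z * W z \<le> (l / 2 * 4 ^ DIM('a)) * (weight x a z * v z)\<^sup>2 + 1 / (2 * l) * k z"
      by (simp add: mult.assoc)
  qed
  also have "\<dots> = (l / 2 * 4 ^ DIM('a)) * (\<integral>z. (weight x a z * v z)\<^sup>2 \<partial>M) + 1 / (2 * l) * (\<integral>z. k z \<partial>M)"
    using iw L2_integrable[OF finite_measure_domain Lk] by simp
  also have "\<dots> \<le> (l / 2 * 4 ^ DIM('a)) * (4 / l\<^sup>2 * ((1/a) ^ DIM('a) * J)) + 1 / (2 * l) * ((1/a) ^ DIM('a) * E)"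
  proof (intro add_mono mult_left_mono)
    show "(\<integral>z. (weight x a z * v z)\<^sup>2 \<partial>M) \<le> 4 / l\<^sup>2 * ((1/a) ^ DIM('a) * J)"
      using weighted_torsion_bound[OF T a(1), of x] a(2) integral_weight_sq(2)[OF a(1), of x] by (simp add: l J_def)
    have "(\<integral>z. k z \<partial>M) \<le> (\<integral>z. k z \<partial>lborel)" by (rule integral_domain_le_lborel(2)[OF ik k01(1)])
    also have "\<dots> = (1/a) ^ DIM('a) * E"
      using integral_lborel_affine[OF kb, of "1/a" x] a by (simp add: k_def E_def)
    finally show "(\<integral>z. k z \<partial>M) \<le> (1/a) ^ DIM('a) * E" .
  qed (use lp in auto)
  also have "\<dots> = (1/a) ^ DIM('a) * ((2 * 4 ^ DIM('a) * J + E / 2) / l)"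
  proof -
    have "(l / 2 * p) * (4 / l\<^sup>2 * (q * J)) + 1 / (2 * l) * (q * E) = q * ((2 * p * J + E / 2) / l)" for p q :: real
      using lp by (simp add: field_simps power2_eq_square)
    then show ?thesis by blast
  qed
  finally show ?thesis by (simp add: k_def J_def E_def)
qed

lemma torsion_bounded:
  assumes T: "torsion_sol \<Omega> v g"
  shows "AE x in M. \<bar>v x\<bar> \<le> torsion_const TYPE('a) / lambda1 \<Omega>"
proof -
  define l where "l = lambda1 \<Omega>"
  have l: "l > 0" by (simp add: l_def lambda1_pos)
  define m where "m = real DIM('a)"
  have m: "m > 0" by (simp add: m_def)
  \<comment> \<open>Gives the weight a logarithmic gradient of at most
    \<open>m * a = sqrt (l / 2)\<close>, and fixes the averaging radius
    \<open>1 / a\<close>.\<close>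
  define a where "a = sqrt (l / 2) / m"
  have a: "a > 0" "(m * a)\<^sup>2 = l / 2" using l m by (auto simp: a_def)
  define \<delta> where "\<delta> = 1 / l"
  have \<delta>: "\<delta> > 0" using l by (simp add: \<delta>_def)
  define W where "W z = sqrt ((v z)\<^sup>2 + \<delta>\<^sup>2) - \<delta>" for z
  define gW where "gW z = (v z / sqrt ((v z)\<^sup>2 + \<delta>\<^sup>2)) *\<^sub>R g z" for z
  define J E X where "J = weight_mass TYPE('a)"
    and "E = eta_mass TYPE('a)" and "X = xi_mass TYPE('a)"
  have E: "E > 0" by (simp add: E_def eta_integral_pos)
  define Q where "Q = (2 * 4 ^ DIM('a) * J + E / 2) / l"
  have "J \<ge> 0" unfolding J_def by (intro Bochner_Integration.integral_nonneg) auto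
  then have Q: "Q \<ge> 0" using E l by (simp add: Q_def)
  have W0: "0 \<le> W z" for z using \<delta> by (simp add: W_def real_le_rsqrt)
  have Wv: "W z \<le> \<bar>v z\<bar>" for z
  proof -
    have "sqrt ((v z)\<^sup>2 + \<delta>\<^sup>2) \<le> \<bar>v z\<bar> + \<delta>"
      using \<delta> by (intro real_le_lsqrt) (auto simp: power2_sum)
    then show ?thesis by (simp add: W_def)
  qed
  have vW: "\<bar>v z\<bar> \<le> W z + \<delta>" for z
    by (simp add: W_def real_le_rsqrt)
  have s0: "sqrt (t\<^sup>2 + \<delta>\<^sup>2) \<noteq> 0" for t
    using \<delta> by (simp add: add_nonneg_eq_0_iff)
  have H: "H01 \<Omega> W gW"
    unfolding W_def[abs_def] gW_def[abs_def]
  proof (rule H01_chain[OF torsion_H01[OF T] smooth_abs_deriv(1)[OF \<delta>]])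
    show "continuous_on UNIV (\<lambda>t. t / sqrt (t\<^sup>2 + \<delta>\<^sup>2))" using s0 by (intro continuous_intros) auto
    show "\<bar>t / sqrt (t\<^sup>2 + \<delta>\<^sup>2)\<bar> \<le> 1" for t
      by (rule smooth_abs_bounds(4)[OF \<delta>])
  qed (use \<delta> in auto)
  have Wm: "W \<in> borel_measurable M" using H01_L2(1)[OF H] by (rule L2_measurable)
  have "AE x in M. W x \<le> (Q + (1/a)\<^sup>2 * X) / E"
    unfolding X_def E_def
  proof (rule subsolution_bounded[OF H W0 _ Q])
    show "0 < 1 / a" using a by simp
    show "(\<integral>z. gW z \<bullet> bumpG x \<tau> z \<partial>M) \<le> (\<integral>z. bump x \<tau> z \<partial>lborel)" if "\<tau> > 0" for x \<tau>
      unfolding gW_def by (rule torsion_smooth_abs_subsolution[OF T \<delta> that])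
    show "(\<integral>z. eta ((z - x) /\<^sub>R (1 / a)) * W z \<partial>M) \<le> (1 / a) ^ DIM('a) * Q" for x
      unfolding Q_def J_def E_def
      by (rule torsion_local_average[OF T l_def a(1) a(2)[unfolded m_def] Wm W0 Wv])
  qed
  then show ?thesis
  proof eventually_elim
    case (elim x)
    have "(1/a)\<^sup>2 = 2 * m\<^sup>2 / l" using l m by (simp add: a_def power_divide field_simps)
    then have "(Q + (1/a)\<^sup>2 * X) / E = ((2 * 4 ^ DIM('a) * J + E / 2 + 2 * m\<^sup>2 * X) / E) / l"
      by (simp add: Q_def add_divide_distrib mult.commute)
    then have "W x + \<delta> \<le> ((2 * 4 ^ DIM('a) * J + E / 2 + 2 * m\<^sup>2 * X) / E) / l + 1 / l"
      using elim by (simp add: \<delta>_def)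
    also have "\<dots> = torsion_const TYPE('a) / lambda1 \<Omega>"
      by (simp add: torsion_const_def J_def E_def X_def m_def l_def add_divide_distrib)
    finally show ?case using vW[of x] by linarith
  qed
qed

end

subsection \<open>Boundedness for \<open>q \<le> 1\<close>\<close>

text \<open>With \<open>r\<^sup>m = 2 |\<Omega>| / \<omega>\<^sub>m\<close>, this is
  \<open>(2 r\<^sup>2) powr (1 - q)\<close> without its power of |\<Omega>|.\<close>

abbreviation faber_const :: "'a::euclidean_space itself \<Rightarrow> real \<Rightarrow> real" where
  "faber_const t q \<equiv> (2 * (2 / measure lborel (ball (0::'a) 1)) powr (2 / real DIM('a))) powr (1 - q)"

context admissible_domain
begin

text \<open>One factor \<open>lambda1 \<Omega>\<close> is kept aside to cancel the denominator of
  the torsion bound; the remaining power has exponent \<open>q - 1 \<le> 0\<close>, so the lower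
  bound on \<open>lambda1\<close> bounds it from above.\<close>

lemma lambda1_powr_le:
  assumes "q \<le> 1"
  shows "lambda1 \<Omega> powr q \<le> lambda1 \<Omega> *
     (faber_const TYPE('a) q *
      measure lebesgue \<Omega> powr (2 / real DIM('a) * (1 - q)))"
proof -
  define m w V where "m = real DIM('a)" and "w = measure lborel (ball (0::'a) 1)" and "V = measure lebesgue \<Omega>"
  have m: "m > 0" by (simp add: m_def)
  have w: "w > 0" by (simp add: w_def content_ball_pos)
  have V: "V > 0" by (simp add: V_def measure_domain_pos)
  obtain r where r: "half_empty \<Omega> r" "w * r ^ DIM('a) = 2 * V"
    using ex_half_empty by (auto simp: w_def V_def)
  have r0: "r > 0" using r(1) by (simp add: half_empty_def)
  have r2: "r\<^sup>2 = (2 / w) powr (2 / m) * V powr (2 / m)"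
  proof -
    have "r powr m = 2 / w * V" using r(2) r0 w by (simp add: powr_realpow m_def field_simps)
    then have "(r powr m) powr (2 / m) = (2 / w) powr (2 / m) * V powr (2 / m)"
      using w V powr_mult[of "2 / w" V "2 / m"] by simp
    moreover have "(r powr m) powr (2 / m) = r\<^sup>2"
      using r0 m by (simp add: powr_powr powr_numeral)
    ultimately show ?thesis by simp
  qed
  define l where "l = lambda1 \<Omega>"
  have l: "l > 0" by (simp add: l_def lambda1_pos)
  have "l powr q = l * l powr (q - 1)"
    using l by (simp add: powr_diff)
  also have "\<dots> \<le> l * (1 / (2 * r\<^sup>2)) powr (q - 1)"
    using l assms r0 lambda1_ge[OF r(1)]
    by (intro mult_left_mono powr_mono2') (auto simp: l_def)
  also have "(1 / (2 * r\<^sup>2)) powr (q - 1) = (2 * r\<^sup>2) powr (1 - q)"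
  proof -
    have "(1 / (2 * r\<^sup>2)) powr (q - 1) = 1 / (2 * r\<^sup>2) powr (q - 1)"
      using r0 powr_divide[of 1 "2 * r\<^sup>2" "q - 1"] by simp
    also have "\<dots> = (2 * r\<^sup>2) powr (- (q - 1))" by (rule powr_minus_divide[symmetric])
    finally show ?thesis by simp
  qed
  also have "\<dots> = ((2 * (2 / w) powr (2 / m)) * V powr (2 / m)) powr (1 - q)"
    by (simp add: r2 mult.assoc)
  also have "\<dots> = (2 * (2 / w) powr (2 / m)) powr (1 - q) * V powr (2 / m * (1 - q))"
    using w V by (subst powr_mult) (auto simp: powr_powr)
  finally show ?thesis by (simp add: l_def w_def m_def V_def)
qed

lemma Tp_le:
  assumes "1 \<le> p"
  shows "Tp \<Omega> p \<le> torsion_const TYPE('a) / lambda1 \<Omega> * measure lebesgue \<Omega> powr (1 / p)"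
proof -
  interpret finite_measure M by (rule finite_measure_domain)
  obtain v g where T: "torsion_sol \<Omega> v g" using torsion_exists by blast
  define K where "K = torsion_const TYPE('a) / lambda1 \<Omega>"
  have K: "K > 0" by (simp add: K_def torsion_const_pos lambda1_pos)
  have b: "AE x in M. \<bar>v x\<bar> powr p \<le> K powr p"
    using torsion_bounded[OF T] by eventually_elim (use assms in \<open>auto simp: K_def intro!: powr_mono2\<close>)
  have [measurable]: "v \<in> borel_measurable M" using H01_L2(1)[OF torsion_H01[OF T]] by (rule L2_measurable)
  have "integrable M (\<lambda>x. \<bar>v x\<bar> powr p)"
    by (rule integrable_const_bound[where B="K powr p"]) (use b in auto)
  then have "(\<integral>x. \<bar>v x\<bar> powr p \<partial>M) \<le> (\<integral>x. K powr p \<partial>M)"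
    using b by (intro integral_mono_AE) auto
  also have "\<dots> = K powr p * measure lebesgue \<Omega>"
    using measure_lebesgue_on_domain by (simp add: mult.commute space_restrict_space)
  finally have "Lp_norm \<Omega> p v \<le> (K powr p * measure lebesgue \<Omega>) powr (1 / p)"
    unfolding Lp_norm_def using assms by (intro powr_mono2) (auto intro!: Bochner_Integration.integral_nonneg)
  also have "\<dots> = K * measure lebesgue \<Omega> powr (1 / p)"
    using assms K by (simp add: powr_mult powr_powr)
  finally show ?thesis using Tp_eq[OF T] by (simp add: K_def)
qed

text \<open>The mean of |v| lies below every essential bound. This keeps the set in
  \<open>Linf_norm\<close> bounded below and also gives the second claim; the assumed bound shows
  that the set is nonempty.\<close>

lemma Linf_bounds:
  assumes "v \<in> borel_measurable M" "AE x in M. \<bar>v x\<bar> \<le> K"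
  shows "Linf_norm \<Omega> v \<le> K" and "(\<integral>x. \<bar>v x\<bar> \<partial>M) \<le> Linf_norm \<Omega> v * measure lebesgue \<Omega>"
proof -
  interpret finite_measure M by (rule finite_measure_domain)
  note [measurable] = assms(1)
  have V: "measure lebesgue \<Omega> > 0" by (rule measure_domain_pos)
  have int: "integrable M (\<lambda>x. \<bar>v x\<bar>)"
    by (rule integrable_const_bound[where B=K]) (use assms(2) in auto)
  have lb: "(\<integral>x. \<bar>v x\<bar> \<partial>M) / measure lebesgue \<Omega> \<le> C" if "AE x in M. \<bar>v x\<bar> \<le> C" for C
  proof -
    have "(\<integral>x. \<bar>v x\<bar> \<partial>M) \<le> (\<integral>x. C \<partial>M)" using that int by (intro integral_mono_AE) auto
    also have "\<dots> = C * measure lebesgue \<Omega>"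
      using measure_lebesgue_on_domain by (simp add: mult.commute space_restrict_space)
    finally show ?thesis using V by (simp add: field_simps)
  qed
  show "Linf_norm \<Omega> v \<le> K"
    unfolding Linf_norm_def by (rule cInf_lower) (use assms(2) lb in \<open>auto intro!: bdd_belowI\<close>)
  have "(\<integral>x. \<bar>v x\<bar> \<partial>M) / measure lebesgue \<Omega> \<le> Linf_norm \<Omega> v"
    unfolding Linf_norm_def by (rule cInf_greatest) (use assms(2) lb in auto)
  then show "(\<integral>x. \<bar>v x\<bar> \<partial>M) \<le> Linf_norm \<Omega> v * measure lebesgue \<Omega>"
    using V by (simp add: field_simps)
qed

lemma Tinf_le: "Tinf \<Omega> \<le> torsion_const TYPE('a) / lambda1 \<Omega>"
proof -
  obtain v g where T: "torsion_sol \<Omega> v g" using torsion_exists by blast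
  show ?thesis unfolding Tinf_eq[OF T]
    by (rule Linf_bounds(1)[OF L2_measurable[OF H01_L2(1)[OF torsion_H01[OF T]]] torsion_bounded[OF T]])
qed

text \<open>\<open>A\<close> stands for \<open>|\<Omega>| powr (1 / p)\<close> when p is finite and
  for 1 when it is infinite, so both cases share one computation.\<close>

lemma F_le:
  assumes "q \<le> 1" "T \<le> torsion_const TYPE('a) / lambda1 \<Omega> * A" "A > 0"
  shows "T * lambda1 \<Omega> powr q / (A * measure lebesgue \<Omega> powr (2 / real DIM('a) * (1 - q)))
     \<le> torsion_const TYPE('a) * faber_const TYPE('a) q"
proof -
  define l k D B where "l = lambda1 \<Omega>" and "k = torsion_const TYPE('a)"
    and "D = faber_const TYPE('a) q"
    and "B = measure lebesgue \<Omega> powr (2 / real DIM('a) * (1 - q))"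
  have l: "l > 0" and k: "k > 0" by (simp_all add: l_def k_def lambda1_pos torsion_const_pos)
  have B: "B > 0" using measure_domain_pos by (simp add: B_def)
  have "T * l powr q \<le> (k / l * A) * l powr q"
    using assms(2) by (intro mult_right_mono) (auto simp: l_def k_def)
  also have "\<dots> \<le> (k / l * A) * (l * (D * B))"
    using lambda1_powr_le[OF assms(1)] l k assms(3)
    by (intro mult_left_mono) (auto simp: l_def D_def B_def)
  also have "\<dots> = (k * D) * (A * B)" using l by simp
  finally have "T * l powr q / (A * B) \<le> k * D"
    using assms(3) B by (simp add: pos_divide_le_eq)
  then show ?thesis by (simp add: l_def k_def D_def B_def)
qed

lemma Fpq_le:
  assumes "q \<le> 1" "1 \<le> p"
  shows "Fpq \<Omega> p q \<le> torsion_const TYPE('a) * faber_const TYPE('a) q"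
  using F_le[OF assms(1) Tp_le[OF assms(2)]] measure_domain_pos
  by (simp add: Fpq_def powr_add)

lemma Finfq_le:
  assumes "q \<le> 1"
  shows "Finfq \<Omega> q \<le> torsion_const TYPE('a) * faber_const TYPE('a) q"
  using F_le[OF assms, of "Tinf \<Omega>" 1] Tinf_le by (simp add: Finfq_def)

subsection \<open>Unboundedness for \<open>q > 1\<close>\<close>

text \<open>Instead of Hoelder, a pointwise bound is integrated:
  \<open>t \<le> c + c powr (1 - p) * |t| powr p\<close>. With \<open>c\<close> half of \<kappa>,
  the constant term uses up half of the mean, which is the loss of a factor 2.\<close>

lemma Tp_ge:
  assumes p: "1 \<le> p" and T: "torsion_sol \<Omega> v g" and \<kappa>: "\<kappa> > 0" "\<kappa> * measure lebesgue \<Omega> \<le> (\<integral>x. v x \<partial>M)"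
  shows "\<kappa> / 2 * measure lebesgue \<Omega> powr (1 / p) \<le> Tp \<Omega> p"
proof -
  interpret finite_measure M by (rule finite_measure_domain)
  define V where "V = measure lebesgue \<Omega>"
  have V: "V > 0" by (simp add: V_def measure_domain_pos)
  have [measurable]: "v \<in> borel_measurable M" using H01_L2(1)[OF torsion_H01[OF T]] by (rule L2_measurable)
  have iv: "integrable M v" by (rule L2_integrable[OF finite_measure_domain H01_L2(1)[OF torsion_H01[OF T]]])
  define K where "K = torsion_const TYPE('a) / lambda1 \<Omega>"
  have "AE x in M. \<bar>v x\<bar> powr p \<le> K powr p"
    using torsion_bounded[OF T] by eventually_elim (use p in \<open>auto simp: K_def intro!: powr_mono2\<close>)
  \<comment> \<open>Needs the sup bound: without integrability the Lebesgue integral would be 0 by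
    convention.\<close>
  then have ip: "integrable M (\<lambda>x. \<bar>v x\<bar> powr p)"
    by (intro integrable_const_bound[where B="K powr p"]) auto
  define c where "c = \<kappa> / 2"
  have c: "c > 0" using \<kappa> by (simp add: c_def)
  have pt: "t \<le> c + c powr (1 - p) * \<bar>t\<bar> powr p" for t
  proof (cases "t \<le> c")
    case True
    then show ?thesis by (simp add: add_increasing2)
  next
    case False
    then have t: "t > 0" "c \<le> t" using c by auto
    have "t = t powr (1 - p) * t powr p" using t by (simp flip: powr_add)
    also have "\<dots> \<le> c powr (1 - p) * t powr p"
      using t c p by (intro mult_right_mono powr_mono2') auto
    finally show ?thesis using t c by simp
  qed
  define I where "I = (\<integral>x. \<bar>v x\<bar> powr p \<partial>M)"
  have "2 * c * V \<le> (\<integral>x. v x \<partial>M)" using \<kappa> by (simp add: c_def V_def)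
  also have "\<dots> \<le> (\<integral>x. c + c powr (1 - p) * \<bar>v x\<bar> powr p \<partial>M)"
    using iv ip pt by (intro integral_mono) auto
  also have "\<dots> = c * V + c powr (1 - p) * I"
    using ip measure_lebesgue_on_domain by (simp add: I_def V_def mult.commute space_restrict_space)
  finally have "c * V \<le> c powr (1 - p) * I" by (simp add: algebra_simps)
  then have "c powr (p - 1) * (c * V) \<le> c powr (p - 1) * (c powr (1 - p) * I)"
    by (intro mult_left_mono) auto
  also have "\<dots> = I"
  proof -
    have "c powr (p - 1) * c powr (1 - p) = 1" using c by (simp flip: powr_add)
    then show ?thesis by (simp add: mult.assoc[symmetric])
  qed
  also have "c powr (p - 1) * (c * V) = c powr p * V"
    using c by (simp add: powr_diff)
  finally have "(c powr p * V) powr (1 / p) \<le> I powr (1 / p)"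
    using p V by (intro powr_mono2) auto
  moreover have "(c powr p * V) powr (1 / p) = c * V powr (1 / p)"
    using c V p by (simp add: powr_mult powr_powr)
  ultimately show ?thesis using Tp_eq[OF T, of p] by (simp add: c_def V_def Lp_norm_def I_def)
qed

lemma Tinf_ge:
  assumes T: "torsion_sol \<Omega> v g" and "\<kappa> * measure lebesgue \<Omega> \<le> (\<integral>x. v x \<partial>M)"
  shows "\<kappa> \<le> Tinf \<Omega>"
proof -
  have Lv: "L2 M v" using H01_L2(1)[OF torsion_H01[OF T]] .
  have iv: "integrable M v" by (rule L2_integrable[OF finite_measure_domain Lv])
  have "(\<integral>x. v x \<partial>M) \<le> (\<integral>x. \<bar>v x\<bar> \<partial>M)" using iv by (intro integral_mono) auto
  also have "\<dots> \<le> Linf_norm \<Omega> v * measure lebesgue \<Omega>"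
    by (rule Linf_bounds(2)[OF L2_measurable[OF Lv] torsion_bounded[OF T]])
  finally have "\<kappa> * measure lebesgue \<Omega> \<le> Linf_norm \<Omega> v * measure lebesgue \<Omega>" using assms(2) by simp
  then show ?thesis using measure_domain_pos by (simp add: Tinf_eq[OF T])
qed

text \<open>The integral of \<open>v\<close> equals that of \<open>|g|\<^sup>2\<close>, which is
  bounded below by \<open>2 \<tau> g \<bullet> D - 4 \<tau>\<^sup>2\<close>, where \<open>D\<close>
  is the sum of bump gradients. The supports are disjoint, so \<open>|D| \<le> 2\<close> everywhere,
  and testing evaluates the cross terms.\<close>

lemma torsion_integral_ge_of_balls:
  fixes c :: "nat \<Rightarrow> 'a"
  assumes T: "torsion_sol \<Omega> v g"
    and sub: "\<And>i. i < N \<Longrightarrow> ball (c i) 1 \<subseteq> \<Omega>"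
    and dis: "\<And>i j. i < N \<Longrightarrow> j < N \<Longrightarrow> i \<noteq> j \<Longrightarrow> ball (c i) 1 \<inter> ball (c j) 1 = {}"
  shows "2 * \<tau> * (real N * ((1/2) ^ DIM('a) * xi_mass TYPE('a))) - 4 * \<tau>\<^sup>2 * measure lebesgue \<Omega> \<le> (\<integral>x. v x \<partial>M)"
proof -
  interpret finite_measure M by (rule finite_measure_domain)
  \<comment> \<open>Bumps of radius 1/2 have closed support inside the open unit balls; their
    gradients are at most \<open>1 / h = 2\<close>.\<close>
  define h where "h = (1/2 :: real)"
  have h: "h > 0" by (simp add: h_def)
  define e where "e = (1/2) ^ DIM('a) * xi_mass TYPE('a)"
  have C: "C1c \<Omega> (bump (c i) h) (bumpG (c i) h)" if "i < N" for i
  proof (rule C1c_bump[OF h])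
    have "cball (c i) h \<subseteq> ball (c i) 1" by (auto simp: h_def)
    then show "cball (c i) h \<subseteq> \<Omega>" using sub[OF that] by blast
  qed
  have Lg: "L2 M g" using H01_L2(2)[OF torsion_H01[OF T]] .
  have one: "(\<integral>z. g z \<bullet> bumpG (c i) h z \<partial>M) = e" if "i < N" for i
    using torsion_test[OF T C1c_H01[OF C[OF that]]] C1c_integral_eq(1)[OF C[OF that]] integral_bump[OF h, of "c i"]
    by (simp add: e_def h_def)
  have out: "bumpG (c i) h z = 0" if "z \<notin> ball (c i) 1" for i z
  proof -
    have "norm ((z - c i) /\<^sub>R h) \<ge> 1"
      using that by (simp add: h_def dist_norm norm_minus_commute)
    then show ?thesis by (simp add: bumpG_def eta_outside)
  qed
  have pt: "(\<Sum>i<N. 2 * \<tau> * (g z \<bullet> bumpG (c i) h z)) \<le> 4 * \<tau>\<^sup>2 + (norm (g z))\<^sup>2" for z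
  proof (cases "\<exists>i<N. z \<in> ball (c i) 1")
    case True
    then obtain i where i: "i < N" "z \<in> ball (c i) 1" by blast
    have "(\<Sum>j<N. 2 * \<tau> * (g z \<bullet> bumpG (c j) h z)) = 2 * \<tau> * (g z \<bullet> bumpG (c i) h z) + (\<Sum>j\<in>{..<N} - {i}. 2 * \<tau> * (g z \<bullet> bumpG (c j) h z))"
      using i by (intro sum.remove) auto
    also have "(\<Sum>j\<in>{..<N} - {i}. 2 * \<tau> * (g z \<bullet> bumpG (c j) h z)) = 0"
    proof (rule sum.neutral, rule ballI)
      fix j assume j: "j \<in> {..<N} - {i}"
      then have "z \<notin> ball (c j) 1" using dis[of i j] i by auto
      then show "2 * \<tau> * (g z \<bullet> bumpG (c j) h z) = 0" by (simp add: out)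
    qed
    also have "2 * \<tau> * (g z \<bullet> bumpG (c i) h z) + 0 \<le> 4 * \<tau>\<^sup>2 + (norm (g z))\<^sup>2"
    proof -
      have "2 * \<tau> * (g z \<bullet> bumpG (c i) h z) \<le> 2 * \<bar>\<tau>\<bar> * (norm (g z) * 2)"
      proof -
        have "\<bar>g z \<bullet> bumpG (c i) h z\<bar> \<le> norm (g z) * norm (bumpG (c i) h z)" by (rule Cauchy_Schwarz_ineq2)
        also have "\<dots> \<le> norm (g z) * 2"
          using norm_bumpG_le[OF h, of "c i" z] by (intro mult_left_mono) (auto simp: h_def)
        finally have "\<bar>2 * \<tau>\<bar> * \<bar>g z \<bullet> bumpG (c i) h z\<bar> \<le> \<bar>2 * \<tau>\<bar> * (norm (g z) * 2)" by (intro mult_left_mono) auto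
        moreover have "2 * \<tau> * (g z \<bullet> bumpG (c i) h z) \<le> \<bar>2 * \<tau>\<bar> * \<bar>g z \<bullet> bumpG (c i) h z\<bar>"
          unfolding abs_mult[symmetric] by (rule abs_ge_self)
        ultimately show ?thesis by simp
      qed
      also have "\<dots> = 2 * (2 * \<bar>\<tau>\<bar>) * norm (g z)" by simp
      also have "\<dots> \<le> (2 * \<bar>\<tau>\<bar>)\<^sup>2 + (norm (g z))\<^sup>2" by (rule sum_squares_bound)
      finally show ?thesis by (simp add: power_mult_distrib)
    qed
    finally show ?thesis .
  next
    case False
    then have "(\<Sum>i<N. 2 * \<tau> * (g z \<bullet> bumpG (c i) h z)) = 0" using out by (intro sum.neutral) auto
    then show ?thesis by simp
  qed
  have ig: "integrable M (\<lambda>z. g z \<bullet> bumpG (c i) h z)" if "i < N" for i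
    by (rule L2_inner_integrable[OF Lg C1c_L2(2)[OF C[OF that]]])
  have "2 * \<tau> * (real N * e) = (\<Sum>i<N. 2 * \<tau> * (\<integral>z. g z \<bullet> bumpG (c i) h z \<partial>M))"
    by (simp add: one)
  also have "\<dots> = (\<integral>z. (\<Sum>i<N. 2 * \<tau> * (g z \<bullet> bumpG (c i) h z)) \<partial>M)"
    using ig by (subst Bochner_Integration.integral_sum) auto
  also have "\<dots> \<le> (\<integral>z. 4 * \<tau>\<^sup>2 + (norm (g z))\<^sup>2 \<partial>M)"
    using ig L2_integrable_sq[OF Lg] pt by (intro integral_mono) auto
  also have "\<dots> = 4 * \<tau>\<^sup>2 * measure lebesgue \<Omega> + (\<integral>x. v x \<partial>M)"
    using L2_integrable_sq[OF Lg] measure_lebesgue_on_domain torsion_energy[OF T]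
    by (simp add: n2_sq space_restrict_space mult.commute)
  finally show ?thesis by (simp add: e_def)
qed

end

section \<open>Unions of distant unit balls\<close>

definition center :: "nat \<Rightarrow> 'a::euclidean_space" where
  "center i = real (10 * i) *\<^sub>R (SOME b. b \<in> Basis)"

definition balls :: "nat \<Rightarrow> 'a::euclidean_space set" where
  "balls N = (\<Union>i<N. ball (center i) 1)"

lemma center_dist:
  assumes "i \<noteq> j"
  shows "10 \<le> dist (center i :: 'a::euclidean_space) (center j)"
proof -
  have "norm (SOME b::'a. b \<in> Basis) = 1"
    by (rule norm_Basis) (simp add: some_in_eq)
  then have "dist (center i :: 'a) (center j) = \<bar>real (10 * i) - real (10 * j)\<bar>"
    by (simp add: center_def dist_norm flip: scaleR_diff_left)
  also have "\<dots> \<ge> 10" using assms by linarith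
  finally show ?thesis .
qed

lemma balls_disjoint:
  assumes "i \<noteq> j"
  shows "ball (center i :: 'a::euclidean_space) 1 \<inter> ball (center j) 1 = {}"
  using center_dist[OF assms, where 'a='a] by (intro disjoint_ballI) simp

lemma measure_balls: "measure lborel (balls N :: 'a::euclidean_space set) = real N * measure lborel (ball (0::'a) 1)"
proof -
  have "measure lborel (balls N :: 'a set) = (\<Sum>i<N. measure lborel (ball (center i :: 'a) 1))"
    unfolding balls_def
  proof (rule measure_finite_Union)
    show "disjoint_family_on (\<lambda>i. ball (center i :: 'a) 1) {..<N}"
      unfolding disjoint_family_on_def using balls_disjoint by blast
    show "emeasure lborel (ball (center i :: 'a) 1) \<noteq> \<infinity>" for i
      using emeasure_bounded_finite[OF bounded_ball] by (metis less_irrefl)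
  qed auto
  moreover have "measure lborel (ball (center i :: 'a) 1) = measure lborel (ball (0::'a) 1)" for i
    by (rule measure_ball_translate)
  ultimately show ?thesis by simp
qed

lemma open_balls: "open (balls N)"
  unfolding balls_def by auto

lemma admissible_balls:
  assumes "N > 0"
  shows "admissible (balls N :: 'a::euclidean_space set)"
proof -
  have "bounded (balls N :: 'a set)" unfolding balls_def by (rule bounded_UN) auto
  then have fin: "emeasure lborel (balls N :: 'a set) < \<infinity>" by (rule emeasure_bounded_finite)
  have "measure lborel (balls N :: 'a set) > 0"
    unfolding measure_balls using assms by (simp add: content_ball_pos)
  then have "emeasure lborel (balls N :: 'a set) > 0"
    by (metis measure_def enn2real_0 less_irrefl not_gr_zero)
  moreover have "emeasure lebesgue (balls N :: 'a set) = emeasure lborel (balls N :: 'a set)"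
    using open_balls[of N, where 'a='a] by simp
  ultimately show ?thesis using fin open_balls by (simp add: admissible_def)
qed

lemma measure_lebesgue_balls:
  "measure lebesgue (balls N :: 'a::euclidean_space set) = real N * measure lborel (ball (0::'a) 1)"
  using measure_completion[of "balls N :: 'a set" lborel] measure_balls[of N, where 'a='a]
    open_balls[of N, where 'a='a] by simp

text \<open>A ball of radius 2 meets at most one of the unit balls, since centers of two such balls
  would be less than 6 apart, and one unit ball fills at most half of it. The radius does not depend
  on \<open>N\<close>, hence neither does the bound 1/8 on \<open>lambda1\<close>.\<close>

lemma half_empty_balls: "half_empty (balls N :: 'a::euclidean_space set) 2"
proof (rule half_emptyI[OF open_balls])
  fix x :: 'a
  define c where "c = (center :: nat \<Rightarrow> 'a)"
  have "\<exists>i. ball x 2 \<inter> balls N \<subseteq> ball (c i) 1"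
  proof (cases "\<exists>i<N. ball x 2 \<inter> ball (c i) 1 \<noteq> {}")
    case True
    then obtain i y where i: "dist x y < 2" "dist (c i) y < 1" by auto
    have "ball x 2 \<inter> balls N \<subseteq> ball (c i) 1"
    proof
      fix z assume "z \<in> ball x 2 \<inter> balls N"
      then obtain j where j: "dist x z < 2" "dist (c j) z < 1" by (auto simp: balls_def c_def)
      have "dist (c i) (c j) < 10"
        using dist_triangle[of "c i" "c j" y] dist_triangle[of y "c j" x] dist_triangle[of x "c j" z] i j
        by (simp add: dist_commute)
      then have "i = j" using center_dist[of i j, where 'a='a] by (auto simp: c_def)
      then show "z \<in> ball (c i) 1" using j by simp
    qed
    then show ?thesis by blast
  next
    case False
    then have "ball x 2 \<inter> balls N = {}" by (auto simp: balls_def c_def)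
    then show ?thesis by auto
  qed
  then obtain i where i: "ball x 2 \<inter> balls N \<subseteq> ball (c i) 1" by blast
  have "measure lborel (ball x 2 \<inter> balls N) \<le> measure lborel (ball (c i) 1)"
  proof (rule measure_mono_fmeasurable[OF i])
    show "ball (c i) 1 \<in> fmeasurable lborel"
      by (rule fmeasurableI) (use emeasure_bounded_finite[OF bounded_ball, of "c i" 1] in auto)
  qed (use open_balls[of N, where 'a='a] in auto)
  also have "\<dots> = measure lborel (ball (0::'a) 1)" by (rule measure_ball_translate)
  also have "\<dots> \<le> measure lborel (ball (0::'a) 2) / 2"
  proof -
    have "2 ^ 1 \<le> (2::real) ^ DIM('a)" by (intro power_increasing) (auto simp: Suc_leI)
    then have "2 * measure lborel (ball (0::'a) 1) \<le> 2 ^ DIM('a) * measure lborel (ball (0::'a) 1)"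
      by (intro mult_right_mono) auto
    then show ?thesis using content_ball_conv_unit_ball[of 2 "0::'a"] by simp
  qed
  finally show "measure lborel (ball x 2 \<inter> balls N) \<le> measure lborel (ball (0::'a) 2) / 2" .
qed simp

lemma xi_integral_pos: "0 < integral\<^sup>L lborel (xi :: 'a::euclidean_space \<Rightarrow> real)"
proof (rule continuous_nonneg_integral_pos[where a=0])
  show "continuous_on UNIV (xi :: 'a \<Rightarrow> real)"
    unfolding xi_def[abs_def] by (intro continuous_intros continuous_on_eta) auto
qed (auto simp: xi_integrable, simp add: xi_def eta_def)

lemma balls_lower_bounds:
  obtains \<kappa> where "\<kappa> > 0"
    "\<And>N p. N > 0 \<Longrightarrow> 1 \<le> p \<Longrightarrow> \<kappa> * measure lebesgue (balls N :: 'a::euclidean_space set) powr (1 / p) \<le> Tp (balls N :: 'a set) p"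
    "\<And>N. N > 0 \<Longrightarrow> \<kappa> \<le> Tinf (balls N :: 'a set)"
    "\<And>N. N > 0 \<Longrightarrow> 1 / 8 \<le> lambda1 (balls N :: 'a set)"
proof -
  define w e where "w = measure lborel (ball (0::'a) 1)"
    and "e = (1/2) ^ DIM('a) * xi_mass TYPE('a)"
  have w: "w > 0" by (simp add: w_def content_ball_pos)
  have e: "e > 0" by (simp add: e_def xi_integral_pos)
  \<comment> \<open>The maximum over \<tau> of
    \<open>(2 * \<tau> * N * e - 4 * \<tau>\<^sup>2 * N * w) / (N * w)\<close>, attained at
    \<open>\<tau> = e / (4 * w)\<close>.\<close>
  define \<kappa> where "\<kappa> = e\<^sup>2 / (4 * w\<^sup>2)"
  have k: "\<kappa> > 0" using w e by (simp add: \<kappa>_def)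
  have main: "\<exists>v g. torsion_sol (balls N :: 'a set) v g \<and> \<kappa> * measure lebesgue (balls N :: 'a set) \<le> (\<integral>x. v x \<partial>lebesgue_on (balls N))"
    if N: "N > 0" for N
  proof -
    interpret admissible_domain "balls N :: 'a set" by unfold_locales (rule admissible_balls[OF N])
    obtain v g where T: "torsion_sol (balls N :: 'a set) v g" using torsion_exists by blast
    have V: "measure lebesgue (balls N :: 'a set) = real N * w"
      by (simp add: measure_lebesgue_balls w_def)
    define \<tau> where "\<tau> = e / (4 * w)"
    have "2 * \<tau> * (real N * e) - 4 * \<tau>\<^sup>2 * measure lebesgue (balls N :: 'a set) \<le> (\<integral>x. v x \<partial>M)"
      unfolding e_def
    proof (rule torsion_integral_ge_of_balls[OF T, where c=center])
      show "ball (center i) 1 \<subseteq> balls N" if "i < N" for i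
        using that by (auto simp: balls_def)
    qed (rule balls_disjoint)
    moreover have "2 * \<tau> * (real N * e) - 4 * \<tau>\<^sup>2 * measure lebesgue (balls N :: 'a set) = \<kappa> * measure lebesgue (balls N :: 'a set)"
      unfolding V \<kappa>_def \<tau>_def using w by (simp add: field_simps power2_eq_square)
    ultimately show ?thesis using T by auto
  qed
  show ?thesis
  \<comment> \<open>Halved because of \<open>Tp_ge\<close>; the bound on \<open>Tinf\<close> alone
    would hold with \<kappa>.\<close>
  proof (rule that[of "\<kappa> / 2"])
    fix N :: nat assume N: "N > 0"
    interpret admissible_domain "balls N :: 'a set" by unfold_locales (rule admissible_balls[OF N])
    obtain v g where T: "torsion_sol (balls N :: 'a set) v g" "\<kappa> * measure lebesgue (balls N :: 'a set) \<le> (\<integral>x. v x \<partial>M)"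
      using main[OF N] by blast
    show "\<kappa> / 2 * measure lebesgue (balls N :: 'a set) powr (1 / p) \<le> Tp (balls N :: 'a set) p" if "1 \<le> p" for p
      by (rule Tp_ge[OF that T(1) k T(2)])
    show "\<kappa> / 2 \<le> Tinf (balls N :: 'a set)" using Tinf_ge[OF T] k by simp
    show "1 / 8 \<le> lambda1 (balls N :: 'a set)" using lambda1_ge[OF half_empty_balls] by simp
  qed (use k in simp)
qed

text \<open>As in \<open>F_le\<close>, \<open>A\<close> covers finite and infinite p at once. The
  volume moves to the numerator with the exponent \<open>2 / m * (q - 1)\<close>, positive here,
  which produces the growth in \<open>N\<close>.\<close>

lemma F_unbounded:
  fixes A \<kappa> q :: real
  assumes q: "q > 1" and k: "\<kappa> > 0" and N: "N > 0"
    and l: "1 / 8 \<le> lambda1 (balls N :: 'a::euclidean_space set)" and A: "A > 0"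
    and T: "\<kappa> * A \<le> T"
  shows "\<kappa> * (1/8) powr q * (real N * measure lborel (ball (0::'a) 1)) powr (2 / real DIM('a) * (q - 1))
     \<le> T * lambda1 (balls N :: 'a set) powr q / (A * measure lebesgue (balls N :: 'a set) powr (2 / real DIM('a) * (1 - q)))"
proof -
  define V where "V = real N * measure lborel (ball (0::'a) 1)"
  define B where "B = V powr (2 / real DIM('a) * (1 - q))"
  have V: "V > 0" using N by (simp add: V_def content_ball_pos)
  have Veq: "measure lebesgue (balls N :: 'a set) = V"
    by (simp add: measure_lebesgue_balls V_def)
  have B: "B > 0" using V by (simp add: B_def)
  have inv: "V powr (2 / real DIM('a) * (q - 1)) = 1 / B"
  proof -
    have "d * (q - 1) = - (d * (1 - q))" for d :: real by (simp add: right_diff_distrib)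
    then show ?thesis unfolding B_def by (simp only: powr_minus_divide)
  qed
  have "(\<kappa> * A) * (1/8) powr q \<le> T * lambda1 (balls N :: 'a set) powr q"
    using T l q k A by (intro mult_mono powr_mono2) (auto intro: order_trans[OF _ T])
  then have "(\<kappa> * A) * (1/8) powr q / (A * B) \<le> T * lambda1 (balls N :: 'a set) powr q / (A * B)"
    using A B by (intro divide_right_mono) auto
  then show ?thesis
    unfolding Veq V_def[symmetric] inv B_def[symmetric] using A by simp
qed

lemma ereal_SUP_unbounded:
  fixes f :: "'b \<Rightarrow> real" and c w s :: real
  assumes "c > 0" "w > 0" "s > 0" "\<And>N::nat. N > 0 \<Longrightarrow> X N \<in> S \<and> c * (real N * w) powr s \<le> f (X N)"
  shows "(SUP x\<in>S. ereal (f x)) = \<infinity>"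
proof (rule ereal_top)
  fix B :: real
  \<comment> \<open>The maximum with 1 keeps \<open>y\<close> positive also for negative
    \<open>B\<close>, so that taking the root and the power back is legitimate.\<close>
  define y where "y = max 1 (B / c)"
  obtain N :: nat where N: "y powr (1 / s) / w < real N" using reals_Archimedean2 by blast
  have y: "y \<ge> 1" by (simp add: y_def)
  have "0 \<le> y powr (1 / s) / w" using assms(2) by simp
  then have N0: "N > 0" using N by (cases N) auto
  have "y powr (1 / s) \<le> real N * w" using N assms(2) by (simp add: field_simps)
  then have "(y powr (1 / s)) powr s \<le> (real N * w) powr s" using assms(3) by (intro powr_mono2) auto
  then have "y \<le> (real N * w) powr s" using assms(3) y by (simp add: powr_powr)
  then have "c * y \<le> c * (real N * w) powr s" using assms(1) by simp
  moreover have "B \<le> c * y" using assms(1) by (simp add: y_def max_def field_simps)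
  ultimately have "B \<le> f (X N)" using assms(4)[OF N0] by linarith
  then have "ereal B \<le> ereal (f (X N))" by simp
  also have "\<dots> \<le> (SUP x\<in>S. ereal (f x))" using assms(4)[OF N0] by (intro SUP_upper) auto
  finally show "ereal B \<le> (SUP x\<in>S. ereal (f x))" .
qed

theorem theorem5:
  fixes q :: real
  shows "(\<forall>p::real. 1 \<le> p \<longrightarrow> (supFpq TYPE('a::euclidean_space) p q < \<infinity> \<longleftrightarrow> q \<le> 1)) \<and>
         (supFinfq TYPE('a::euclidean_space) q < \<infinity> \<longleftrightarrow> q \<le> 1)"
proof -
  define C where "C = torsion_const TYPE('a) * faber_const TYPE('a) q"
  have up: "supFpq TYPE('a) p q < \<infinity>" if "q \<le> 1" "1 \<le> p" for p
  proof -
    have "supFpq TYPE('a) p q \<le> ereal C"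
      unfolding supFpq_def C_def
      by (intro SUP_least) (use admissible_domain.Fpq_le[OF admissible_domain.intro, OF _ that] in auto)
    then show ?thesis by (rule order_le_less_trans) simp
  qed
  have upi: "supFinfq TYPE('a) q < \<infinity>" if "q \<le> 1"
  proof -
    have "supFinfq TYPE('a) q \<le> ereal C"
      unfolding supFinfq_def C_def
      by (intro SUP_least) (use admissible_domain.Finfq_le[OF admissible_domain.intro, OF _ that] in auto)
    then show ?thesis by (rule order_le_less_trans) simp
  qed
  obtain \<kappa> where k: "\<kappa> > 0"
    "\<And>N p. N > 0 \<Longrightarrow> 1 \<le> p \<Longrightarrow> \<kappa> * measure lebesgue (balls N :: 'a set) powr (1 / p) \<le> Tp (balls N :: 'a set) p"
    "\<And>N. N > 0 \<Longrightarrow> \<kappa> \<le> Tinf (balls N :: 'a set)"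
    "\<And>N. N > 0 \<Longrightarrow> 1 / 8 \<le> lambda1 (balls N :: 'a set)"
    using balls_lower_bounds[where 'a='a] by blast
  have w: "measure lborel (ball (0::'a) 1) > 0" by (simp add: content_ball_pos)
  have c: "\<kappa> * (1/8) powr q > 0" using k(1) by simp
  have V0: "measure lebesgue (balls N :: 'a set) > 0" if "N > 0" for N
    using admissible_domain.measure_domain_pos[OF admissible_domain.intro[OF admissible_balls[OF that]]] .
  have down: "supFpq TYPE('a) p q = \<infinity>" if q: "q > 1" and p: "1 \<le> p" for p
    unfolding supFpq_def
  proof (rule ereal_SUP_unbounded[OF c w])
    show "2 / real DIM('a) * (q - 1) > 0" using q by simp
    fix N :: nat assume N: "N > 0"
    show "(balls N :: 'a set) \<in> {\<Omega>. admissible \<Omega>} \<and> \<kappa> * (1 / 8) powr q * (real N * measure lborel (ball (0::'a) 1)) powr (2 / real DIM('a) * (q - 1)) \<le> Fpq (balls N :: 'a set) p q"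
      using F_unbounded[OF q k(1) N k(4)[OF N] _ k(2)[OF N p]] V0[OF N] admissible_balls[OF N]
      by (simp add: Fpq_def powr_add)
  qed
  have downi: "supFinfq TYPE('a) q = \<infinity>" if q: "q > 1"
    unfolding supFinfq_def
  proof (rule ereal_SUP_unbounded[OF c w])
    show "2 / real DIM('a) * (q - 1) > 0" using q by simp
    fix N :: nat assume N: "N > 0"
    show "(balls N :: 'a set) \<in> {\<Omega>. admissible \<Omega>} \<and> \<kappa> * (1 / 8) powr q * (real N * measure lborel (ball (0::'a) 1)) powr (2 / real DIM('a) * (q - 1)) \<le> Finfq (balls N :: 'a set) q"
      using F_unbounded[OF q k(1) N k(4)[OF N], of 1 "Tinf (balls N :: 'a set)"] k(3)[OF N] admissible_balls[OF N]
      by (simp add: Finfq_def)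
  qed
  show ?thesis
    using up upi down downi by (metis less_irrefl not_le)
qed

end
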